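(* Let $c>1$ be a constant and $\alpha_n=\frac{c\log n}{n}$. For each $n\ge1$ let $A(n)$ be an $\alpha_n$-balanced random matrix in $\mathfrak{M}_n(\mathbb{Z})$, where $\mathfrak{M}_n$ is one of $\mathrm{M}_n,\mathrm{Sym}_n,\mathrm{Alt}_n$. Then for every finite abelian group $G$, $\lim_{n\to\infty}\mathbb{E}(\#\mathrm{Sur}(\mathrm{cok}(A(n)),G))$ equals $1$ if $\mathfrak{M}_n=\mathrm{M}_n$, $|\wedge^2G|$ if $\mathfrak{M}_n=\mathrm{Sym}_n$, and $|\mathrm{Sym}^2G|$ if $\mathfrak{M}_n=\mathrm{Alt}_n$.
   Context: For $\alpha\in(0,1/2]$, a random element $x$ of $\mathbb{F}_p$ is $\alpha$-balanced if $\mathbb{P}(x=r)\le1-\alpha$ for all $r$. A random matrix in $\mathrm{M}_n(\mathbb{F}_p)$ (resp. $\mathrm{Sym}_n(\mathbb{F}_p)$, $\mathrm{Alt}_n(\mathbb{F}_p)$) is $\alpha$-balanced if its entries (resp. upper triangular, strictly upper triangular entries) are independent and $\alpha$-balanced. A random matrix in $\mathfrak{M}_n(\mathbb{Z})$ is $\alpha$-balanced if its reduction modulo $p$ is $\alpha$-balanced in $\mathfrak{M}_n(\mathbb{F}_p)$ for every prime $p$. $\mathrm{cok}(A)=\mathbb{Z}^n/A\mathbb{Z}^n$. $\mathrm{Sur}(X,G)$ is the set of surjective homomorphisms $X\to G$. $\wedge^2G$ and $\mathrm{Sym}^2G$ are the quotients of $G\otimes G$ by the subgroups generated by $g\otimes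 g$, resp. $g_1\otimes g_2-g_2\otimes g_1$. *)

theory Defs
  imports
    "HOL-Probability.Probability"
    "HOL-Number_Theory.Residues"
    "HOL-Algebra.IntRing"
    "HOL-Algebra.Free_Abelian_Groups"
    "HOL-Algebra.Generated_Groups"
    "Jordan_Normal_Form.Matrix"
begin

datatype mat_kind = General | Symmetric | Alternating

definition mat_space :: "mat_kind \<Rightarrow> ('a, 'm) ring_scheme \<Rightarrow> nat \<Rightarrow> 'a mat set" where
  "mat_space K R n =
     {A \<in> carrier_mat n n.
        (\<forall>i<n. \<forall>j<n. A $$ (i, j) \<in> carrier R) \<and>
        (case K of
           General \<Rightarrow> True
         | Symmetric \<Rightarrow> (\<forall>i<n. \<forall>j<n. A $$ (j, i) = A $$ (i, j))
         | Alternating \<Rightarrow> (\<forall>i<n. A $$ (i, i) = \<zero>\<^bsub>R\<^esub>) \<and>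
                          (\<forall>i<n. \<forall>j<n. A $$ (j, i) = \<ominus>\<^bsub>R\<^esub> (A $$ (i, j))))}"

definition free_entries :: "mat_kind \<Rightarrow> nat \<Rightarrow> (nat \<times> nat) set" where
  "free_entries K n =
     (case K of
        General \<Rightarrow> {(i, j). i < n \<and> j < n}
      | Symmetric \<Rightarrow> {(i, j). i \<le> j \<and> j < n}
      | Alternating \<Rightarrow> {(i, j). i < j \<and> j < n})"

definition random_matrix ::
  "'w measure \<Rightarrow> mat_kind \<Rightarrow> ('a, 'm) ring_scheme \<Rightarrow> nat \<Rightarrow> ('w \<Rightarrow> 'a mat) \<Rightarrow> bool" where
  "random_matrix M K R n B \<longleftrightarrow> B \<in> measurable M (count_space (mat_space K R n))"

text \<open>For a prime \<open>p\<close>, the field with \<open>p\<close> elements is \<open>residue_ring p\<close>, whose carrier is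
  the set of integers \<open>{0..p - 1}\<close>.\<close>

definition balanced_elem :: "'w measure \<Rightarrow> real \<Rightarrow> int \<Rightarrow> ('w \<Rightarrow> int) \<Rightarrow> bool" where
  "balanced_elem M \<alpha> p X \<longleftrightarrow>
     X \<in> measurable M (count_space (carrier (residue_ring p))) \<and>
     (\<forall>r \<in> carrier (residue_ring p). measure M {\<omega> \<in> space M. X \<omega> = r} \<le> 1 - \<alpha>)"

definition balanced_mat_mod ::
  "'w measure \<Rightarrow> real \<Rightarrow> mat_kind \<Rightarrow> int \<Rightarrow> nat \<Rightarrow> ('w \<Rightarrow> int mat) \<Rightarrow> bool" where
  "balanced_mat_mod M \<alpha> K p n B \<longleftrightarrow>
     random_matrix M K (residue_ring p) n B \<and>
     prob_space.indep_vars M (\<lambda>_. count_space (carrier (residue_ring p)))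
       (\<lambda>ij \<omega>. B \<omega> $$ ij) (free_entries K n) \<and>
     (\<forall>ij \<in> free_entries K n. balanced_elem M \<alpha> p (\<lambda>\<omega>. B \<omega> $$ ij))"

definition balanced_mat ::
  "'w measure \<Rightarrow> real \<Rightarrow> mat_kind \<Rightarrow> nat \<Rightarrow> ('w \<Rightarrow> int mat) \<Rightarrow> bool" where
  "balanced_mat M \<alpha> K n A \<longleftrightarrow>
     random_matrix M K int_ring n A \<and>
     (\<forall>p::int. prime p \<longrightarrow>
        balanced_mat_mod M \<alpha> K p n (\<lambda>\<omega>. map_mat (\<lambda>a. a mod p) (A \<omega>)))"

definition cok :: "nat \<Rightarrow> int mat \<Rightarrow> int vec set monoid" where
  "cok n A = monoid_vec TYPE(int) n Mod ((\<lambda>v. A *\<^sub>v v) ` carrier_vec n)"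

text \<open>Functions are total in HOL; restricting to extensional ones makes each surjective
  homomorphism be counted exactly once.\<close>

definition Sur :: "('a, 'm) monoid_scheme \<Rightarrow> ('b, 'k) monoid_scheme \<Rightarrow> ('a \<Rightarrow> 'b) set" where
  "Sur X G = epi X G \<inter> extensional (carrier X)"

text \<open>Tensor product of abelian groups (written multiplicatively): the free abelian group on
  pairs modulo the bilinearity relations.\<close>

definition tensor_relations ::
  "('a, 'm) monoid_scheme \<Rightarrow> ('b, 'k) monoid_scheme \<Rightarrow> ('a \<times> 'b \<Rightarrow>\<^sub>0 int) set" where
  "tensor_relations G H =
     {frag_of (x \<otimes>\<^bsub>G\<^esub> x', y) - frag_of (x, y) - frag_of (x', y) | x x' y.
        x \<in> carrier G \<and> x' \<in> carrier G \<and> y \<in> carrier H} \<union>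
     {frag_of (x, y \<otimes>\<^bsub>H\<^esub> y') - frag_of (x, y) - frag_of (x, y') | x y y'.
        x \<in> carrier G \<and> y \<in> carrier H \<and> y' \<in> carrier H}"

definition tensor_kernel ::
  "('a, 'm) monoid_scheme \<Rightarrow> ('b, 'k) monoid_scheme \<Rightarrow> ('a \<times> 'b \<Rightarrow>\<^sub>0 int) set" where
  "tensor_kernel G H =
     generate (free_Abelian_group (carrier G \<times> carrier H)) (tensor_relations G H)"

definition tensor_group ::
  "('a, 'm) monoid_scheme \<Rightarrow> ('b, 'k) monoid_scheme \<Rightarrow> ('a \<times> 'b \<Rightarrow>\<^sub>0 int) set monoid" where
  "tensor_group G H = free_Abelian_group (carrier G \<times> carrier H) Mod tensor_kernel G H"

definition pure_tensor ::
  "('a, 'm) monoid_scheme \<Rightarrow> ('b, 'k) monoid_scheme \<Rightarrow> 'a \<Rightarrow> 'b \<Rightarrow> ('a \<times> 'b \<Rightarrow>\<^sub>0 int) set" where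
  "pure_tensor G H x y =
     tensor_kernel G H #>\<^bsub>free_Abelian_group (carrier G \<times> carrier H)\<^esub> frag_of (x, y)"

definition wedge_square ::
  "('a, 'm) monoid_scheme \<Rightarrow> ('a \<times> 'a \<Rightarrow>\<^sub>0 int) set set monoid" where
  "wedge_square G =
     tensor_group G G Mod
       generate (tensor_group G G) {pure_tensor G G g g | g. g \<in> carrier G}"

definition sym_square ::
  "('a, 'm) monoid_scheme \<Rightarrow> ('a \<times> 'a \<Rightarrow>\<^sub>0 int) set set monoid" where
  "sym_square G =
     tensor_group G G Mod
       generate (tensor_group G G)
         {pure_tensor G G g h \<otimes>\<^bsub>tensor_group G G\<^esub> inv\<^bsub>tensor_group G G\<^esub> pure_tensor G G h g
          | g h. g \<in> carrier G \<and> h \<in> carrier G}"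

end

theory Submission
  imports Defs "HOL-Real_Asymp.Real_Asymp"
begin

text \<open>
  A surjection from the cokernel to \<open>G\<close> is a generating tuple \<open>f \<in> G\<^sup>n\<close> with \<open>f A = 0\<close>. Expanding the
  indicator of \<open>f A = 0\<close> over tuples \<open>C\<close> of characters of \<open>G\<close> and putting \<open>u\<^sub>i = (f\<^sub>i, C\<^sub>i)\<close>, the
  expected number of surjections becomes \<open>|G|\<^sup>-\<^sup>n\<close> times a sum over \<open>u\<close> of products of characteristic functions
  of the entries, evaluated at a bilinear form \<open>B (u\<^sub>i, u\<^sub>j)\<close> on \<open>V = G \<times> G\<^sup>*\<close>. The \<open>u\<close> on which all factors
  are trivial give the main term: for fixed generating \<open>f\<close> they correspond to the characters of the
  trivial group, of \<open>\<and>\<^sup>2 G\<close> and of \<open>Sym\<^sup>2 G\<close> respectively.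

  For the remaining \<open>u\<close>, two non-orthogonal values that are both taken often make the product
  superexponentially small. Otherwise all but \<open>o(n)\<close> of the \<open>u\<^sub>i\<close> lie in an isotropic subgroup \<open>W\<close>. If
  \<open>|W| < |G|\<close> there are too few such \<open>u\<close>. If \<open>|W| = |G|\<close> then \<open>W\<close> is its own orthogonal complement, and averaging
  over \<open>W\<close> the product of the factors of \<open>s\<close> outliers gives at most \<open>((1 + (1 - 2 \<beta>)\<^sup>s) / 2)\<^sup>1\<^sup>/\<^sup>2\<close> with
  \<open>\<beta> = 2 \<alpha> (1 - \<alpha>)\<close>, since squared characteristic functions are convex combinations of characters of \<open>W\<close>.
  Over the \<open>n\<close> rows this is about \<open>n\<^sup>-\<^sup>c\<^sup>s\<close>, which beats the choice of the outliers because \<open>c > 1\<close>.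
\<close>

section \<open>Characters of finite abelian groups\<close>

text \<open>The hypothesis \<open>c > 1\<close> leaves no constant to waste. Bounding each factor
  separately, as in \<open>cmod_char_fun_bound\<close>, loses the factor \<open>root_gap\<close>,
  which depends on |G|; that bound is therefore used only where superexponential decay is available.
  For outliers of a self-orthogonal W the average over W sees only collision probabilities, not the
  position of the roots of unity. Passing to squared factors and back costs nothing to first order:
  (1 - 2\<beta>)^s is about 1 - 4 \<alpha> s, half of the loss enters the mean, and the square root
  halves it again. This leaves 1 - \<alpha> s per row, hence n^(-c s) over all rows, against at most
  n^s choices of the outliers. A second obstacle is that the hypotheses speak only of reductions
  modulo primes, whereas the characters of G see the entries modulo |G|, which need not be
  squarefree. For the law of one entry it suffices that a root of unity of order m separates
  residues modulo any prime dividing m. Joint independence modulo |G| is recovered from arbitrarily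
  large primes.\<close>

definition circle_group :: "complex monoid" where
  "circle_group = \<lparr>carrier = {z. cmod z = 1}, mult = (*), one = 1\<rparr>"

lemma circle_group_simps [simp]:
  "carrier circle_group = {z. cmod z = 1}" "x \<otimes>\<^bsub>circle_group\<^esub> y = x * y" "\<one>\<^bsub>circle_group\<^esub> = 1"
  by (auto simp: circle_group_def)

lemma comm_group_circle [simp]: "comm_group circle_group"
proof (rule comm_groupI)
  fix x assume "x \<in> carrier circle_group"
  then show "\<exists>y\<in>carrier circle_group. y \<otimes>\<^bsub>circle_group\<^esub> x = \<one>\<^bsub>circle_group\<^esub>"
    by (intro bexI[of _ "inverse x"]) (auto simp: norm_inverse, metis left_inverse norm_zero zero_neq_one)
qed (auto simp: norm_mult)

lemma group_circle [simp]: "group circle_group"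
  by (simp add: comm_group.axioms(2))

text \<open>Extensionality makes characters that agree on the carrier equal, so that they can be
  counted.\<close>

definition chars :: "('a, 'm) monoid_scheme \<Rightarrow> ('a \<Rightarrow> complex) set" where
  "chars G = hom G circle_group \<inter> extensional (carrier G)"

lemma charsI:
  assumes "\<And>x. x \<in> carrier G \<Longrightarrow> cmod (f x) = 1"
    and "\<And>x y. x \<in> carrier G \<Longrightarrow> y \<in> carrier G \<Longrightarrow> f (x \<otimes>\<^bsub>G\<^esub> y) = f x * f y"
    and "group G"
  shows "restrict f (carrier G) \<in> chars G"
proof -
  interpret group G by fact
  show ?thesis
    using assms by (auto simp: chars_def hom_def)
qed

lemma
  assumes "\<xi> \<in> chars G"
  shows chars_norm: "x \<in> carrier G \<Longrightarrow> cmod (\<xi> x) = 1"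
    and chars_mult: "x \<in> carrier G \<Longrightarrow> y \<in> carrier G \<Longrightarrow> \<xi> (x \<otimes>\<^bsub>G\<^esub> y) = \<xi> x * \<xi> y"
    and chars_extensional: "\<xi> \<in> extensional (carrier G)"
  using assms by (auto simp: chars_def hom_def Pi_iff)

lemma chars_eqI:
  assumes "\<xi> \<in> chars G" "\<psi> \<in> chars G" "\<And>x. x \<in> carrier G \<Longrightarrow> \<xi> x = \<psi> x"
  shows "\<xi> = \<psi>"
  using assms by (intro extensionalityI[of _ "carrier G"]) (auto simp: chars_def)

lemma chars_nonzero: "\<xi> \<in> chars G \<Longrightarrow> x \<in> carrier G \<Longrightarrow> \<xi> x \<noteq> 0"
  using chars_norm[of \<xi> G x] by auto

lemma chars_one:
  assumes "group G" "\<xi> \<in> chars G"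
  shows "\<xi> \<one>\<^bsub>G\<^esub> = 1"
  using hom_one[of \<xi> G circle_group] assms by (auto simp: chars_def)

lemma chars_pow:
  assumes "group G" "\<xi> \<in> chars G" "x \<in> carrier G"
  shows "\<xi> (x [^]\<^bsub>G\<^esub> (k::nat)) = \<xi> x ^ k"
proof -
  interpret group G by fact
  show ?thesis
    using assms by (induction k) (auto simp: chars_one chars_mult)
qed

lemma chars_inv:
  assumes "group G" "\<xi> \<in> chars G" "x \<in> carrier G"
  shows "\<xi> (inv\<^bsub>G\<^esub> x) = inverse (\<xi> x)"
proof -
  interpret group G by fact
  have "\<xi> (inv\<^bsub>G\<^esub> x) * \<xi> x = 1"
    using assms by (metis chars_mult chars_one inv_closed l_inv)
  then show ?thesis
    by (metis inverse_unique mult.commute)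
qed

lemma cnj_eq_inverse: "cmod z = 1 \<Longrightarrow> cnj z = inverse z"
  by (metis complex_norm_square inverse_unique of_real_1 power_one)

lemma chars_pow_order:
  assumes "group G" "finite (carrier G)" "\<xi> \<in> chars G" "x \<in> carrier G"
  shows "\<xi> x ^ order G = 1"
proof -
  interpret group G by fact
  show ?thesis
    using assms by (metis chars_one chars_pow pow_order_eq_1)
qed

lemma finite_chars:
  assumes "group G" "finite (carrier G)"
  shows "finite (chars G)"
proof (rule finite_subset)
  interpret group G by fact
  have "order G > 0"
    using assms by (simp add: order_gt_0_iff_finite)
  then show "finite (carrier G \<rightarrow>\<^sub>E {z::complex. z ^ order G = 1})"
    using assms by (intro finite_PiE finite_roots_unity) auto
  show "chars G \<subseteq> carrier G \<rightarrow>\<^sub>E {z. z ^ order G = 1}"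
  proof
    fix \<xi> assume "\<xi> \<in> chars G"
    then show "\<xi> \<in> carrier G \<rightarrow>\<^sub>E {z. z ^ order G = 1}"
      using assms chars_extensional[of \<xi> G] by (simp add: PiE_iff chars_pow_order)
  qed
qed

section \<open>The dual group\<close>

definition triv_char :: "('a, 'm) monoid_scheme \<Rightarrow> 'a \<Rightarrow> complex" where
  "triv_char G = (\<lambda>x\<in>carrier G. 1)"

definition char_group :: "('a, 'm) monoid_scheme \<Rightarrow> ('a \<Rightarrow> complex) monoid" where
  "char_group G = \<lparr>carrier = chars G, mult = (\<lambda>\<xi> \<psi>. \<lambda>x\<in>carrier G. \<xi> x * \<psi> x), one = triv_char G\<rparr>"

lemma char_group_simps [simp]:
  "carrier (char_group G) = chars G"
  "\<xi> \<otimes>\<^bsub>char_group G\<^esub> \<psi> = (\<lambda>x\<in>carrier G. \<xi> x * \<psi> x)"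
  "\<one>\<^bsub>char_group G\<^esub> = triv_char G"
  by (auto simp: char_group_def)

lemma triv_char_in_chars [simp]: "group G \<Longrightarrow> triv_char G \<in> chars G"
  unfolding triv_char_def by (rule charsI) auto

lemma chars_times_closed:
  assumes "group G" "\<xi> \<in> chars G" "\<psi> \<in> chars G"
  shows "(\<lambda>x\<in>carrier G. \<xi> x * \<psi> x) \<in> chars G"
  using assms by (intro charsI) (auto simp: chars_norm chars_mult norm_mult)

lemma chars_cnj_closed:
  assumes "group G" "\<xi> \<in> chars G"
  shows "(\<lambda>x\<in>carrier G. cnj (\<xi> x)) \<in> chars G"
  using assms by (intro charsI) (auto simp: chars_norm chars_mult)

lemma comm_group_char_group:
  assumes "group G"
  shows "comm_group (char_group G)"
proof (rule comm_groupI)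
  interpret group G by fact
  fix \<xi> assume "\<xi> \<in> carrier (char_group G)"
  then show "\<exists>\<psi>\<in>carrier (char_group G). \<psi> \<otimes>\<^bsub>char_group G\<^esub> \<xi> = \<one>\<^bsub>char_group G\<^esub>"
    using assms
    by (intro bexI[of _ "\<lambda>x\<in>carrier G. cnj (\<xi> x)"])
       (auto simp: chars_cnj_closed triv_char_def cnj_eq_inverse chars_norm chars_nonzero intro!: restrict_ext)
  show "\<one>\<^bsub>char_group G\<^esub> \<otimes>\<^bsub>char_group G\<^esub> \<xi> = \<xi>"
    using \<open>\<xi> \<in> carrier (char_group G)\<close>
    by (auto simp: triv_char_def fun_eq_iff chars_def restrict_def extensional_def)
qed (use assms in \<open>auto simp: chars_times_closed mult_ac intro!: restrict_ext\<close>)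

section \<open>Orthogonality for one character\<close>

lemma sum_char:
  assumes "group G" "finite (carrier G)" "\<xi> \<in> chars G"
  shows "(\<Sum>x\<in>carrier G. \<xi> x) = (if \<forall>x\<in>carrier G. \<xi> x = 1 then of_nat (order G) else 0)"
proof (cases "\<forall>x\<in>carrier G. \<xi> x = 1")
  case True
  then show ?thesis by (simp add: order_def)
next
  case False
  interpret group G by fact
  from False obtain y where y: "y \<in> carrier G" "\<xi> y \<noteq> 1" by blast
  have "(\<Sum>x\<in>carrier G. \<xi> x) = (\<Sum>x\<in>carrier G. \<xi> (y \<otimes>\<^bsub>G\<^esub> x))"
    using sum.reindex_bij_betw[of "\<lambda>x. y \<otimes>\<^bsub>G\<^esub> x" "carrier G" "carrier G" \<xi>]
    by (metis (no_types, lifting) bij_betw_def inj_on_multc inj_on_cmult y(1) surj_const_mult)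
  also have "\<dots> = \<xi> y * (\<Sum>x\<in>carrier G. \<xi> x)"
    using assms y by (simp add: chars_mult sum_distrib_left)
  finally have "(\<xi> y - 1) * (\<Sum>x\<in>carrier G. \<xi> x) = 0"
    by (simp add: algebra_simps)
  with y False show ?thesis by (metis mult_eq_0_iff right_minus_eq)
qed

section \<open>Extension of characters from subgroups\<close>

lemma (in group) finite_subgroupI:
  assumes "finite (carrier G)" "H \<subseteq> carrier G" "H \<noteq> {}" "\<And>a b. a \<in> H \<Longrightarrow> b \<in> H \<Longrightarrow> a \<otimes> b \<in> H"
  shows "subgroup H G"
proof (rule subgroupI)
  fix a assume a: "a \<in> H"
  have pow: "a [^] (Suc k) \<in> H" for k :: nat
    using a assms by (induction k) auto
  have "order G > 0" using assms by (simp add: order_gt_0_iff_finite)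
  then obtain k where k: "order G = Suc k" using gr0_conv_Suc by blast
  have ac: "a \<in> carrier G" using a assms by blast
  \<comment> \<open>The exponent is 2|G| - 1 rather than |G| - 1: for the trivial group the latter
    is 0, and \<one> is not yet known to lie in H.\<close>
  have "a [^] (Suc (k + k)) \<in> H" by (rule pow)
  moreover have "a [^] (Suc (k + k)) \<otimes> a = \<one>"
  proof -
    have "a [^] (Suc (k + k)) \<otimes> a = a [^] (order G + order G)" by (simp add: k)
    also have "\<dots> = a [^] order G \<otimes> a [^] order G"
      using ac by (simp add: nat_pow_mult)
    also have "\<dots> = \<one>"
      using ac by (simp add: pow_order_eq_1)
    finally show ?thesis .
  qed
  ultimately show "inv a \<in> H"
    using inv_equality[of _ a] ac pow[of "k + k"] by (metis nat_pow_closed)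
qed (use assms in auto)

text \<open>The extension to the subgroup generated by H and g sends h g^k to \<xi>(h) z^k. Two
  expressions of one element differ by a power of g lying in H, hence by a multiple of m in the
  exponent, and the condition on \<open>z ^ m\<close> is exactly the compatibility this requires.
  Natural exponents suffice because G is finite.\<close>

lemma char_extend_step:
  assumes "comm_group G" "finite (carrier G)" "subgroup H G" "\<xi> \<in> chars (G\<lparr>carrier := H\<rparr>)"
    and g: "g \<in> carrier G" and m: "m > 0" "g [^]\<^bsub>G\<^esub> m \<in> H" "\<And>k. 0 < k \<Longrightarrow> g [^]\<^bsub>G\<^esub> k \<in> H \<Longrightarrow> m dvd (k::nat)"
    and z: "z ^ m = \<xi> (g [^]\<^bsub>G\<^esub> m)" "cmod z = 1"
  obtains H' \<xi>' where "subgroup H' G" "H \<subseteq> H'" "g \<in> H'" "\<xi>' \<in> chars (G\<lparr>carrier := H'\<rparr>)"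
    "\<And>h. h \<in> H \<Longrightarrow> \<xi>' h = \<xi> h" "\<xi>' g = z"
proof -
  interpret comm_group G by fact
  interpret H: subgroup H G by fact
  have grpH: "group (G\<lparr>carrier := H\<rparr>)"
    using assms(3) by (rule subgroup_imp_group)
  define H' where "H' = (\<lambda>(h,k). h \<otimes>\<^bsub>G\<^esub> g [^]\<^bsub>G\<^esub> (k::nat)) ` (H \<times> UNIV)"
  have \<xi>m: "\<xi> (x \<otimes>\<^bsub>G\<^esub> y) = \<xi> x * \<xi> y" if "x \<in> H" "y \<in> H" for x y
    using chars_mult[OF assms(4)] that by simp
  have \<xi>n: "cmod (\<xi> x) = 1" if "x \<in> H" for x
    using chars_norm[OF assms(4)] that by simp
  have \<xi>1: "\<xi> \<one>\<^bsub>G\<^esub> = 1"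
    using chars_one[OF grpH assms(4)] by simp
  have \<xi>p: "\<xi> (x [^]\<^bsub>G\<^esub> (k::nat)) = \<xi> x ^ k" if "x \<in> H" for x k
  proof -
    have "x [^]\<^bsub>G\<^esub> k \<in> H" for k :: nat
      using that by (induction k) auto
    then show ?thesis
      using that by (induction k) (auto simp: \<xi>m \<xi>1)
  qed
  have wd_aux: "\<xi> h * z ^ k = \<xi> h' * z ^ l"
    if "h \<in> H" "h' \<in> H" "h \<otimes>\<^bsub>G\<^esub> g [^]\<^bsub>G\<^esub> k = h' \<otimes>\<^bsub>G\<^esub> g [^]\<^bsub>G\<^esub> l" "k \<le> l" for h h' and k l :: nat
  proof -
    have hc: "h \<in> carrier G" "h' \<in> carrier G" using that by auto
    have "h \<otimes>\<^bsub>G\<^esub> g [^]\<^bsub>G\<^esub> k = h' \<otimes>\<^bsub>G\<^esub> g [^]\<^bsub>G\<^esub> (l - k) \<otimes>\<^bsub>G\<^esub> g [^]\<^bsub>G\<^esub> k"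
      using that g hc by (simp add: m_assoc nat_pow_mult)
    then have eq: "h = h' \<otimes>\<^bsub>G\<^esub> g [^]\<^bsub>G\<^esub> (l - k)"
      using g hc by simp
    have gH: "g [^]\<^bsub>G\<^esub> (l - k) \<in> H"
    proof -
      have "inv\<^bsub>G\<^esub> h' \<otimes>\<^bsub>G\<^esub> h = g [^]\<^bsub>G\<^esub> (l - k)"
        unfolding eq using g hc by (simp add: m_assoc[symmetric])
      then show ?thesis
        using that by (metis H.m_closed H.m_inv_closed)
    qed
    have "m dvd l - k"
      using gH m(3)[of "l - k"] by (cases "l - k = 0") auto
    then obtain q where q: "l - k = m * q" by blast
    have "\<xi> (g [^]\<^bsub>G\<^esub> (l - k)) = z ^ (l - k)"
      unfolding q using m(2) g z by (metis \<xi>p nat_pow_pow power_mult)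
    then have "\<xi> h = \<xi> h' * z ^ (l - k)"
      using eq \<xi>m[OF that(2) gH] by simp
    then show ?thesis
      using that(4) by (simp add: mult.assoc flip: power_add)
  qed
  have wd: "\<xi> h * z ^ k = \<xi> h' * z ^ l"
    if "h \<in> H" "h' \<in> H" "h \<otimes>\<^bsub>G\<^esub> g [^]\<^bsub>G\<^esub> k = h' \<otimes>\<^bsub>G\<^esub> g [^]\<^bsub>G\<^esub> l" for h h' and k l :: nat
    using wd_aux[of h h' k l] wd_aux[of h' h l k] that by (cases "k \<le> l") auto
  \<comment> \<open>The expression x = h g^k is picked by choice; \<open>wd\<close> makes the value
    independent of it.\<close>
  define f where "f x = (case (SOME p. p \<in> H \<times> (UNIV::nat set) \<and> x = fst p \<otimes>\<^bsub>G\<^esub> g [^]\<^bsub>G\<^esub> snd p) of (h, k) \<Rightarrow> \<xi> h * z ^ k)" for x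
  have f: "f (h \<otimes>\<^bsub>G\<^esub> g [^]\<^bsub>G\<^esub> k) = \<xi> h * z ^ k" if "h \<in> H" for h and k :: nat
  proof -
    let ?P = "\<lambda>p. p \<in> H \<times> (UNIV::nat set) \<and> h \<otimes>\<^bsub>G\<^esub> g [^]\<^bsub>G\<^esub> k = fst p \<otimes>\<^bsub>G\<^esub> g [^]\<^bsub>G\<^esub> snd p"
    have "?P (Eps ?P)"
      by (rule someI[of ?P "(h,k)"]) (use that in auto)
    then show ?thesis
      unfolding f_def using wd[of "fst (Eps ?P)" h "snd (Eps ?P)" k] that
      by (auto simp: split_beta)
  qed
  have mult: "(h \<otimes>\<^bsub>G\<^esub> g [^]\<^bsub>G\<^esub> k) \<otimes>\<^bsub>G\<^esub> (h' \<otimes>\<^bsub>G\<^esub> g [^]\<^bsub>G\<^esub> l) = (h \<otimes>\<^bsub>G\<^esub> h') \<otimes>\<^bsub>G\<^esub> g [^]\<^bsub>G\<^esub> (k + l)"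
    if "h \<in> H" "h' \<in> H" for h h' and k l :: nat
    using that g by (simp add: nat_pow_mult[symmetric] m_ac)
  have sub: "subgroup H' G"
  proof (rule finite_subgroupI)
    show "H' \<subseteq> carrier G" "H' \<noteq> {}" "finite (carrier G)"
      unfolding H'_def using g H.subset assms H.one_closed by auto
    fix a b assume "a \<in> H'" "b \<in> H'"
    then obtain h k h' l where "h \<in> H" "h' \<in> H" "a = h \<otimes>\<^bsub>G\<^esub> g [^]\<^bsub>G\<^esub> (k::nat)" "b = h' \<otimes>\<^bsub>G\<^esub> g [^]\<^bsub>G\<^esub> (l::nat)"
      unfolding H'_def by auto
    then show "a \<otimes>\<^bsub>G\<^esub> b \<in> H'"
      using mult unfolding H'_def by (auto intro!: image_eqI[of _ _ "(h \<otimes>\<^bsub>G\<^esub> h', k + l)"])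
  qed
  have grpH': "group (G\<lparr>carrier := H'\<rparr>)"
    using sub by (rule subgroup_imp_group)
  have HH': "H \<subseteq> H'"
    unfolding H'_def by (auto intro!: image_eqI[of _ _ "(x, 0)" for x])
  have gH': "g \<in> H'"
    unfolding H'_def using g by (auto intro!: image_eqI[of _ _ "(\<one>\<^bsub>G\<^esub>, 1)"])
  have "restrict f (carrier (G\<lparr>carrier := H'\<rparr>)) \<in> chars (G\<lparr>carrier := H'\<rparr>)"
  proof (rule charsI)
    show "group (G\<lparr>carrier := H'\<rparr>)" by fact
    show "cmod (f x) = 1" if "x \<in> carrier (G\<lparr>carrier := H'\<rparr>)" for x
      using that f \<xi>n z by (auto simp: H'_def norm_mult norm_power)
    show "f (x \<otimes>\<^bsub>G\<lparr>carrier := H'\<rparr>\<^esub> y) = f x * f y"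
      if "x \<in> carrier (G\<lparr>carrier := H'\<rparr>)" "y \<in> carrier (G\<lparr>carrier := H'\<rparr>)" for x y
      using that by (auto simp: H'_def mult f \<xi>m power_add)
  qed
  moreover have "f h = \<xi> h" if "h \<in> H" for h
    using f[OF that, of 0] that H.subset by auto
  moreover have "f g = z"
    using f[OF H.one_closed, of 1] g \<xi>1 by simp
  ultimately show thesis
    using that[of H' "restrict f H'"] sub HH' gH' by (auto simp: subset_iff)
qed

lemma exists_root_on_circle:
  assumes "m > 0" "cmod w = 1"
  obtains z where "z ^ m = w" "cmod z = 1"
proof
  have "w = cis (Arg w)"
    using assms(2) by (metis cis_Arg mult_1 norm_zero rcis_cmod_Arg rcis_def of_real_1)
  then show "cis (Arg w / m) ^ m = w" "cmod (cis (Arg w / m)) = 1"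
    using assms(1) Complex.DeMoivre[of "Arg w / m" m] by auto
qed

text \<open>This m is the order of g in G/H, found as a least exponent without forming the
  quotient.\<close>

lemma exists_order_mod_subgroup:
  assumes "comm_group G" "finite (carrier G)" "subgroup H G" "g \<in> carrier G"
  obtains m :: nat where "m > 0" "g [^]\<^bsub>G\<^esub> m \<in> H" "\<And>k. 0 < k \<Longrightarrow> g [^]\<^bsub>G\<^esub> k \<in> H \<Longrightarrow> m dvd (k::nat)"
proof -
  interpret comm_group G by fact
  interpret H: subgroup H G by fact
  define m where "m = (LEAST k. 0 < k \<and> g [^]\<^bsub>G\<^esub> (k::nat) \<in> H)"
  have ex: "0 < order G \<and> g [^]\<^bsub>G\<^esub> order G \<in> H"
    using assms by (simp add: order_gt_0_iff_finite pow_order_eq_1)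
  have m: "0 < m \<and> g [^]\<^bsub>G\<^esub> m \<in> H"
    unfolding m_def by (rule LeastI[of "\<lambda>k. 0 < k \<and> g [^]\<^bsub>G\<^esub> (k::nat) \<in> H", OF ex])
  have "m dvd k" if "0 < k" "g [^]\<^bsub>G\<^esub> k \<in> H" for k
  proof -
    have pow: "(g [^]\<^bsub>G\<^esub> m) [^]\<^bsub>G\<^esub> j \<in> H" for j :: nat
      using m by (induction j) auto
    have "g [^]\<^bsub>G\<^esub> k = (g [^]\<^bsub>G\<^esub> m) [^]\<^bsub>G\<^esub> (k div m) \<otimes>\<^bsub>G\<^esub> g [^]\<^bsub>G\<^esub> (k mod m)"
      using assms(4) by (simp add: nat_pow_pow nat_pow_mult)
    then have "g [^]\<^bsub>G\<^esub> (k mod m) = inv\<^bsub>G\<^esub> ((g [^]\<^bsub>G\<^esub> m) [^]\<^bsub>G\<^esub> (k div m)) \<otimes>\<^bsub>G\<^esub> g [^]\<^bsub>G\<^esub> k"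
      using assms(4) by (simp add: m_assoc[symmetric])
    then have "g [^]\<^bsub>G\<^esub> (k mod m) \<in> H"
      using pow that by (metis H.m_closed H.m_inv_closed)
    then have "\<not> 0 < k mod m"
      using not_less_Least[of "k mod m" "\<lambda>k. 0 < k \<and> g [^]\<^bsub>G\<^esub> (k::nat) \<in> H"] m
      unfolding m_def[symmetric] by auto
    then show ?thesis by auto
  qed
  then show thesis using m that by blast
qed

text \<open>The circle is divisible, so the required m-th root always exists and a character extends
  by one generator at a time; the number of elements outside H decreases.\<close>

lemma char_extend:
  assumes "comm_group G" "finite (carrier G)" "subgroup H G" "\<xi> \<in> chars (G\<lparr>carrier := H\<rparr>)"
  obtains \<xi>' where "\<xi>' \<in> chars G" "\<And>h. h \<in> H \<Longrightarrow> \<xi>' h = \<xi> h"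
proof -
  interpret comm_group G by fact
  have "\<exists>\<xi>'\<in>chars G. \<forall>h\<in>H. \<xi>' h = \<xi> h"
    using assms(3,4)
  proof (induction "card (carrier G - H)" arbitrary: H \<xi> rule: less_induct)
    case less
    show ?case
    proof (cases "H = carrier G")
      case True
      then show ?thesis
        using less.prems by (auto simp: chars_def hom_def)
    next
      case False
      interpret H: subgroup H G by fact
      from False obtain g where g: "g \<in> carrier G" "g \<notin> H"
        using H.subset by blast
      obtain m :: nat where m: "m > 0" "g [^]\<^bsub>G\<^esub> m \<in> H" "\<And>k. 0 < k \<Longrightarrow> g [^]\<^bsub>G\<^esub> k \<in> H \<Longrightarrow> m dvd (k::nat)"
        using exists_order_mod_subgroup[OF assms(1,2) less.prems(1) g(1)] by blast
      obtain z where z: "z ^ m = \<xi> (g [^]\<^bsub>G\<^esub> m)" "cmod z = 1"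
        using exists_root_on_circle[OF m(1), of "\<xi> (g [^]\<^bsub>G\<^esub> m)"] chars_norm[OF less.prems(2), of "g [^]\<^bsub>G\<^esub> m"] m(2)
        by auto
      obtain H' \<xi>' where H': "subgroup H' G" "H \<subseteq> H'" "g \<in> H'" "\<xi>' \<in> chars (G\<lparr>carrier := H'\<rparr>)"
        "\<And>h. h \<in> H \<Longrightarrow> \<xi>' h = \<xi> h"
        using char_extend_step[OF assms(1,2) less.prems g(1) m z] by metis
      have "card (carrier G - H') < card (carrier G - H)"
        using H' g assms(2) by (intro psubset_card_mono) auto
      from less.hyps[OF this H'(1,4)] H' show ?thesis by (metis subsetD)
    qed
  qed
  then show thesis using that by blast
qed

text \<open>Over the trivial subgroup the order m of g is at least 2, and sending g to any m-th root
  of unity other than 1 is an admissible first extension.\<close>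

lemma char_separates:
  assumes "comm_group G" "finite (carrier G)" "g \<in> carrier G" "g \<noteq> \<one>\<^bsub>G\<^esub>"
  obtains \<xi> where "\<xi> \<in> chars G" "\<xi> g \<noteq> 1"
proof -
  interpret comm_group G by fact
  let ?H = "{\<one>\<^bsub>G\<^esub>}"
  have sub: "subgroup ?H G" by (rule triv_subgroup)
  obtain m :: nat where m: "m > 0" "g [^]\<^bsub>G\<^esub> m \<in> ?H" "\<And>k. 0 < k \<Longrightarrow> g [^]\<^bsub>G\<^esub> k \<in> ?H \<Longrightarrow> m dvd (k::nat)"
    using exists_order_mod_subgroup[OF assms(1,2) sub assms(3)] by blast
  have "m \<noteq> 1" using m(2) assms by auto
  then have "m \<ge> 2" using m(1) by linarith
  have "\<not> {z::complex. z ^ m = 1} \<subseteq> {1}"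
  proof
    assume "{z::complex. z ^ m = 1} \<subseteq> {1}"
    then have "card {z::complex. z ^ m = 1} \<le> card {1::complex}"
      by (intro card_mono) auto
    then show False
      using card_roots_unity_eq[OF m(1)] \<open>m \<ge> 2\<close> by simp
  qed
  then obtain z :: complex where z: "z ^ m = 1" and "z \<noteq> 1"
    by blast
  then have zn: "cmod z = 1"
    using m(1) by (metis norm_ge_zero norm_one norm_power power_eq_1_iff less_irrefl)
  have "(\<lambda>x\<in>?H. 1) \<in> chars (G\<lparr>carrier := ?H\<rparr>)"
    using triv_char_in_chars[OF subgroup_imp_group[OF sub]] by (simp add: triv_char_def)
  from char_extend_step[OF assms(1,2) sub this assms(3) m, of z]
  obtain H' \<xi>' where H': "subgroup H' G" "g \<in> H'" "\<xi>' \<in> chars (G\<lparr>carrier := H'\<rparr>)" "\<xi>' g = z"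
    using z zn m(2) by (metis restrict_apply')
  from char_extend[OF assms(1,2) H'(1,3)] H' \<open>z \<noteq> 1\<close> show thesis
    using that by metis
qed

text \<open>Evaluation at g is a character of the dual group, so this is \<open>sum_char\<close> for
  that group; separation of points says that the evaluation is nontrivial when g is.\<close>

lemma sum_chars_at:
  assumes "comm_group G" "finite (carrier G)" "g \<in> carrier G"
  shows "(\<Sum>\<xi>\<in>chars G. \<xi> g) = (if g = \<one>\<^bsub>G\<^esub> then of_nat (card (chars G)) else 0)"
proof (cases "g = \<one>\<^bsub>G\<^esub>")
  case True
  interpret comm_group G by fact
  show ?thesis
    using True by (simp add: chars_one)
next
  case False
  interpret comm_group G by fact
  interpret X: comm_group "char_group G" by (rule comm_group_char_group) simp
  have "(\<lambda>\<xi>\<in>chars G. \<xi> g) \<in> chars (char_group G)"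
    using charsI[of "char_group G" "\<lambda>\<xi>. \<xi> g"] assms(3) X.is_group
    by (simp add: chars_norm)
  from sum_char[OF X.is_group _ this] char_separates[OF assms False]
  have "(\<Sum>\<xi>\<in>chars G. (\<lambda>\<xi>\<in>chars G. \<xi> g) \<xi>) = 0"
    using finite_chars[OF _ assms(2)] by (auto split: if_splits)
  then show ?thesis using False by simp
qed

text \<open>Double counting of the sum of \<xi>(g) over all g and \<xi>: either orthogonality
  relation leaves a single term of the outer sum.\<close>

lemma card_chars:
  assumes "comm_group G" "finite (carrier G)"
  shows "card (chars G) = order G"
proof -
  interpret comm_group G by fact
  have "(\<Sum>g\<in>carrier G. \<Sum>\<xi>\<in>chars G. \<xi> g) = of_nat (card (chars G))"
    using assms by (simp add: sum_chars_at if_distrib sum.delta)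
  moreover have "(\<Sum>g\<in>carrier G. \<Sum>\<xi>\<in>chars G. \<xi> g) = (\<Sum>\<xi>\<in>chars G. if \<xi> = triv_char G then of_nat (order G) else 0)"
  proof (subst sum.swap, rule sum.cong)
    fix \<xi> assume \<xi>: "\<xi> \<in> chars G"
    then have "(\<forall>x\<in>carrier G. \<xi> x = 1) \<longleftrightarrow> \<xi> = triv_char G"
      using chars_eqI[OF \<xi> triv_char_in_chars] by (auto simp: triv_char_def)
    then show "sum \<xi> (carrier G) = (if \<xi> = triv_char G then of_nat (order G) else 0)"
      using sum_char[OF is_group assms(2) \<xi>] by simp
  qed simp
  moreover have "\<dots> = of_nat (order G)"
    using finite_chars[OF is_group assms(2)] by (simp add: sum.delta)
  ultimately show ?thesis
    by (metis of_nat_eq_iff)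
qed

section \<open>Convex combinations of characters\<close>

definition mean :: "('a, 'm) monoid_scheme \<Rightarrow> ('a \<Rightarrow> real) \<Rightarrow> real" where
  "mean W f = (\<Sum>w\<in>carrier W. f w) / real (order W)"

text \<open>Here f is the expectation of a random character of W with law p, that is, a normalised
  positive definite function. The law is kept explicit because its mass at the trivial character
  equals the mean of f.\<close>

definition char_mixture :: "('a, 'm) monoid_scheme \<Rightarrow> (('a \<Rightarrow> complex) \<Rightarrow> real) \<Rightarrow> ('a \<Rightarrow> real) \<Rightarrow> bool" where
  "char_mixture W p f \<longleftrightarrow> (\<forall>\<xi>\<in>chars W. 0 \<le> p \<xi>) \<and> sum p (chars W) = 1 \<and>
     (\<forall>w\<in>carrier W. complex_of_real (f w) = (\<Sum>\<xi>\<in>chars W. of_real (p \<xi>) * \<xi> w))"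

text \<open>The law on characters is the push-forward under \<psi> of a law on an arbitrary finite
  index set.\<close>

lemma char_mixtureI:
  assumes "group W" "finite (carrier W)" "finite R" "\<And>r. r \<in> R \<Longrightarrow> 0 \<le> (p r :: real)" "sum p R = 1"
    and "\<And>r. r \<in> R \<Longrightarrow> \<psi> r \<in> chars W"
    and "\<And>w. w \<in> carrier W \<Longrightarrow> complex_of_real (f w) = (\<Sum>r\<in>R. of_real (p r) * \<psi> r w)"
  shows "char_mixture W (\<lambda>\<xi>. \<Sum>r | r \<in> R \<and> \<psi> r = \<xi>. p r) f"
proof -
  have fin: "finite (chars W)" using assms finite_chars by blast
  have sub: "\<psi> ` R \<subseteq> chars W" using assms by auto
  have 1: "(\<Sum>\<xi>\<in>chars W. \<Sum>r | r \<in> R \<and> \<psi> r = \<xi>. p r) = 1"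
    using sum.group[OF assms(3) fin sub, of p] assms(5) by simp
  have "(\<Sum>\<xi>\<in>chars W. of_real (\<Sum>r | r \<in> R \<and> \<psi> r = \<xi>. p r) * \<xi> w) = (\<Sum>r\<in>R. of_real (p r) * \<psi> r w)" for w
  proof -
    have "(\<Sum>\<xi>\<in>chars W. of_real (\<Sum>r | r \<in> R \<and> \<psi> r = \<xi>. p r) * \<xi> w)
        = (\<Sum>\<xi>\<in>chars W. \<Sum>r | r \<in> R \<and> \<psi> r = \<xi>. of_real (p r) * \<psi> r w)"
      by (auto simp: sum_distrib_right intro!: sum.cong)
    then show ?thesis
      using sum.group[OF assms(3) fin sub, of "\<lambda>r. of_real (p r) * \<psi> r w"] by simp
  qed
  then show ?thesis
    unfolding char_mixture_def using 1 assms by (auto intro!: sum_nonneg)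
qed

text \<open>Every nontrivial character sums to zero over W, so only the trivial one
  contributes.\<close>

lemma char_mixture_mean:
  assumes "comm_group W" "finite (carrier W)" "char_mixture W p f"
  shows "mean W f = p (triv_char W)"
proof -
  interpret comm_group W by fact
  have pos: "order W > 0" using assms by (simp add: order_gt_0_iff_finite)
  have "complex_of_real (\<Sum>w\<in>carrier W. f w) = (\<Sum>w\<in>carrier W. \<Sum>\<xi>\<in>chars W. of_real (p \<xi>) * \<xi> w)"
    using assms by (simp add: char_mixture_def)
  also have "\<dots> = (\<Sum>\<xi>\<in>chars W. of_real (p \<xi>) * (\<Sum>w\<in>carrier W. \<xi> w))"
    by (subst sum.swap) (simp add: sum_distrib_left)
  also have "\<dots> = (\<Sum>\<xi>\<in>chars W. if \<xi> = triv_char W then of_real (p \<xi>) * of_nat (order W) else 0)"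
  proof (rule sum.cong)
    fix \<xi> assume \<xi>: "\<xi> \<in> chars W"
    then have "(\<forall>x\<in>carrier W. \<xi> x = 1) \<longleftrightarrow> \<xi> = triv_char W"
      using chars_eqI[OF \<xi> triv_char_in_chars] by (auto simp: triv_char_def)
    then show "of_real (p \<xi>) * sum \<xi> (carrier W) = (if \<xi> = triv_char W then of_real (p \<xi>) * of_nat (order W) else 0)"
      using sum_char[OF is_group assms(2) \<xi>] by simp
  qed simp
  also have "\<dots> = of_real (p (triv_char W) * real (order W))"
    using finite_chars[OF is_group assms(2)] by (simp add: sum.delta)
  finally have "(\<Sum>w\<in>carrier W. f w) = p (triv_char W) * real (order W)"
    by (simp only: of_real_eq_iff)
  then show ?thesis
    unfolding mean_def using pos by simp
qed

lemma chars_times_eq_triv: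
  assumes "group W" "\<xi> \<in> chars W" "\<psi> \<in> chars W" "(\<lambda>x\<in>carrier W. \<xi> x * \<psi> x) = triv_char W"
  shows "\<xi> = triv_char W \<longleftrightarrow> \<psi> = triv_char W"
proof -
  have *: "\<xi> x * \<psi> x = 1" if "x \<in> carrier W" for x
    using fun_cong[OF assms(4), of x] that by (simp add: triv_char_def)
  show ?thesis
    using * assms chars_eqI[OF assms(2) triv_char_in_chars] chars_eqI[OF assms(3) triv_char_in_chars]
    by (auto simp: triv_char_def)
qed

text \<open>The new law is that of the product of two independent random characters. If the product
  is trivial, then both factors are trivial or both are nontrivial; admitting all pairs of
  nontrivial characters gives the bound.\<close>

lemma char_mixture_times:
  assumes "comm_group W" "finite (carrier W)" "char_mixture W p f" "char_mixture W q g"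
  obtains r where "char_mixture W r (\<lambda>w. f w * g w)"
    "r (triv_char W) \<le> p (triv_char W) * q (triv_char W) + (1 - p (triv_char W)) * (1 - q (triv_char W))"
proof -
  interpret comm_group W by fact
  let ?t = "triv_char W" and ?X = "chars W"
  let ?m = "\<lambda>(\<xi>, \<psi>). \<lambda>x\<in>carrier W. \<xi> x * \<psi> x" and ?p = "\<lambda>(\<xi>, \<psi>). p \<xi> * q \<psi>"
  let ?r = "\<lambda>\<xi>. \<Sum>z | z \<in> ?X \<times> ?X \<and> ?m z = \<xi>. ?p z"
  have fin: "finite ?X" using finite_chars[OF is_group assms(2)] .
  have p: "sum p ?X = 1" "\<And>\<xi>. \<xi> \<in> ?X \<Longrightarrow> 0 \<le> p \<xi>" and q: "sum q ?X = 1" "\<And>\<xi>. \<xi> \<in> ?X \<Longrightarrow> 0 \<le> q \<xi>"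
    using assms by (auto simp: char_mixture_def)
  have "char_mixture W ?r (\<lambda>w. f w * g w)"
  proof (rule char_mixtureI)
    show "sum ?p (?X \<times> ?X) = 1"
      using p q by (simp add: sum.cartesian_product[symmetric] sum_distrib_left[symmetric])
    show "complex_of_real (f w * g w) = (\<Sum>z\<in>?X \<times> ?X. of_real (?p z) * ?m z w)" if "w \<in> carrier W" for w
    proof -
      have "(\<Sum>z\<in>?X \<times> ?X. of_real (?p z) * ?m z w) = (\<Sum>\<xi>\<in>?X. \<Sum>\<psi>\<in>?X. (of_real (p \<xi>) * \<xi> w) * (of_real (q \<psi>) * \<psi> w))"
        using that by (simp add: sum.cartesian_product split_beta mult_ac)
      also have "\<dots> = (\<Sum>\<xi>\<in>?X. of_real (p \<xi>) * \<xi> w) * (\<Sum>\<psi>\<in>?X. of_real (q \<psi>) * \<psi> w)"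
        by (simp add: sum_product)
      finally show ?thesis
        using assms that by (simp add: char_mixture_def)
    qed
  qed (use assms p q fin is_group in \<open>auto simp: chars_times_closed\<close>)
  moreover have "?r ?t \<le> p ?t * q ?t + (1 - p ?t) * (1 - q ?t)"
  proof -
    have tX: "?t \<in> ?X" by simp
    have sp: "sum p (?X - {?t}) = 1 - p ?t" "sum q (?X - {?t}) = 1 - q ?t"
      using p q fin tX by (simp_all add: sum_diff1)
    have sub: "{z \<in> ?X \<times> ?X. ?m z = ?t} \<subseteq> {(?t, ?t)} \<union> (?X - {?t}) \<times> (?X - {?t})"
      using chars_times_eq_triv[OF is_group] by auto
    have "?r ?t \<le> sum ?p ({(?t, ?t)} \<union> (?X - {?t}) \<times> (?X - {?t}))"
      using fin p q tX by (intro sum_mono2 sub) (auto simp del: Un_insert_left)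
    also have "\<dots> = p ?t * q ?t + sum ?p ((?X - {?t}) \<times> (?X - {?t}))"
      using fin by simp
    also have "sum ?p ((?X - {?t}) \<times> (?X - {?t})) = (1 - p ?t) * (1 - q ?t)"
      using sp by (simp add: sum.cartesian_product[symmetric] sum_distrib_left[symmetric] sum_distrib_right[symmetric])
    finally show ?thesis .
  qed
  ultimately show thesis using that by blast
qed

lemma char_mixture_one:
  assumes "group W" "finite (carrier W)"
  shows "\<exists>p. char_mixture W p (\<lambda>_. 1)"
proof -
  have "char_mixture W (\<lambda>\<xi>. \<Sum>r | r \<in> {()} \<and> triv_char W = \<xi>. 1) (\<lambda>_. 1)"
    using assms by (intro char_mixtureI[where p = "\<lambda>_. 1" and \<psi> = "\<lambda>_. triv_char W"]) (use assms(1) in \<open>auto simp: triv_char_in_chars triv_char_def[of W, THEN fun_cong]\<close>)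
  then show ?thesis by blast
qed

lemma mean_mono:
  assumes "\<And>w. w \<in> carrier W \<Longrightarrow> f w \<le> g w"
  shows "mean W f \<le> mean W g"
  unfolding mean_def using assms by (intro divide_right_mono sum_mono) auto

text \<open>With a and b the means of one factor and of the remaining product,
  \<open>char_mixture_times\<close> bounds the new mean c by 2c - 1 \<le> (2a - 1)(2b - 1). So twice
  the mean minus 1 shrinks by 1 - 2\<beta> at each factor, as for the parity of independent coin
  flips.\<close>

lemma mean_prod_char_mixtures:
  assumes "comm_group W" "finite (carrier W)" "finite K" "0 \<le> \<beta>" "\<beta> \<le> 1/2"
    and "\<And>k. k \<in> K \<Longrightarrow> \<exists>p. char_mixture W p (f k)"
    and "\<And>k w. k \<in> K \<Longrightarrow> w \<in> carrier W \<Longrightarrow> 0 \<le> f k w \<and> f k w \<le> 1"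
    and "\<And>k. k \<in> K \<Longrightarrow> mean W (f k) \<le> 1 - \<beta>"
  shows "mean W (\<lambda>w. \<Prod>k\<in>K. f k w) \<le> (1 + (1 - 2 * \<beta>) ^ card K) / 2"
proof -
  interpret comm_group W by fact
  have "(\<exists>p. char_mixture W p (\<lambda>w. \<Prod>k\<in>K. f k w)) \<and>
        mean W (\<lambda>w. \<Prod>k\<in>K. f k w) \<le> (1 + (1 - 2 * \<beta>) ^ card K) / 2"
    using assms(3,6,7,8)
  proof (induction K rule: finite_induct)
    case empty
    then show ?case
      using char_mixture_one[OF is_group assms(2)] by (auto simp: mean_def order_def)
  next
    case (insert k K)
    let ?g = "\<lambda>w. \<Prod>k\<in>K. f k w"
    from insert.IH insert.prems obtain p where p: "char_mixture W p ?g"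
      and le: "mean W ?g \<le> (1 + (1 - 2 * \<beta>) ^ card K) / 2"
      by auto
    obtain q where q: "char_mixture W q (f k)" using insert.prems by blast
    from char_mixture_times[OF assms(1,2) q p] obtain r where
      r: "char_mixture W r (\<lambda>w. f k w * ?g w)"
      "r (triv_char W) \<le> q (triv_char W) * p (triv_char W) + (1 - q (triv_char W)) * (1 - p (triv_char W))"
      by blast
    define a b where "a = mean W (f k)" and "b = mean W ?g"
    let ?c = "mean W (\<lambda>w. f k w * ?g w)"
    have c: "?c \<le> a * b + (1 - a) * (1 - b)"
      using r(2) unfolding a_def b_def char_mixture_mean[OF assms(1,2) r(1)] char_mixture_mean[OF assms(1,2) p]
        char_mixture_mean[OF assms(1,2) q] .
    have g01: "0 \<le> ?g w" "?g w \<le> 1" if "w \<in> carrier W" for w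
      using that insert.prems by (auto intro!: prod_nonneg prod_le_1)
    have ca: "?c \<le> a"
      unfolding a_def using g01 insert.prems by (intro mean_mono) (auto intro!: mult_left_le)
    have a: "a \<le> 1 - \<beta>" unfolding a_def using insert.prems by blast
    have pow: "0 \<le> (1 - 2 * \<beta>) ^ card K" using assms by simp
    \<comment> \<open>For a < 1/2 the factor 2a - 1 is negative and the induction hypothesis cannot
      be multiplied by it, but then the mean is at most a, since the other factors do not exceed
      1.\<close>
    have "?c \<le> (1 + (1 - 2 * \<beta>) ^ Suc (card K)) / 2"
    proof (cases "a \<le> 1/2")
      case True
      have "0 \<le> (1 - 2 * \<beta>) ^ Suc (card K)"
        using assms by (intro zero_le_power) auto
      then show ?thesis using ca True by simp
    next
      case False
      have "?c \<le> 1/2 + (2 * a - 1) * (2 * b - 1) / 2"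
        using c by (simp add: field_simps)
      also have "(2 * a - 1) * (2 * b - 1) \<le> (2 * a - 1) * (1 - 2 * \<beta>) ^ card K"
        using False le by (intro mult_left_mono) (auto simp: b_def)
      also have "\<dots> \<le> (1 - 2 * \<beta>) * (1 - 2 * \<beta>) ^ card K"
        using a pow by (intro mult_right_mono) auto
      finally show ?thesis by (simp add: field_simps)
    qed
    then show ?case
      using insert.hyps r by (auto simp: prod.insert)
  qed
  then show ?thesis by blast
qed

section \<open>Balanced distributions modulo \<open>a\<close>\<close>

text \<open>Balance is imposed only on the reductions modulo prime divisors of a, which is what the
  hypotheses on the matrix provide.\<close>

definition balanced_law :: "nat \<Rightarrow> real \<Rightarrow> (nat \<Rightarrow> real) \<Rightarrow> bool" where
  "balanced_law a \<alpha> p \<longleftrightarrow> (\<forall>r<a. 0 \<le> p r) \<and> (\<Sum>r<a. p r) = 1 \<and>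
     (\<forall>q t. prime q \<longrightarrow> q dvd a \<longrightarrow> (\<Sum>r | r < a \<and> r mod q = t. p r) \<le> 1 - \<alpha>)"

definition char_fun :: "nat \<Rightarrow> (nat \<Rightarrow> real) \<Rightarrow> complex \<Rightarrow> complex" where
  "char_fun a p z = (\<Sum>r<a. of_real (p r) * z ^ r)"

text \<open>The sum is the probability that two independent samples agree. The extreme case is two
  atoms of mass 1 - \<alpha> and \<alpha>; if no mass reaches 1/2, the sum is at most 1/2, which is
  within the bound.\<close>

lemma sum_squares_le:
  fixes P :: "nat \<Rightarrow> real"
  assumes "finite T" "\<And>t. t \<in> T \<Longrightarrow> 0 \<le> P t" "\<And>t. t \<in> T \<Longrightarrow> P t \<le> 1 - \<alpha>" "sum P T = 1" "0 \<le> \<alpha>" "\<alpha> \<le> 1/2"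
  shows "(\<Sum>t\<in>T. P t * P t) \<le> 1 - 2 * \<alpha> * (1 - \<alpha>)"
proof (cases "\<exists>t\<in>T. P t \<ge> 1/2")
  case False
  have "(\<Sum>t\<in>T. P t * P t) \<le> (\<Sum>t\<in>T. P t * (1/2))"
    using False assms by (intro sum_mono mult_left_mono) auto
  also have "\<dots> = 1/2" using assms by (simp flip: sum_divide_distrib)
  also have "\<dots> \<le> 1 - 2 * \<alpha> * (1 - \<alpha>)"
    using zero_le_power2[of "2 * \<alpha> - 1"] by (simp add: power2_eq_square algebra_simps)
  finally show ?thesis .
next
  case True
  then obtain t where t: "t \<in> T" "P t \<ge> 1/2" by blast
  let ?m = "P t"
  have rest: "sum P (T - {t}) = 1 - ?m" using assms t by (simp add: sum_diff1)
  have le: "P s \<le> 1 - ?m" if "s \<in> T - {t}" for s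
    using member_le_sum[of s "T - {t}" P] that assms rest by auto
  have "(\<Sum>s\<in>T. P s * P s) = ?m * ?m + (\<Sum>s\<in>T-{t}. P s * P s)"
    using assms t by (simp add: sum.remove)
  also have "(\<Sum>s\<in>T-{t}. P s * P s) \<le> (\<Sum>s\<in>T-{t}. P s * (1 - ?m))"
    using assms le by (intro sum_mono mult_left_mono) auto
  also have "\<dots> = (1 - ?m) * (1 - ?m)"
    using rest by (simp flip: sum_distrib_right)
  also have "?m * ?m + (1 - ?m) * (1 - ?m) \<le> 1 - 2 * \<alpha> * (1 - \<alpha>)"
  proof -
    \<comment> \<open>The polynomial m^2 + (1 - m)^2 is convex and symmetric about 1/2, and m lies
      between \<alpha> and 1 - \<alpha>; this product is half of the difference to its value at the
      two ends.\<close>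
    have "(1 - \<alpha> - ?m) * (?m - \<alpha>) \<ge> 0"
      using assms t by (intro mult_nonneg_nonneg) auto
    then show ?thesis by (simp add: algebra_simps)
  qed
  finally show ?thesis by simp
qed

text \<open>Two independent samples are compared after reduction modulo q, where balance is
  available.\<close>

lemma balanced_law_collision:
  assumes "balanced_law a \<alpha> p" "prime q" "q dvd a" "a > 0" "0 \<le> \<alpha>" "\<alpha> \<le> 1/2"
  shows "(\<Sum>r<a. \<Sum>s<a. if r mod q = s mod q then p r * p s else 0) \<le> 1 - 2 * \<alpha> * (1 - \<alpha>)"
proof -
  have q: "q > 0" using assms prime_gt_0_nat by blast
  define P where "P t = (\<Sum>r | r < a \<and> r mod q = t. p r)" for t
  have P: "(\<Sum>t<q. P t) = 1"
    using sum.group[of "{..<a}" "{..<q}" "\<lambda>r. r mod q" p] assms q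
    unfolding P_def balanced_law_def by (auto simp: image_subset_iff)
  have "(\<Sum>r<a. \<Sum>s<a. if r mod q = s mod q then p r * p s else 0) = (\<Sum>r<a. p r * P (r mod q))"
  proof (rule sum.cong)
    fix r
    have "(\<Sum>s<a. if r mod q = s mod q then p r * p s else 0) = (\<Sum>s | s < a \<and> s mod q = r mod q. p r * p s)"
      by (rule sum.mono_neutral_cong_right) auto
    then show "(\<Sum>s<a. if r mod q = s mod q then p r * p s else 0) = p r * P (r mod q)"
      by (simp add: P_def sum_distrib_left)
  qed simp
  also have "\<dots> = (\<Sum>t<q. \<Sum>r | r < a \<and> r mod q = t. p r * P (r mod q))"
    using sum.group[of "{..<a}" "{..<q}" "\<lambda>r. r mod q" "\<lambda>r. p r * P (r mod q)"] q
    by (auto simp: image_subset_iff)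
  also have "\<dots> = (\<Sum>t<q. P t * P t)"
    by (intro sum.cong) (auto simp: P_def sum_distrib_right)
  also have "\<dots> \<le> 1 - 2 * \<alpha> * (1 - \<alpha>)"
  proof (rule sum_squares_le)
    show "0 \<le> P t" for t
      using assms unfolding P_def balanced_law_def by (auto intro!: sum_nonneg)
    show "P t \<le> 1 - \<alpha>" for t
      using assms unfolding P_def balanced_law_def by blast
  qed (use P assms in auto)
  finally show ?thesis .
qed

text \<open>q is a prime factor of the order m of z: equal powers have exponents congruent modulo m,
  hence modulo q. This turns nontriviality of z into information modulo a prime.\<close>

lemma root_of_unity_prime:
  fixes z :: complex
  assumes "z ^ a = 1" "z \<noteq> 1" "a > 0"
  obtains q :: nat where "prime q" "q dvd a" "\<And>r s. z ^ r = z ^ s \<Longrightarrow> r mod q = s mod q"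
proof -
  define m where "m = (LEAST k. 0 < k \<and> z ^ k = 1)"
  have m: "0 < m \<and> z ^ m = 1"
    unfolding m_def by (rule LeastI[of "\<lambda>k. 0 < k \<and> z ^ k = 1" a]) (use assms in auto)
  have dvd: "m dvd k" if "z ^ k = 1" for k
  proof -
    have "z ^ k = (z ^ m) ^ (k div m) * z ^ (k mod m)"
      by (metis mult_div_mod_eq power_add power_mult)
    then have "z ^ (k mod m) = 1" using that m by simp
    then have "\<not> 0 < k mod m"
      using not_less_Least[of "k mod m" "\<lambda>k. 0 < k \<and> z ^ k = 1"] m unfolding m_def[symmetric] by auto
    then show ?thesis by auto
  qed
  have "m \<noteq> 1" using m assms by auto
  then obtain q where q: "prime q" "q dvd m" using prime_factor_nat by blast
  have z0: "z \<noteq> 0" using m by (metis power_0_left zero_neq_one less_irrefl)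
  have *: "r mod q = s mod q" if "z ^ r = z ^ s" "r \<le> s" for r s
  proof -
    have "z ^ (s - r) = 1"
      using that z0 by (simp add: power_diff)
    then have "q dvd s - r" using dvd q dvd_trans by blast
    then show ?thesis using that(2) by (metis mod_eq_dvd_iff_nat)
  qed
  have "r mod q = s mod q" if "z ^ r = z ^ s" for r s
    using *[of r s] *[of s r] that by (metis nle_le)
  moreover have "q dvd a" using dvd[OF assms(1)] q dvd_trans by blast
  ultimately show thesis using that q by blast
qed

section \<open>Characteristic functions at roots of unity\<close>

lemma cmod_char_fun_sq:
  "complex_of_real ((cmod (char_fun a p z))\<^sup>2) = (\<Sum>(r, s)\<in>{..<a} \<times> {..<a}. of_real (p r * p s) * (z ^ r * cnj z ^ s))"
  unfolding complex_norm_square char_fun_def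
  by (simp add: sum_product sum.cartesian_product split_beta mult_ac)

lemma cmod_char_fun_le_1:
  assumes "balanced_law a \<alpha> p" "cmod z = 1"
  shows "cmod (char_fun a p z) \<le> 1"
proof -
  have "cmod (char_fun a p z) \<le> (\<Sum>r<a. cmod (of_real (p r) * z ^ r))"
    unfolding char_fun_def by (rule norm_sum)
  also have "\<dots> = (\<Sum>r<a. p r)"
    using assms by (intro sum.cong) (auto simp: norm_mult norm_power balanced_law_def)
  finally show ?thesis using assms by (simp add: balanced_law_def)
qed

lemma char_fun_one: "balanced_law a \<alpha> p \<Longrightarrow> char_fun a p 1 = 1"
  unfolding char_fun_def balanced_law_def by (simp flip: of_real_sum)

lemma root_of_unity_norm:
  fixes z :: complex
  assumes "z ^ a = 1" "a > 0"
  shows "cmod z = 1"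
  using assms by (metis norm_ge_zero norm_one norm_power power_eq_1_iff less_irrefl gr0_conv_Suc power_inject_base power_one)

lemma power_cnj_eq_one_iff:
  fixes z :: complex
  assumes "cmod z = 1"
  shows "z ^ r * cnj z ^ s = 1 \<longleftrightarrow> z ^ r = z ^ s"
proof -
  have "z \<noteq> 0" using assms by auto
  then show ?thesis
    unfolding cnj_eq_inverse[OF assms] by (simp add: power_inverse field_simps)
qed

text \<open>The gap between 1 and the real parts of the other a-th roots of unity. Inserting 1 keeps
  the set nonempty when a = 1.\<close>

definition root_gap :: "nat \<Rightarrow> real" where
  "root_gap a = Min (insert 1 ((\<lambda>z. 1 - Re z) ` ({z::complex. z ^ a = 1} - {1})))"

lemma root_gap:
  assumes "a > 0"
  shows "0 < root_gap a" "root_gap a \<le> 1" "z ^ a = 1 \<Longrightarrow> z \<noteq> 1 \<Longrightarrow> Re z \<le> 1 - root_gap a"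
proof -
  let ?S = "insert 1 ((\<lambda>z. 1 - Re z) ` ({z::complex. z ^ a = 1} - {1}))"
  have fin: "finite ?S"
    using finite_roots_unity[of a, where 'a = complex] assms by auto
  have "0 < 1 - Re z" if "z ^ a = 1" "z \<noteq> 1" for z :: complex
  proof -
    have n: "cmod z = 1" using root_of_unity_norm that assms by blast
    then have "Re z \<le> 1" using complex_Re_le_cmod[of z] by simp
    moreover have "Re z \<noteq> 1"
    proof
      assume "Re z = 1"
      then have "Im z = 0" using n cmod_power2[of z] by simp
      then show False using \<open>Re z = 1\<close> that(2) by (simp add: complex_eq_iff)
    qed
    ultimately show ?thesis by simp
  qed
  then show "0 < root_gap a"
    unfolding root_gap_def using fin by (subst Min_gr_iff) auto
  show "root_gap a \<le> 1" unfolding root_gap_def using fin by (intro Min_le) auto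
  show "Re z \<le> 1 - root_gap a" if "z ^ a = 1" "z \<noteq> 1"
    using Min_le[OF fin, of "1 - Re z"] that unfolding root_gap_def by auto
qed

text \<open>The squared modulus is the expectation of Re z^(r - s) for independent r and s. This
  real part is at most 1, and at most 1 minus the gap unless r and s collide modulo q; balance
  controls the collision probability.\<close>

lemma cmod_char_fun_bound:
  assumes p: "balanced_law a \<alpha> p" and \<alpha>: "0 \<le> \<alpha>" "\<alpha> \<le> 1/2" and z: "z ^ a = 1" "z \<noteq> 1" and a: "a > 0"
  shows "(cmod (char_fun a p z))\<^sup>2 \<le> 1 - root_gap a * (2 * \<alpha> * (1 - \<alpha>))"
proof -
  let ?k = "root_gap a"
  have zn: "cmod z = 1" using root_of_unity_norm z a by blast
  obtain q where q: "prime q" "q dvd a" "\<And>r s. z ^ r = z ^ s \<Longrightarrow> r mod q = s mod q"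
    using root_of_unity_prime z a by blast
  have p0: "\<And>r. r < a \<Longrightarrow> 0 \<le> p r" and p1: "(\<Sum>r<a. p r) = 1" using p by (auto simp: balanced_law_def)
  have "(cmod (char_fun a p z))\<^sup>2 = Re (complex_of_real ((cmod (char_fun a p z))\<^sup>2))" by simp
  also have "\<dots> = (\<Sum>r<a. \<Sum>s<a. p r * p s * Re (z ^ r * cnj z ^ s))"
    unfolding cmod_char_fun_sq by (simp add: sum.cartesian_product split_beta)
  also have "\<dots> \<le> (\<Sum>r<a. \<Sum>s<a. (1 - ?k) * (p r * p s) + ?k * (if r mod q = s mod q then p r * p s else 0))"
  proof (intro sum_mono)
    fix r s assume rs: "r \<in> {..<a}" "s \<in> {..<a}"
    have "Re (z ^ r * cnj z ^ s) \<le> (if r mod q = s mod q then 1 else 1 - ?k)"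
    proof (cases "z ^ r = z ^ s")
      case True
      then show ?thesis using q(3)[OF True] power_cnj_eq_one_iff[OF zn, of r s] by simp
    next
      case False
      have "(z ^ r * cnj z ^ s) ^ a = (z ^ a) ^ r * cnj (z ^ a) ^ s"
        unfolding power_mult_distrib complex_cnj_power by (metis mult.commute power_mult)
      then have "(z ^ r * cnj z ^ s) ^ a = 1" using z by simp
      then have "Re (z ^ r * cnj z ^ s) \<le> 1 - ?k"
        using root_gap(3)[OF a] power_cnj_eq_one_iff[OF zn, of r s] False by blast
      then show ?thesis using root_gap(1)[OF a] by simp
    qed
    then have "p r * p s * Re (z ^ r * cnj z ^ s) \<le> p r * p s * (if r mod q = s mod q then 1 else 1 - ?k)"
      using rs p0 by (intro mult_left_mono) auto
    then show "p r * p s * Re (z ^ r * cnj z ^ s) \<le> (1 - ?k) * (p r * p s) + ?k * (if r mod q = s mod q then p r * p s else 0)"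
      by (auto simp: algebra_simps split: if_splits)
  qed
  also have "\<dots> = (1 - ?k) * ((\<Sum>r<a. p r) * (\<Sum>s<a. p s)) + ?k * (\<Sum>r<a. \<Sum>s<a. if r mod q = s mod q then p r * p s else 0)"
    unfolding sum_product by (simp add: sum.distrib sum_distrib_left)
  also have "\<dots> \<le> (1 - ?k) + ?k * (1 - 2 * \<alpha> * (1 - \<alpha>))"
    using balanced_law_collision[OF p q(1,2) a \<alpha>] root_gap(1)[OF a] p1 by simp
  finally show ?thesis by (simp add: algebra_simps)
qed

text \<open>The square is a mixture of the characters \<xi>^(r - s), and its mean is the probability
  that this power is trivial on W, which forces r and s to be congruent modulo q. No root gap
  enters, in contrast to the pointwise bound.\<close>

lemma char_mixture_char_fun:
  assumes "comm_group W" "finite (carrier W)" "\<xi> \<in> chars W" "\<exists>w\<in>carrier W. \<xi> w \<noteq> 1"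
    and "\<And>w. w \<in> carrier W \<Longrightarrow> \<xi> w ^ a = 1" "a > 0"
    and p: "balanced_law a \<alpha> p" and \<alpha>: "0 \<le> \<alpha>" "\<alpha> \<le> 1/2"
  shows "\<exists>P. char_mixture W P (\<lambda>w. (cmod (char_fun a p (\<xi> w)))\<^sup>2)"
    and "mean W (\<lambda>w. (cmod (char_fun a p (\<xi> w)))\<^sup>2) \<le> 1 - 2 * \<alpha> * (1 - \<alpha>)"
proof -
  interpret comm_group W by fact
  let ?R = "{..<a} \<times> {..<a}"
  let ?p = "\<lambda>(r, s). p r * p s"
  define \<psi> where "\<psi> = (\<lambda>(r, s). \<lambda>w\<in>carrier W. \<xi> w ^ r * cnj (\<xi> w) ^ s)"
  have p0: "\<And>r. r < a \<Longrightarrow> 0 \<le> p r" and p1: "(\<Sum>r<a. p r) = 1" using p by (auto simp: balanced_law_def)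
  let ?P = "\<lambda>\<eta>. \<Sum>r | r \<in> ?R \<and> \<psi> r = \<eta>. ?p r"
  have mix: "char_mixture W ?P (\<lambda>w. (cmod (char_fun a p (\<xi> w)))\<^sup>2)"
  proof (rule char_mixtureI)
    show "sum ?p ?R = 1"
      using p1 by (simp add: sum.cartesian_product[symmetric] sum_distrib_left[symmetric])
    show "\<psi> r \<in> chars W" for r
      unfolding \<psi>_def using assms(3)
      by (cases r) (auto intro!: charsI simp: norm_mult norm_power chars_norm chars_mult power_mult_distrib)
    show "complex_of_real ((cmod (char_fun a p (\<xi> w)))\<^sup>2) = (\<Sum>r\<in>?R. of_real (?p r) * \<psi> r w)" if "w \<in> carrier W" for w
      unfolding cmod_char_fun_sq using that by (intro sum.cong) (auto simp: \<psi>_def)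
  qed (use assms p0 is_group in auto)
  then show "\<exists>P. char_mixture W P (\<lambda>w. (cmod (char_fun a p (\<xi> w)))\<^sup>2)" by blast
  obtain w where w: "w \<in> carrier W" "\<xi> w \<noteq> 1" using assms by blast
  obtain q where q: "prime q" "q dvd a" "\<And>r s. \<xi> w ^ r = \<xi> w ^ s \<Longrightarrow> r mod q = s mod q"
    using root_of_unity_prime[of "\<xi> w" a] w assms by blast
  have "mean W (\<lambda>w. (cmod (char_fun a p (\<xi> w)))\<^sup>2) = ?P (triv_char W)"
    by (rule char_mixture_mean[OF assms(1,2) mix])
  also have "\<dots> \<le> (\<Sum>r\<in>?R. case r of (r, s) \<Rightarrow> if r mod q = s mod q then p r * p s else 0)"
  proof -
    have "?P (triv_char W) = (\<Sum>r\<in>?R. if \<psi> r = triv_char W then ?p r else 0)"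
      by (simp add: sum.inter_filter)
    also have "\<dots> \<le> (\<Sum>r\<in>?R. case r of (r, s) \<Rightarrow> if r mod q = s mod q then p r * p s else 0)"
    proof (rule sum_mono)
      fix x assume "x \<in> ?R"
      then obtain r s where x: "x = (r, s)" and rs: "r < a" "s < a" by auto
      have "r mod q = s mod q" if "\<psi> (r, s) = triv_char W"
      proof -
        have "\<xi> w ^ r * cnj (\<xi> w) ^ s = 1"
          using fun_cong[OF that, of w] w by (simp add: \<psi>_def triv_char_def)
        then show ?thesis
          using power_cnj_eq_one_iff[OF chars_norm[OF assms(3) w(1)]] q(3) by blast
      qed
      then show "(if \<psi> x = triv_char W then ?p x else 0) \<le> (case x of (r, s) \<Rightarrow> if r mod q = s mod q then p r * p s else 0)"
        using p0 rs by (auto simp: x)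
    qed
    finally show ?thesis .
  qed
  also have "\<dots> = (\<Sum>r<a. \<Sum>s<a. if r mod q = s mod q then p r * p s else 0)"
    by (simp add: sum.cartesian_product)
  also have "\<dots> \<le> 1 - 2 * \<alpha> * (1 - \<alpha>)"
    by (rule balanced_law_collision[OF p q(1,2) assms(6) \<alpha>])
  finally show "mean W (\<lambda>w. (cmod (char_fun a p (\<xi> w)))\<^sup>2) \<le> 1 - 2 * \<alpha> * (1 - \<alpha>)" .
qed

text \<open>Only the squared moduli are mixtures of characters, so Cauchy-Schwarz over W is applied;
  it is the source of the square root.\<close>

lemma sum_prod_char_fun_le:
  assumes "comm_group W" "finite (carrier W)" "finite K" "a > 0" and \<alpha>: "0 \<le> \<alpha>" "\<alpha> \<le> 1/2"
    and "\<And>k. k \<in> K \<Longrightarrow> \<xi> k \<in> chars W" "\<And>k. k \<in> K \<Longrightarrow> \<exists>w\<in>carrier W. \<xi> k w \<noteq> 1"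
    and "\<And>k w. k \<in> K \<Longrightarrow> w \<in> carrier W \<Longrightarrow> \<xi> k w ^ a = 1"
    and "\<And>k. k \<in> K \<Longrightarrow> balanced_law a \<alpha> (p k)"
  shows "(\<Sum>w\<in>carrier W. \<Prod>k\<in>K. cmod (char_fun a (p k) (\<xi> k w)))
     \<le> real (order W) * sqrt ((1 + (1 - 4 * \<alpha> * (1 - \<alpha>)) ^ card K) / 2)"
proof -
  interpret comm_group W by fact
  let ?f = "\<lambda>k w. cmod (char_fun a (p k) (\<xi> k w))"
  have pos: "order W > 0" using assms by (simp add: order_gt_0_iff_finite)
  have \<beta>: "2 * \<alpha> * (1 - \<alpha>) \<le> 1/2"
    using zero_le_power2[of "2 * \<alpha> - 1"] by (simp add: power2_eq_square algebra_simps)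
  have "mean W (\<lambda>w. \<Prod>k\<in>K. (?f k w)\<^sup>2) \<le> (1 + (1 - 2 * (2 * \<alpha> * (1 - \<alpha>))) ^ card K) / 2"
  proof (rule mean_prod_char_mixtures[OF assms(1-3) _ \<beta>])
    fix k assume k: "k \<in> K"
    show "\<exists>P. char_mixture W P (\<lambda>w. (?f k w)\<^sup>2)" "mean W (\<lambda>w. (?f k w)\<^sup>2) \<le> 1 - 2 * \<alpha> * (1 - \<alpha>)"
      using char_mixture_char_fun[OF assms(1,2) assms(7)[OF k] assms(8)[OF k] assms(9)[OF k] assms(4) assms(10)[OF k] \<alpha>]
      by auto
    show "0 \<le> (?f k w)\<^sup>2 \<and> (?f k w)\<^sup>2 \<le> 1" if "w \<in> carrier W" for w
      using cmod_char_fun_le_1[OF assms(10)[OF k]] chars_norm[OF assms(7)[OF k] that]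
      by (auto intro!: power_le_one)
  qed (use \<alpha> in auto)
  then have m: "mean W (\<lambda>w. \<Prod>k\<in>K. (?f k w)\<^sup>2) \<le> (1 + (1 - 4 * \<alpha> * (1 - \<alpha>)) ^ card K) / 2"
    by (simp add: mult.assoc)
  have "(\<Sum>w\<in>carrier W. \<Prod>k\<in>K. ?f k w)\<^sup>2 \<le> (\<Sum>w\<in>carrier W. (\<Prod>k\<in>K. ?f k w)\<^sup>2) * real (card (carrier W))"
    by (rule sum_squared_le_sum_of_squares)
  also have "(\<Sum>w\<in>carrier W. (\<Prod>k\<in>K. ?f k w)\<^sup>2) = real (order W) * mean W (\<lambda>w. \<Prod>k\<in>K. (?f k w)\<^sup>2)"
    using pos by (simp add: mean_def prod_power_distrib)
  also have "\<dots> * real (card (carrier W)) = (real (order W))\<^sup>2 * mean W (\<lambda>w. \<Prod>k\<in>K. (?f k w)\<^sup>2)"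
    by (simp add: order_def power2_eq_square)
  also have "\<dots> \<le> (real (order W))\<^sup>2 * ((1 + (1 - 4 * \<alpha> * (1 - \<alpha>)) ^ card K) / 2)"
    using m by (intro mult_left_mono) auto
  finally have "sqrt ((\<Sum>w\<in>carrier W. \<Prod>k\<in>K. ?f k w)\<^sup>2) \<le> sqrt ((real (order W))\<^sup>2 * ((1 + (1 - 4 * \<alpha> * (1 - \<alpha>)) ^ card K) / 2))"
    by (rule real_sqrt_le_mono)
  then show ?thesis
    unfolding real_sqrt_mult by (simp add: sum_nonneg prod_nonneg)
qed

section \<open>Counting assignments with few non-orthogonal pairs\<close>

definition index_pairs :: "nat \<Rightarrow> (nat \<times> nat) set" where
  "index_pairs n = {(i, j). i < j \<and> j < n}"

lemma finite_index_pairs [simp]: "finite (index_pairs n)"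
  by (rule finite_subset[of _ "{..<n} \<times> {..<n}"]) (auto simp: index_pairs_def)

lemma prod_le_prod_subset:
  fixes h :: "'a \<Rightarrow> real"
  assumes "finite A" "S \<subseteq> A" "\<And>x. x \<in> A \<Longrightarrow> 0 \<le> h x \<and> h x \<le> 1"
  shows "prod h A \<le> prod h S"
proof -
  have "prod h A = prod h (A - S) * prod h S"
    using assms by (intro prod.subset_diff)
  also have "\<dots> \<le> 1 * prod h S"
    using assms by (intro mult_right_mono prod_le_1 prod_nonneg) auto
  finally show ?thesis by simp
qed

text \<open>P and Q are disjoint, so each unordered pair {i, k} arises at most once, and the
  symmetry of h allows either order.\<close>

lemma prod_index_pairs_le:
  fixes h :: "nat \<Rightarrow> nat \<Rightarrow> real"
  assumes sym: "\<And>i j. h i j = h j i" and h: "\<And>i j. i < n \<Longrightarrow> j < n \<Longrightarrow> i \<noteq> j \<Longrightarrow> 0 \<le> h i j \<and> h i j \<le> 1"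
    and "P \<subseteq> {..<n}" "Q \<subseteq> {..<n}" "P \<inter> Q = {}"
  shows "(\<Prod>(i, j)\<in>index_pairs n. h i j) \<le> (\<Prod>i\<in>P. \<Prod>k\<in>Q. h i k)"
proof -
  let ?m = "\<lambda>(i, k). (min i k, max i k) :: nat \<times> nat"
  have inj: "inj_on ?m (P \<times> Q)"
    using assms(5) by (auto simp: inj_on_def min_def max_def split: if_splits)
  have sub: "?m ` (P \<times> Q) \<subseteq> index_pairs n"
  proof clarify
    fix i k assume "i \<in> P" "k \<in> Q"
    then have "i \<noteq> k" "i < n" "k < n" using assms by auto
    then show "(min i k, max i k) \<in> index_pairs n"
      by (auto simp: index_pairs_def min_def max_def)
  qed
  have "(\<Prod>(i, j)\<in>index_pairs n. h i j) \<le> (\<Prod>(i, j)\<in>?m ` (P \<times> Q). h i j)"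
    proof (rule prod_le_prod_subset[OF finite_index_pairs sub])
    fix x assume "x \<in> index_pairs n"
    then show "0 \<le> (case x of (i, j) \<Rightarrow> h i j) \<and> (case x of (i, j) \<Rightarrow> h i j) \<le> 1"
      using h by (auto simp: index_pairs_def)
  qed
  also have "\<dots> = (\<Prod>z\<in>P \<times> Q. case z of (i, k) \<Rightarrow> h i k)"
    unfolding prod.reindex[OF inj] using sym by (intro prod.cong) (auto simp: min_def max_def)
  also have "\<dots> = (\<Prod>i\<in>P. \<Prod>k\<in>Q. h i k)"
    by (simp add: prod.cartesian_product)
  finally show ?thesis .
qed

text \<open>The saving of one row against s outliers, after division by the size N of W. It is about
  1 - \<alpha> s as long as \<alpha> s is small.\<close>

definition contraction :: "real \<Rightarrow> nat \<Rightarrow> real" where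
  "contraction \<alpha> s = sqrt ((1 + (1 - 4 * \<alpha> * (1 - \<alpha>)) ^ s) / 2)"

lemma contraction_nonneg [simp]: "0 \<le> contraction \<alpha> s"
  unfolding contraction_def
proof (rule real_sqrt_ge_zero)
  have "0 \<le> 1 - 4 * \<alpha> * (1 - \<alpha>)"
    using zero_le_power2[of "2 * \<alpha> - 1"] by (simp add: power2_eq_square algebra_simps)
  then show "0 \<le> (1 + (1 - 4 * \<alpha> * (1 - \<alpha>)) ^ s) / 2" by (simp add: add_nonneg_nonneg)
qed

text \<open>The elements of \<open>Ws\<close> play the role of the isotropic subgroups of \<open>V\<close>; those of maximal
  size \<open>N\<close> are their own orthogonal complements.\<close>

locale pair_weights =
  fixes V :: "'v set" and N :: nat and perp :: "'v \<Rightarrow> 'v \<Rightarrow> bool" and Ws :: "'v set set"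
    and n :: nat and \<theta> :: "nat \<Rightarrow> nat \<Rightarrow> 'v \<Rightarrow> 'v \<Rightarrow> real" and \<delta> :: "nat \<Rightarrow> 'v \<Rightarrow> real"
    and good :: "(nat \<Rightarrow> 'v) \<Rightarrow> bool" and \<alpha> \<kappa> :: real
  assumes finite_V: "finite V" and card_V: "card V = N\<^sup>2" and N_pos: "N > 0"
    and Ws_sub: "\<And>W. W \<in> Ws \<Longrightarrow> W \<subseteq> V \<and> card W \<le> N"
    and Ws_cover: "\<And>S. S \<subseteq> V \<Longrightarrow> (\<And>u v. u \<in> S \<Longrightarrow> v \<in> S \<Longrightarrow> perp u v) \<Longrightarrow> \<exists>W\<in>Ws. S \<subseteq> W"
    and \<theta>_sym: "\<And>i j u v. \<theta> i j u v = \<theta> j i v u"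
    and \<theta>_bounds: "\<And>i j u v. i < n \<Longrightarrow> j < n \<Longrightarrow> i \<noteq> j \<Longrightarrow> u \<in> V \<Longrightarrow> v \<in> V \<Longrightarrow> 0 \<le> \<theta> i j u v \<and> \<theta> i j u v \<le> 1"
    and \<delta>_bounds: "\<And>i u. i < n \<Longrightarrow> u \<in> V \<Longrightarrow> 0 \<le> \<delta> i u \<and> \<delta> i u \<le> 1"
    and \<theta>_not_perp: "\<And>i j u v. i < n \<Longrightarrow> j < n \<Longrightarrow> i \<noteq> j \<Longrightarrow> u \<in> V \<Longrightarrow> v \<in> V \<Longrightarrow> \<not> perp u v \<Longrightarrow>
           \<theta> i j u v \<le> exp (- \<kappa> * \<alpha>)"
    and \<theta>_outliers: "\<And>W K i x. W \<in> Ws \<Longrightarrow> card W = N \<Longrightarrow> K \<subseteq> {..<n} \<Longrightarrow> i < n \<Longrightarrow> i \<notin> K \<Longrightarrow>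
           (\<And>k. k \<in> K \<Longrightarrow> x k \<in> V - W) \<Longrightarrow> (\<Sum>w\<in>W. \<Prod>k\<in>K. \<theta> i k w (x k)) \<le> N * contraction \<alpha> (card K)"
    and \<delta>_inside: "\<And>W. W \<in> Ws \<Longrightarrow> card W = N \<Longrightarrow>
           (\<forall>u\<in>{..<n} \<rightarrow>\<^sub>E W. good u) \<or> (\<forall>i<n. (\<Sum>w\<in>W. \<delta> i w) \<le> N * contraction \<alpha> 1)"
begin

definition weight :: "(nat \<Rightarrow> 'v) \<Rightarrow> real" where
  "weight u = (\<Prod>(i, j)\<in>index_pairs n. \<theta> i j (u i) (u j)) * (\<Prod>i<n. \<delta> i (u i))"

definition outliers :: "'v set \<Rightarrow> (nat \<Rightarrow> 'v) \<Rightarrow> nat set" where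
  "outliers W u = {i. i < n \<and> u i \<notin> W}"

abbreviation "assignments \<equiv> {..<n} \<rightarrow>\<^sub>E V"

lemma finite_assignments: "finite assignments"
  using finite_V by (intro finite_PiE) auto

lemma assignmentD: "u \<in> assignments \<Longrightarrow> i < n \<Longrightarrow> u i \<in> V"
  by auto

lemma pair_factor_bounds:
  assumes "u \<in> assignments" "(i, j) \<in> index_pairs n"
  shows "0 \<le> \<theta> i j (u i) (u j) \<and> \<theta> i j (u i) (u j) \<le> 1"
  using assms(2) \<theta>_bounds[of i j "u i" "u j"] assignmentD[OF assms(1)] by (simp add: index_pairs_def)

lemma weight_nonneg: "u \<in> assignments \<Longrightarrow> 0 \<le> weight u"
  unfolding weight_def
proof (intro mult_nonneg_nonneg prod_nonneg)
  assume u: "u \<in> assignments"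
  show "0 \<le> \<delta> i (u i)" if "i \<in> {..<n}" for i
    using \<delta>_bounds[of i "u i"] assignmentD[OF u] that by simp
  show "0 \<le> (case x of (i, j) \<Rightarrow> \<theta> i j (u i) (u j))" if "x \<in> index_pairs n" for x
    using pair_factor_bounds[OF u] that by (cases x) simp
qed

lemma weight_le_pairs:
  assumes "u \<in> assignments"
  shows "weight u \<le> (\<Prod>(i, j)\<in>index_pairs n. \<theta> i j (u i) (u j))"
proof -
  have "(\<Prod>i<n. \<delta> i (u i)) \<le> 1"
    using \<delta>_bounds assms by (intro prod_le_1) auto
  moreover have "0 \<le> (\<Prod>(i, j)\<in>index_pairs n. \<theta> i j (u i) (u j))"
    using pair_factor_bounds[OF assms] by (intro prod_nonneg) (auto split: prod.splits)
  ultimately show ?thesis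
    unfolding weight_def by (rule mult_left_le)
qed

lemma weight_le_diag:
  assumes "u \<in> assignments"
  shows "weight u \<le> (\<Prod>i<n. \<delta> i (u i))"
proof -
  have "(\<Prod>(i, j)\<in>index_pairs n. \<theta> i j (u i) (u j)) \<le> 1"
    "0 \<le> (\<Prod>(i, j)\<in>index_pairs n. \<theta> i j (u i) (u j))"
    using pair_factor_bounds[OF assms] by (intro prod_le_1 prod_nonneg; auto split: prod.splits)+
  moreover have "0 \<le> (\<Prod>i<n. \<delta> i (u i))"
    using \<delta>_bounds assms by (intro prod_nonneg) auto
  ultimately show ?thesis
    unfolding weight_def by (intro mult_left_le_one_le)
qed

lemma weight_le_block:
  assumes "u \<in> assignments" "P \<subseteq> {..<n}" "Q \<subseteq> {..<n}" "P \<inter> Q = {}"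
  shows "weight u \<le> (\<Prod>i\<in>P. \<Prod>k\<in>Q. \<theta> i k (u i) (u k))"
proof -
  have "(\<Prod>(i, j)\<in>index_pairs n. \<theta> i j (u i) (u j)) \<le> (\<Prod>i\<in>P. \<Prod>k\<in>Q. \<theta> i k (u i) (u k))"
  proof (rule prod_index_pairs_le)
    show "\<theta> i j (u i) (u j) = \<theta> j i (u j) (u i)" for i j by (rule \<theta>_sym)
    show "0 \<le> \<theta> i j (u i) (u j) \<and> \<theta> i j (u i) (u j) \<le> 1" if "i < n" "j < n" "i \<noteq> j" for i j
      using that assms(1) by (intro \<theta>_bounds) auto
  qed (use assms in auto)
  then show ?thesis using weight_le_pairs[OF assms(1)] by linarith
qed

text \<open>Call a value frequent if it is taken at least 2t times. Two non-orthogonal frequent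
  values supply t^2 pairs of indices with decay. Otherwise the frequent values lie in one W, and
  every outlier takes one of at most N^2 infrequent values, each fewer than 2t times.\<close>

lemma weight_le_or_few_outliers:
  assumes u: "u \<in> assignments"
  shows "weight u \<le> exp (- \<kappa> * \<alpha> * real (t * t)) \<or> (\<exists>W\<in>Ws. card (outliers W u) \<le> 2 * N\<^sup>2 * t)"
proof -
  define idx where "idx v = {i. i < n \<and> u i = v}" for v
  \<comment> \<open>The factor 2 is for a value that is not orthogonal to itself: with v = w there
    must still be room for disjoint P and Q of size t.\<close>
  define S where "S = {v\<in>V. card (idx v) \<ge> 2 * t}"
  have fin_idx: "finite (idx v)" for v by (simp add: idx_def)
  show ?thesis
  proof (cases "\<forall>v\<in>S. \<forall>w\<in>S. perp v w")
    case False
    then obtain v w where vw: "v \<in> S" "w \<in> S" "\<not> perp v w" by blast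
    have "t \<le> card (idx v)" using vw(1) by (simp add: S_def)
    then obtain P where P: "P \<subseteq> idx v" "card P = t" "finite P"
      using obtain_subset_with_card_n by metis
    have "card (idx w - P) \<ge> card (idx w) - card P"
      using P(3) by (rule diff_card_le_card_Diff)
    moreover have "2 * t \<le> card (idx w)" using vw(2) by (simp add: S_def)
    ultimately have "t \<le> card (idx w - P)" using P(2) by linarith
    then obtain Q where Q: "Q \<subseteq> idx w - P" "card Q = t" "finite Q"
      using obtain_subset_with_card_n by metis
    have PQ: "P \<subseteq> {..<n}" "Q \<subseteq> {..<n}" "P \<inter> Q = {}"
      using P Q by (auto simp: idx_def)
    have "weight u \<le> (\<Prod>i\<in>P. \<Prod>k\<in>Q. \<theta> i k (u i) (u k))"
      by (rule weight_le_block[OF u PQ])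
    also have "\<dots> \<le> (\<Prod>i\<in>P. \<Prod>k\<in>Q. exp (- \<kappa> * \<alpha>))"
    proof -
      have "0 \<le> \<theta> i k (u i) (u k) \<and> \<theta> i k (u i) (u k) \<le> exp (- \<kappa> * \<alpha>)" if ik: "i \<in> P" "k \<in> Q" for i k
      proof -
      from ik have *: "i < n" "k < n" "i \<noteq> k" "u i = v" "u k = w" "v \<in> V" "w \<in> V"
        using P Q vw by (auto simp: idx_def S_def)
      then show ?thesis
        using \<theta>_not_perp[of i k v w] \<theta>_bounds[of i k v w] vw(3) by simp
      qed
      then show ?thesis by (intro prod_mono conjI prod_nonneg) auto
    qed
    also have "\<dots> = exp (- \<kappa> * \<alpha>) ^ (t * t)"
      using P Q by (simp add: power_mult)
    also have "\<dots> = exp (- \<kappa> * \<alpha> * real (t * t))"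
      by (simp add: exp_of_nat_mult[symmetric] mult_ac)
    finally show ?thesis by blast
  next
    case True
    then obtain W where W: "W \<in> Ws" "S \<subseteq> W"
      using Ws_cover[of S] by (auto simp: S_def)
    have "outliers W u \<subseteq> (\<Union>v\<in>V - S. idx v)"
      using W u by (auto simp: outliers_def idx_def)
    then have "card (outliers W u) \<le> card (\<Union>v\<in>V - S. idx v)"
      using finite_V fin_idx by (intro card_mono) auto
    also have "\<dots> \<le> (\<Sum>v\<in>V - S. card (idx v))"
      using finite_V by (intro card_UN_le) auto
    also have "\<dots> \<le> (\<Sum>v\<in>V - S. 2 * t)"
      by (intro sum_mono) (auto simp: S_def)
    also have "\<dots> \<le> card V * (2 * t)"
      using finite_V by (simp add: card_mono)
    finally show ?thesis
      using W card_V by (auto simp: mult_ac)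
  qed
qed

text \<open>An exponentially weighted count: each outlier is charged a factor x, so that the sum
  over all assignments factorises, and the bound on the number of outliers costs at most
  x^(-\<tau>). The base stays below N because W has at most N - 1 elements.\<close>

lemma sum_few_outliers_small:
  assumes "W \<in> Ws" "card W < N"
  shows "(\<Sum>u | u \<in> assignments \<and> card (outliers W u) \<le> \<tau>. weight u) \<le> (2 * real N ^ 2) ^ \<tau> * (real N - 1/2) ^ n"
proof -
  \<comment> \<open>Chosen so that x N^2 = 1/2 and the base (N - 1) + x N^2 equals N - 1/2.\<close>
  define x where "x = 1 / (2 * real N ^ 2)"
  have "1 \<le> real N ^ 2" using N_pos by (intro one_le_power) linarith
  then have "1 / (2 * real N ^ 2) \<le> 1 / 1" by (intro frac_le) linarith+
  then have x: "0 < x" "x \<le> 1" using N_pos by (simp_all add: x_def)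
  have W: "W \<subseteq> V" using Ws_sub assms by blast
  have w1: "weight u \<le> (\<Prod>i<n. if u i \<in> W then 1 else x) / x ^ \<tau>"
    if u: "u \<in> assignments" "card (outliers W u) \<le> \<tau>" for u
  proof -
    have "(\<Prod>i<n. if u i \<in> W then 1 else x) = (\<Prod>i\<in>outliers W u. x)"
      by (rule prod.mono_neutral_cong_right) (auto simp: outliers_def)
    also have "\<dots> = x ^ card (outliers W u)" by simp
    also have "\<dots> \<ge> x ^ \<tau>" using x u by (intro power_decreasing) auto
    finally have "1 \<le> (\<Prod>i<n. if u i \<in> W then 1 else x) / x ^ \<tau>"
      using x by (simp add: field_simps)
    moreover have "weight u \<le> 1"
    proof (rule order.trans[OF weight_le_diag[OF u(1)]], rule prod_le_1)
      fix i assume "i \<in> {..<n}"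
      then show "0 \<le> \<delta> i (u i) \<and> \<delta> i (u i) \<le> 1" using u(1) by (intro \<delta>_bounds) auto
    qed
    ultimately show ?thesis by linarith
  qed
  have "(\<Sum>u | u \<in> assignments \<and> card (outliers W u) \<le> \<tau>. weight u)
      \<le> (\<Sum>u | u \<in> assignments \<and> card (outliers W u) \<le> \<tau>. (\<Prod>i<n. if u i \<in> W then 1 else x) / x ^ \<tau>)"
    using w1 by (intro sum_mono) auto
  also have "\<dots> \<le> (\<Sum>u\<in>assignments. (\<Prod>i<n. if u i \<in> W then 1 else x) / x ^ \<tau>)"
    using x(1) by (intro sum_mono2 finite_assignments divide_nonneg_nonneg prod_nonneg zero_le_power) auto
  also have "\<dots> = (\<Prod>i<n. \<Sum>v\<in>V. if v \<in> W then 1 else x) / x ^ \<tau>"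
    using finite_V by (subst prod_sum_PiE) (auto simp: sum_divide_distrib)
  also have "(\<Sum>v\<in>V. if v \<in> W then 1 else x) = real (card W) + x * (real N ^ 2 - real (card W))"
  proof -
    have "(\<Sum>v\<in>V. if v \<in> W then 1 else x) = real (card W) + x * real (card (V - W))"
      using W finite_V by (simp add: sum.If_cases Int_absorb1 Diff_eq[symmetric])
    then show ?thesis
      using W finite_V card_V card_mono[OF finite_V W] by (simp add: card_Diff_subset finite_subset of_nat_diff)
  qed
  also have "(\<Prod>i<n. real (card W) + x * (real N ^ 2 - real (card W))) / x ^ \<tau> \<le> (real N - 1/2) ^ n / x ^ \<tau>"
  proof -
    have "card W \<le> card V" using W finite_V by (intro card_mono)
    then have cV: "real (card W) \<le> real N ^ 2" using card_V by (metis of_nat_le_iff of_nat_power)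
    have "real (card W) + x * (real N ^ 2 - real (card W)) \<le> (real N - 1) + x * real N ^ 2"
      using assms x by (intro add_mono mult_left_mono) auto
    also have "\<dots> = real N - 1/2" using N_pos by (simp add: x_def)
    finally show ?thesis
      using x cV by (auto intro!: divide_right_mono power_mono add_nonneg_nonneg)
  qed
  also have "\<dots> = (2 * real N ^ 2) ^ \<tau> * (real N - 1/2) ^ n"
    by (simp add: x_def power_divide)
  finally show ?thesis .
qed

text \<open>Only the factors between the outliers K and the other indices are kept. Once the values
  on K are fixed, the remaining indices decouple, and the sum over W in each of these n - |K| rows
  is bounded by \<open>\<theta>_outliers\<close>.\<close>

lemma sum_fixed_outliers:
  assumes W: "W \<in> Ws" "card W = N" and K: "K \<subseteq> {..<n}"
  shows "(\<Sum>u | u \<in> assignments \<and> outliers W u = K. weight u)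
     \<le> real N ^ (2 * card K) * (real N * contraction \<alpha> (card K)) ^ (n - card K)"
proof -
  let ?I = "{..<n} - K"
  have WV: "W \<subseteq> V" using Ws_sub W by blast
  have finK: "finite K" using K finite_subset by blast
  let ?X = "K \<rightarrow>\<^sub>E (V - W)" and ?Y = "?I \<rightarrow>\<^sub>E W"
  let ?g = "\<lambda>(x, y). \<Prod>i\<in>?I. \<Prod>k\<in>K. \<theta> i k (y i) (x k)"
  have fin: "finite ?X" "finite ?Y"
    using finK finite_V WV finite_subset by (auto intro!: finite_PiE)
  have "(\<Sum>u | u \<in> assignments \<and> outliers W u = K. weight u) \<le> sum ?g (?X \<times> ?Y)"
  proof (rule sum_le_included[where i = "\<lambda>(x, y). \<lambda>j\<in>{..<n}. if j \<in> K then x j else y j"])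
    show "finite {u \<in> assignments. outliers W u = K}" using finite_assignments by auto
    show "finite (?X \<times> ?Y)" using fin by auto
    show "\<forall>z\<in>?X \<times> ?Y. 0 \<le> ?g z"
    proof clarify
      fix x y assume xy: "x \<in> ?X" "y \<in> ?Y"
      show "0 \<le> (\<Prod>i\<in>?I. \<Prod>k\<in>K. \<theta> i k (y i) (x k))"
      proof (intro prod_nonneg)
        fix i k assume "i \<in> ?I" "k \<in> K"
        then show "0 \<le> \<theta> i k (y i) (x k)"
          using xy K WV \<theta>_bounds[of i k "y i" "x k"] by (auto simp: PiE_iff subset_iff)
      qed
    qed
    show "\<forall>u\<in>{u \<in> assignments. outliers W u = K}. \<exists>z\<in>?X \<times> ?Y.
       (case z of (x, y) \<Rightarrow> \<lambda>j\<in>{..<n}. if j \<in> K then x j else y j) = u \<and> weight u \<le> ?g z"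
    proof clarify
      fix u assume u: "u \<in> assignments" and Kd: "K = outliers W u"
      show "\<exists>z\<in>(outliers W u \<rightarrow>\<^sub>E (V - W)) \<times> (({..<n} - outliers W u) \<rightarrow>\<^sub>E W).
       (case z of (x, y) \<Rightarrow> \<lambda>j\<in>{..<n}. if j \<in> outliers W u then x j else y j) = u \<and>
       weight u \<le> (case z of (x, y) \<Rightarrow> \<Prod>i\<in>{..<n} - outliers W u. \<Prod>k\<in>outliers W u. \<theta> i k (y i) (x k))"
      proof (rule bexI[of _ "(restrict u K, restrict u ?I)"])
        show "(restrict u K, restrict u ?I) \<in> (outliers W u \<rightarrow>\<^sub>E (V - W)) \<times> (({..<n} - outliers W u) \<rightarrow>\<^sub>E W)"
          using u by (auto simp: Kd outliers_def)
        have "weight u \<le> (\<Prod>i\<in>?I. \<Prod>k\<in>K. \<theta> i k (u i) (u k))"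
          using u K by (intro weight_le_block) auto
        also have "\<dots> = (\<Prod>i\<in>?I. \<Prod>k\<in>K. \<theta> i k (restrict u ?I i) (restrict u K k))"
          by (intro prod.cong) auto
        finally show "(case (restrict u K, restrict u ?I) of (x, y) \<Rightarrow> \<lambda>j\<in>{..<n}. if j \<in> outliers W u then x j else y j) = u \<and>
          weight u \<le> (case (restrict u K, restrict u ?I) of (x, y) \<Rightarrow> \<Prod>i\<in>{..<n} - outliers W u. \<Prod>k\<in>outliers W u. \<theta> i k (y i) (x k))"
          using u by (auto simp: Kd fun_eq_iff PiE_iff extensional_def)
      qed
    qed
  qed
  also have "\<dots> = (\<Sum>x\<in>?X. \<Sum>y\<in>?Y. \<Prod>i\<in>?I. \<Prod>k\<in>K. \<theta> i k (y i) (x k))"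
    by (simp add: sum.cartesian_product)
  also have "\<dots> = (\<Sum>x\<in>?X. \<Prod>i\<in>?I. \<Sum>w\<in>W. \<Prod>k\<in>K. \<theta> i k w (x k))"
    using finite_V WV finite_subset by (intro sum.cong prod_sum_PiE[symmetric]) auto
  also have "\<dots> \<le> (\<Sum>x\<in>?X. \<Prod>i\<in>?I. real N * contraction \<alpha> (card K))"
  proof (intro sum_mono prod_mono conjI sum_nonneg prod_nonneg)
    fix x i assume x: "x \<in> ?X" and i: "i \<in> ?I"
    show "(\<Sum>w\<in>W. \<Prod>k\<in>K. \<theta> i k w (x k)) \<le> real N * contraction \<alpha> (card K)"
      using x i by (intro \<theta>_outliers[OF W K]) auto
    fix w k assume "w \<in> W" "k \<in> K"
    then show "0 \<le> \<theta> i k w (x k)"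
      using x i K WV \<theta>_bounds[of i k w "x k"] by (auto simp: PiE_iff subset_iff)
  qed
  also have "\<dots> = real (card ?X) * (real N * contraction \<alpha> (card K)) ^ (n - card K)"
    using K finK by (simp add: card_Diff_subset)
  also have "\<dots> \<le> real N ^ (2 * card K) * (real N * contraction \<alpha> (card K)) ^ (n - card K)"
  proof (rule mult_right_mono)
    have "card ?X = card (V - W) ^ card K"
      using finK by (simp add: card_PiE)
    also have "\<dots> \<le> (N\<^sup>2) ^ card K"
      using finite_V card_V by (intro power_mono) (metis card_mono Diff_subset, simp)
    finally show "real (card ?X) \<le> real N ^ (2 * card K)"
      by (simp add: power_mult flip: of_nat_power)
  qed simp
  finally show ?thesis .
qed

text \<open>Without outliers no decay of the off-diagonal factors is available, so the saving has to
  come from the diagonal factors; where it is not granted there, every assignment into W is good and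
  the sum is empty.\<close>

lemma sum_bad_inside:
  assumes W: "W \<in> Ws" "card W = N"
  shows "(\<Sum>u | u \<in> assignments \<and> outliers W u = {} \<and> \<not> good u. weight u) \<le> (real N * contraction \<alpha> 1) ^ n"
proof (cases "\<forall>u\<in>{..<n} \<rightarrow>\<^sub>E W. good u")
  case True
  have "u \<in> {..<n} \<rightarrow>\<^sub>E W" if "u \<in> assignments" "outliers W u = {}" for u
  proof (rule PiE_I)
    show "u i \<in> W" if "i \<in> {..<n}" for i
      using that \<open>outliers W u = {}\<close> unfolding outliers_def by blast
  qed (use that(1) in \<open>rule PiE_arb\<close>)
  then have "{u. u \<in> assignments \<and> outliers W u = {} \<and> \<not> good u} = {}"
    using True by (metis (mono_tags, lifting) empty_Collect_eq)
  then show ?thesis by (simp only: sum.empty) simp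
next
  case False
  have WV: "W \<subseteq> V" using Ws_sub W by blast
  have finW: "finite W" using WV finite_V finite_subset by blast
  have sub: "{..<n} \<rightarrow>\<^sub>E W \<subseteq> assignments" using WV by (intro PiE_mono) auto
  have "(\<Sum>u | u \<in> assignments \<and> outliers W u = {} \<and> \<not> good u. weight u) \<le> (\<Sum>u\<in>{..<n} \<rightarrow>\<^sub>E W. weight u)"
  proof (rule sum_mono2)
    show "finite ({..<n} \<rightarrow>\<^sub>E W)" using finW by (intro finite_PiE) auto
    show "{u. u \<in> assignments \<and> outliers W u = {} \<and> \<not> good u} \<subseteq> {..<n} \<rightarrow>\<^sub>E W"
      by (intro subsetI PiE_I) (auto simp: outliers_def)
    show "0 \<le> weight b" if "b \<in> ({..<n} \<rightarrow>\<^sub>E W) - {u. u \<in> assignments \<and> outliers W u = {} \<and> \<not> good u}" for b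
      using that sub by (intro weight_nonneg) auto
  qed
  also have "\<dots> \<le> (\<Sum>u\<in>{..<n} \<rightarrow>\<^sub>E W. \<Prod>i<n. \<delta> i (u i))"
    using sub by (intro sum_mono weight_le_diag) auto
  also have "\<dots> = (\<Prod>i<n. \<Sum>w\<in>W. \<delta> i w)"
    using finW by (intro prod_sum_PiE[symmetric]) auto
  also have "\<dots> \<le> (\<Prod>i<n. real N * contraction \<alpha> 1)"
    using \<delta>_inside[OF W] False \<delta>_bounds WV by (intro prod_mono conjI sum_nonneg) auto
  finally show ?thesis by simp
qed

text \<open>Assignments are sorted by their exact set of outliers. The empty set is treated apart,
  since it alone relies on the diagonal factors and on \<open>good\<close>.\<close>

lemma sum_few_outliers_max:
  assumes W: "W \<in> Ws" "card W = N"
  shows "(\<Sum>u | u \<in> assignments \<and> card (outliers W u) \<le> \<tau> \<and> \<not> good u. weight u)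
     \<le> (real N * contraction \<alpha> 1) ^ n +
       (\<Sum>K | K \<subseteq> {..<n} \<and> K \<noteq> {} \<and> card K \<le> \<tau>.
          real N ^ (2 * card K) * (real N * contraction \<alpha> (card K)) ^ (n - card K))"
proof -
  let ?U = "{u. u \<in> assignments \<and> card (outliers W u) \<le> \<tau> \<and> \<not> good u}"
  let ?KK = "{K. K \<subseteq> {..<n} \<and> K \<noteq> {} \<and> card K \<le> \<tau>}"
  have finU: "finite ?U" using finite_assignments by auto
  have finK: "finite ?KK" by (rule finite_subset[of _ "Pow {..<n}"]) auto
  have "sum weight ?U = (\<Sum>K\<in>insert {} ?KK. \<Sum>u | u \<in> ?U \<and> outliers W u = K. weight u)"
    proof (rule sum.group[symmetric])
    show "outliers W ` ?U \<subseteq> insert {} ?KK"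
    proof clarify
      fix u assume "card (outliers W u) \<le> \<tau>" "outliers W u \<noteq> {}"
      then show "outliers W u \<subseteq> {..<n} \<and> outliers W u \<noteq> {} \<and> card (outliers W u) \<le> \<tau>"
        by (auto simp: outliers_def)
    qed
  qed (use finU finK in simp_all)
  also have "\<dots> = (\<Sum>u | u \<in> ?U \<and> outliers W u = {}. weight u) + (\<Sum>K\<in>?KK. \<Sum>u | u \<in> ?U \<and> outliers W u = K. weight u)"
    using finK by simp
  also have "\<dots> \<le> (real N * contraction \<alpha> 1) ^ n +
       (\<Sum>K\<in>?KK. real N ^ (2 * card K) * (real N * contraction \<alpha> (card K)) ^ (n - card K))"
  proof (intro add_mono sum_mono)
    have "{u. u \<in> ?U \<and> outliers W u = {}} = {u. u \<in> assignments \<and> outliers W u = {} \<and> \<not> good u}" by auto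
    then show "(\<Sum>u | u \<in> ?U \<and> outliers W u = {}. weight u) \<le> (real N * contraction \<alpha> 1) ^ n"
      using sum_bad_inside[OF W] by simp
    fix K assume K: "K \<in> ?KK"
    have "(\<Sum>u | u \<in> ?U \<and> outliers W u = K. weight u) \<le> (\<Sum>u | u \<in> assignments \<and> outliers W u = K. weight u)"
      using finite_assignments weight_nonneg by (intro sum_mono2) auto
    also have "\<dots> \<le> real N ^ (2 * card K) * (real N * contraction \<alpha> (card K)) ^ (n - card K)"
      using K by (intro sum_fixed_outliers[OF W]) auto
    finally show "(\<Sum>u | u \<in> ?U \<and> outliers W u = K. weight u) \<le> real N ^ (2 * card K) * (real N * contraction \<alpha> (card K)) ^ (n - card K)" .
  qed
  finally show ?thesis .
qed

lemma Ws_subset_Pow: "Ws \<subseteq> Pow V"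
  using Ws_sub by blast

lemma finite_Ws: "finite Ws"
  using finite_subset[OF Ws_subset_Pow] finite_V by blast

lemma card_Ws: "card Ws \<le> 2 ^ N\<^sup>2"
proof -
  have "card Ws \<le> card (Pow V)"
    using finite_V by (intro card_mono Ws_subset_Pow) simp
  then show ?thesis using finite_V card_V by (simp add: card_Pow)
qed

text \<open>The first term covers assignments with two frequent non-orthogonal values. The others
  are summed over the possible W: \<open>card W < N\<close> in the second term,
  \<open>card W = N\<close> in the last two, without and with outliers.\<close>

lemma sum_bad_le:
  "(\<Sum>u | u \<in> assignments \<and> \<not> good u. weight u) \<le>
     real N ^ (2 * n) * exp (- \<kappa> * \<alpha> * real (t * t)) +
     2 ^ N\<^sup>2 * ((2 * real N ^ 2) ^ (2 * N\<^sup>2 * t) * (real N - 1/2) ^ n + ((real N * contraction \<alpha> 1) ^ n +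
       (\<Sum>K | K \<subseteq> {..<n} \<and> K \<noteq> {} \<and> card K \<le> 2 * N\<^sup>2 * t.
          real N ^ (2 * card K) * (real N * contraction \<alpha> (card K)) ^ (n - card K))))"
proof -
  let ?\<tau> = "2 * N\<^sup>2 * t"
  let ?e = "exp (- \<kappa> * \<alpha> * real (t * t))"
  let ?B2 = "(2 * real N ^ 2) ^ ?\<tau> * (real N - 1/2) ^ n"
  let ?B3 = "(real N * contraction \<alpha> 1) ^ n +
       (\<Sum>K | K \<subseteq> {..<n} \<and> K \<noteq> {} \<and> card K \<le> ?\<tau>.
          real N ^ (2 * card K) * (real N * contraction \<alpha> (card K)) ^ (n - card K))"
  let ?U = "{u. u \<in> assignments \<and> \<not> good u}"
  have finU: "finite ?U" using finite_assignments by auto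
  have N1: "real N \<ge> 1" using N_pos by linarith
  have B: "0 \<le> ?B2" "0 \<le> ?B3"
    using N1 by (intro mult_nonneg_nonneg add_nonneg_nonneg sum_nonneg zero_le_power contraction_nonneg; simp)+
  \<comment> \<open>An assignment may be counted for several W; the weights are nonnegative, so this
    only enlarges the bound.\<close>
  have "sum weight ?U \<le> (\<Sum>u\<in>?U. ?e + (\<Sum>W\<in>Ws. if card (outliers W u) \<le> ?\<tau> then weight u else 0))"
  proof (rule sum_mono)
    fix u assume "u \<in> ?U"
    then have u: "u \<in> assignments" by simp
    have nn: "0 \<le> (\<Sum>W\<in>Ws. if card (outliers W u) \<le> ?\<tau> then weight u else 0)"
      using weight_nonneg[OF u] by (intro sum_nonneg) auto
    from weight_le_or_few_outliers[OF u, of t]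
    show "weight u \<le> ?e + (\<Sum>W\<in>Ws. if card (outliers W u) \<le> ?\<tau> then weight u else 0)"
    proof
      assume "weight u \<le> ?e"
      then show ?thesis using nn by linarith
    next
      assume "\<exists>W\<in>Ws. card (outliers W u) \<le> ?\<tau>"
      then obtain W where W: "W \<in> Ws" "card (outliers W u) \<le> ?\<tau>" by blast
      have "(if card (outliers W u) \<le> ?\<tau> then weight u else 0) \<le> (\<Sum>W\<in>Ws. if card (outliers W u) \<le> ?\<tau> then weight u else 0)"
        using W finite_Ws weight_nonneg[OF u] by (intro member_le_sum) auto
      then show ?thesis using W exp_gt_zero[of "- \<kappa> * \<alpha> * real (t * t)"] by (simp del: exp_gt_zero)
    qed
  qed
  also have "\<dots> = real (card ?U) * ?e + (\<Sum>W\<in>Ws. \<Sum>u\<in>?U. if card (outliers W u) \<le> ?\<tau> then weight u else 0)"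
    by (simp add: sum.distrib sum.swap[of _ Ws])
  also have "\<dots> \<le> real N ^ (2 * n) * ?e + (\<Sum>W\<in>Ws. ?B2 + ?B3)"
  proof (intro add_mono mult_right_mono sum_mono)
    have "card ?U \<le> card assignments"
      using finite_assignments by (intro card_mono) auto
    also have "\<dots> = N ^ (2 * n)" using card_V by (simp add: card_PiE power_mult)
    finally show "real (card ?U) \<le> real N ^ (2 * n)" by (metis of_nat_le_iff of_nat_power)
    fix W assume W: "W \<in> Ws"
    have "(\<Sum>u\<in>?U. if card (outliers W u) \<le> ?\<tau> then weight u else 0)
        = (\<Sum>u | u \<in> assignments \<and> card (outliers W u) \<le> ?\<tau> \<and> \<not> good u. weight u)"
      using finU by (intro sum.mono_neutral_cong_right) auto
    also have "\<dots> \<le> ?B2 + ?B3"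
    proof (cases "card W = N")
      case True
      then show ?thesis using sum_few_outliers_max[OF W True, of ?\<tau>] B by linarith
    next
      case False
      then have "card W < N" using Ws_sub[OF W] by simp
      have "(\<Sum>u | u \<in> assignments \<and> card (outliers W u) \<le> ?\<tau> \<and> \<not> good u. weight u)
         \<le> (\<Sum>u | u \<in> assignments \<and> card (outliers W u) \<le> ?\<tau>. weight u)"
        using finite_assignments weight_nonneg by (intro sum_mono2) auto
      then show ?thesis using sum_few_outliers_small[OF W \<open>card W < N\<close>, of ?\<tau>] B by linarith
    qed
    finally show "(\<Sum>u\<in>?U. if card (outliers W u) \<le> ?\<tau> then weight u else 0) \<le> ?B2 + ?B3" .
  qed simp
  also have "(\<Sum>W\<in>Ws. ?B2 + ?B3) \<le> 2 ^ N\<^sup>2 * (?B2 + ?B3)"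
  proof -
    have "real (card Ws) \<le> 2 ^ N\<^sup>2"
      using card_Ws by (metis of_nat_le_iff of_nat_numeral of_nat_power)
    then have "real (card Ws) * (?B2 + ?B3) \<le> 2 ^ N\<^sup>2 * (?B2 + ?B3)"
      using B by (intro mult_right_mono) auto
    then show ?thesis by simp
  qed
  finally show ?thesis by simp
qed

end

section \<open>Asymptotics of the bad contribution\<close>

lemma exp_linear_decay:
  assumes "\<epsilon> > 0" "eventually (\<lambda>n. f n \<le> - \<epsilon> * real n) sequentially"
  shows "(\<lambda>n. exp (f n)) \<longlonglongrightarrow> 0"
proof (rule tendsto_sandwich[where f = "\<lambda>_. 0" and h = "\<lambda>n. exp (- \<epsilon> * real n)"])
  show "(\<lambda>n. exp (- \<epsilon> * real n)) \<longlonglongrightarrow> 0"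
    using assms(1) by real_asymp
  show "eventually (\<lambda>n. exp (f n) \<le> exp (- \<epsilon> * real n)) sequentially"
    using assms(2) by eventually_elim simp
qed auto

text \<open>The threshold t must be o(n), so that outliers are few, while \<alpha> t^2 must exceed
  every multiple of n. As \<alpha> is of order (ln n) / n, any exponent strictly between 0 and 1/2
  would do; with 1/3 the quotient \<alpha> t^2 / n grows like (ln n)^(1/3).\<close>

definition frequency :: "nat \<Rightarrow> nat" where
  "frequency n = nat \<lceil>real n / (ln (real n) powr (1/3))\<rceil>"

lemma frequency_bounds:
  "real n / (ln (real n) powr (1/3)) \<le> real (frequency n)"
  "real (frequency n) \<le> real n / (ln (real n) powr (1/3)) + 1"
proof -
  let ?x = "real n / (ln (real n) powr (1/3))"
  have x: "0 \<le> ?x" by simp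
  then have "0 \<le> \<lceil>?x\<rceil>" by linarith
  then have "real (frequency n) = of_int \<lceil>?x\<rceil>"
    unfolding frequency_def by simp
  then show "?x \<le> real (frequency n)" "real (frequency n) \<le> ?x + 1"
    using ceiling_correct[of ?x] by linarith+
qed

lemma frequency_over_n: "(\<lambda>n. real (frequency n) / real n) \<longlonglongrightarrow> 0"
proof (rule tendsto_sandwich[where f = "\<lambda>_. 0" and h = "\<lambda>n. (real n / (ln (real n) powr (1/3)) + 1) / real n"])
  show "(\<lambda>n. (real n / (ln (real n) powr (1/3)) + 1) / real n) \<longlonglongrightarrow> 0"
    by real_asymp
  show "eventually (\<lambda>n. real (frequency n) / real n \<le> (real n / (ln (real n) powr (1/3)) + 1) / real n) sequentially"
    using frequency_bounds(2) by (intro always_eventually allI divide_right_mono) auto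
qed auto

lemma frequency_square_large:
  assumes "c > 0"
  shows "filterlim (\<lambda>n. c * ln (real n) / real n * (real (frequency n) * real (frequency n)) / real n) at_top sequentially"
proof (rule filterlim_at_top_mono)
  show "filterlim (\<lambda>n. c * ln (real n) / real n * (real n / (ln (real n) powr (1/3)) * (real n / (ln (real n) powr (1/3)))) / real n) at_top sequentially"
    using assms by real_asymp
  show "eventually (\<lambda>n. c * ln (real n) / real n * (real n / (ln (real n) powr (1/3)) * (real n / (ln (real n) powr (1/3)))) / real n
     \<le> c * ln (real n) / real n * (real (frequency n) * real (frequency n)) / real n) sequentially"
    using eventually_ge_at_top[of 2]
  proof eventually_elim
    case (elim n)
    then show ?case
      using frequency_bounds(1)[of n] assms
      by (intro divide_right_mono mult_left_mono mult_mono) auto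
  qed
qed

section \<open>Sums over sets of outliers\<close>

lemma sum_Pow_power_card:
  fixes y :: real
  assumes "finite A"
  shows "(\<Sum>K\<in>Pow A. y ^ card K) = (1 + y) ^ card A"
  using prod_add[OF assms, of "\<lambda>_. y" "\<lambda>_. 1"] by (simp add: add.commute)

lemma exp_neg_le_quadratic:
  fixes y :: real
  assumes "y \<ge> 0"
  shows "exp (- y) \<le> 1 - y + y\<^sup>2 / 2"
proof -
  define f where "f x = 1 - x + x\<^sup>2 / 2 - exp (- x)" for x :: real
  have "f 0 \<le> f y"
  proof (rule DERIV_nonneg_imp_nondecreasing[OF assms])
    fix x assume "0 \<le> x" "x \<le> y"
    have "(f has_real_derivative (- 1 + x + exp (- x))) (at x)"
      unfolding f_def by (auto intro!: derivative_eq_intros)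
    moreover have "- 1 + x + exp (- x) \<ge> 0"
      using exp_ge_add_one_self[of "- x"] by simp
    ultimately show "\<exists>y. (f has_real_derivative y) (at x) \<and> 0 \<le> y" by blast
  qed
  then show ?thesis by (simp add: f_def)
qed

text \<open>The coefficient of \<alpha> s in the exponent tends to -1 as \<alpha> and \<alpha> s
  tend to 0, which is what \<open>c > 1\<close> needs. With y as defined below, (1 + exp (-y)) / 2
  is 1 - y/2 to first order, and the square root halves the loss; the quadratic Taylor term becomes
  the correction 1 - 2 \<alpha> s.\<close>

lemma contraction_le_exp:
  assumes "0 \<le> \<alpha>" "\<alpha> \<le> 1/2"
  shows "contraction \<alpha> s \<le> exp (- \<alpha> * (1 - \<alpha>) * s * (1 - 2 * \<alpha> * s))"
proof -
  define y where "y = 4 * \<alpha> * (1 - \<alpha>) * real s"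
  have y0: "y \<ge> 0" using assms by (simp add: y_def)
  have "0 \<le> 1 - 4 * \<alpha> * (1 - \<alpha>)"
    using zero_le_power2[of "2 * \<alpha> - 1"] by (simp add: power2_eq_square algebra_simps)
  moreover have "1 - 4 * \<alpha> * (1 - \<alpha>) \<le> exp (- (4 * \<alpha> * (1 - \<alpha>)))"
    using exp_ge_add_one_self[of "- (4 * \<alpha> * (1 - \<alpha>))"] by simp
  ultimately have "(1 - 4 * \<alpha> * (1 - \<alpha>)) ^ s \<le> exp (- (4 * \<alpha> * (1 - \<alpha>))) ^ s"
    by (intro power_mono)
  also have "\<dots> = exp (- y)" by (simp add: y_def exp_of_nat_mult[symmetric] mult_ac)
  also have "\<dots> \<le> 1 - y + y\<^sup>2 / 2" by (rule exp_neg_le_quadratic[OF y0])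
  finally have "(1 + (1 - 4 * \<alpha> * (1 - \<alpha>)) ^ s) / 2 \<le> 1 + (- y / 2 * (1 - y / 2))"
    by (simp add: power2_eq_square field_simps)
  also have "\<dots> \<le> exp (- y / 2 * (1 - y / 2))"
    by (rule exp_ge_add_one_self)
  also have "- y / 2 * (1 - y / 2) \<le> - y / 2 * (1 - 2 * \<alpha> * s)"
  proof -
    have "y / 2 \<le> 2 * \<alpha> * s"
    proof -
      have "\<alpha> * s * (1 - \<alpha>) \<le> \<alpha> * s"
        using assms by (intro mult_left_le) auto
      then show ?thesis by (simp add: y_def algebra_simps)
    qed
    then have "y / 2 * (1 - 2 * \<alpha> * s) \<le> y / 2 * (1 - y / 2)"
      using y0 by (intro mult_left_mono) auto
    then show ?thesis by simp
  qed
  also have "- y / 2 * (1 - 2 * \<alpha> * s) = 2 * (- \<alpha> * (1 - \<alpha>) * s * (1 - 2 * \<alpha> * s))"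
    by (simp add: y_def)
  also have "exp \<dots> = (exp (- \<alpha> * (1 - \<alpha>) * s * (1 - 2 * \<alpha> * s)))\<^sup>2"
    by (simp only: exp_double)
  finally have "(1 + (1 - 4 * \<alpha> * (1 - \<alpha>)) ^ s) / 2 \<le> (exp (- \<alpha> * (1 - \<alpha>) * s * (1 - 2 * \<alpha> * s)))\<^sup>2" by simp
  then show ?thesis
    unfolding contraction_def by (intro real_le_lsqrt) auto
qed

text \<open>When \<alpha> s is not small, the exponent in \<open>contraction_le_exp\<close> may have
  the wrong sign. For \<eta> > 0 a fixed constant below 1 is then enough, since it will be raised to
  a power close to n.\<close>

lemma contraction_le_const:
  assumes "0 \<le> \<alpha>" "\<alpha> \<le> 1/2" "2 * \<alpha> * s \<ge> \<eta>"
  shows "contraction \<alpha> s \<le> sqrt ((1 + exp (- \<eta>)) / 2)"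
proof -
  have "0 \<le> 1 - 4 * \<alpha> * (1 - \<alpha>)"
    using zero_le_power2[of "2 * \<alpha> - 1"] by (simp add: power2_eq_square algebra_simps)
  moreover have "1 - 4 * \<alpha> * (1 - \<alpha>) \<le> exp (- (4 * \<alpha> * (1 - \<alpha>)))"
    using exp_ge_add_one_self[of "- (4 * \<alpha> * (1 - \<alpha>))"] by simp
  ultimately have "(1 - 4 * \<alpha> * (1 - \<alpha>)) ^ s \<le> exp (- (4 * \<alpha> * (1 - \<alpha>))) ^ s"
    by (intro power_mono)
  also have "\<dots> = exp (- (2 * \<alpha> * s) * (2 * (1 - \<alpha>)))" by (simp add: exp_of_nat_mult[symmetric] mult_ac)
  also have "\<dots> \<le> exp (- \<eta>)"
  proof -
    have "2 * \<alpha> * s * 1 \<le> 2 * \<alpha> * s * (2 * (1 - \<alpha>))"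
      using assms by (intro mult_left_mono) auto
    then show ?thesis using assms(3) by simp
  qed
  finally show ?thesis unfolding contraction_def by simp
qed

text \<open>For sets K with \<alpha> |K| small the term is at most (N n^(-c'))^|K| with 1 < c' < c,
  and the binomial theorem makes the sum over all nonempty K tend to 0. For larger K the contraction
  is at most a constant \<rho> < 1; its power n - |K| beats the number of sets of size o(n), which
  is estimated by weights x^|K|.\<close>

lemma sum_outlier_sets_tendsto_0:
  fixes c :: real and N :: nat and \<tau> :: "nat \<Rightarrow> nat"
  assumes c: "c > 1" and N: "N > 0" and \<alpha>: "\<And>n. n \<ge> 1 \<Longrightarrow> \<alpha> n = c * ln (real n) / real n"
    and \<tau>: "(\<lambda>n. real (\<tau> n) / real n) \<longlonglongrightarrow> 0"
  shows "(\<lambda>n. \<Sum>K | K \<subseteq> {..<n} \<and> K \<noteq> {} \<and> card K \<le> \<tau> n. real N ^ card K * contraction (\<alpha> n) (card K) ^ (n - card K)) \<longlonglongrightarrow> 0"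
proof -
  define c' where "c' = (1 + c) / 2"
  \<comment> \<open>Then 1 - 3\<eta> = c'/c: three correction factors, each at least 1 - \<eta>,
    reduce the exponent c to no less than c'.\<close>
  define \<eta> where "\<eta> = (1 - c' / c) / 3"
  have c': "1 < c'" "c' < c" using c by (auto simp: c'_def)
  have \<eta>: "0 < \<eta>" "\<eta> < 1" using c c' by (auto simp: \<eta>_def field_simps)
  define \<rho> where "\<rho> = sqrt ((1 + exp (- \<eta>)) / 2)"
  have \<rho>: "0 < \<rho>" "\<rho> < 1" using \<eta> by (auto simp: \<rho>_def add_pos_pos)
  define L where "L = - ln \<rho>"
  have L: "0 < L" using \<rho> by (simp add: L_def)
  \<comment> \<open>The bound N x \<le> L/2 keeps (1 + N x)^n below exp (n L / 2), which uses up
    half of the decay exp (- n L).\<close>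
  define x where "x = min 1 (L / (2 * real N))"
  have x: "0 < x" "x \<le> 1" "real N * x \<le> L / 2"
    using L N by (auto simp: x_def min_def field_simps)
  \<comment> \<open>The subtracted 1 is the term of the empty set, which is excluded from the
    sum.\<close>
  define small where "small n = (1 + real N * real n powr (- c')) ^ n - 1" for n :: nat
  define mid where "mid n = exp (real (\<tau> n) * (- ln x + L) - real n * L / 2)" for n :: nat
  have small: "small \<longlonglongrightarrow> 0"
  proof (rule tendsto_sandwich[where f = "\<lambda>_. 0" and h = "\<lambda>n. exp (real N * real n powr (1 - c')) - 1"])
    show "(\<lambda>n. exp (real N * real n powr (1 - c')) - 1) \<longlonglongrightarrow> 0"
      using c' by real_asymp
    show "eventually (\<lambda>n. 0 \<le> small n) sequentially"
      by (rule always_eventually) (auto simp: small_def intro!: one_le_power)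
    show "eventually (\<lambda>n. small n \<le> exp (real N * real n powr (1 - c')) - 1) sequentially"
      using eventually_ge_at_top[of 1]
    proof eventually_elim
      case (elim n)
      have "(1 + real N * real n powr (- c')) ^ n \<le> exp (real N * real n powr (- c')) ^ n"
        by (intro power_mono exp_ge_add_one_self) auto
      also have "\<dots> = exp (real N * (real n * real n powr (- c')))"
        by (simp add: exp_of_nat_mult[symmetric] mult_ac)
      also have "real n * real n powr (- c') = real n powr (1 - c')"
        using elim powr_add[of "real n" 1 "- c'"] by simp
      finally show ?case by (simp add: small_def)
    qed
  qed simp
  have mid: "mid \<longlonglongrightarrow> 0"
    unfolding mid_def
  proof (rule exp_linear_decay[of "L / 4"])
    have "(\<lambda>n. real (\<tau> n) / real n * (- ln x + L)) \<longlonglongrightarrow> 0 * (- ln x + L)"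
      by (intro tendsto_intros \<tau>)
    then have "eventually (\<lambda>n. real (\<tau> n) / real n * (- ln x + L) < L / 4) sequentially"
      using L by (intro order_tendstoD) auto
    then show "eventually (\<lambda>n. real (\<tau> n) * (- ln x + L) - real n * L / 2 \<le> - (L / 4) * real n) sequentially"
      using eventually_ge_at_top[of 1]
    proof eventually_elim
      case (elim n)
      then have "real (\<tau> n) * (- ln x + L) \<le> real n * (L / 4)"
        by (simp add: field_simps)
      then show ?case by (simp add: field_simps)
    qed
  qed (use L in simp)
  have \<alpha>_lim: "\<alpha> \<longlonglongrightarrow> 0"
  proof (rule Lim_transform_eventually)
    show "(\<lambda>n. c * ln (real n) / real n) \<longlonglongrightarrow> 0" by real_asymp
    show "eventually (\<lambda>n. c * ln (real n) / real n = \<alpha> n) sequentially"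
      using eventually_ge_at_top[of 1] by eventually_elim (simp add: \<alpha>)
  qed
  have ev\<alpha>: "eventually (\<lambda>n. \<alpha> n < min \<eta> (1/2)) sequentially"
    using \<eta> by (intro order_tendstoD(2)[OF \<alpha>_lim]) auto
  have ev: "eventually (\<lambda>n. (\<Sum>K | K \<subseteq> {..<n} \<and> K \<noteq> {} \<and> card K \<le> \<tau> n. real N ^ card K * contraction (\<alpha> n) (card K) ^ (n - card K)) \<le> small n + mid n) sequentially"
    using eventually_ge_at_top[of 2] ev\<alpha> order_tendstoD(2)[OF \<tau> \<eta>(1)]
  proof eventually_elim
    case (elim n)
    have n: "n \<ge> 2" by fact
    have ln0: "ln (real n) > 0" using n by simp
    have an: "\<alpha> n * n = c * ln n" using \<alpha>[of n] n by simp
    have a: "0 \<le> \<alpha> n" "\<alpha> n \<le> 1/2" "\<alpha> n \<le> \<eta>"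
      using \<alpha>[of n] n c elim by auto
    have \<tau>n: "real (\<tau> n) \<le> \<eta> * n" using elim n by (simp add: field_simps)
    let ?KK = "{K. K \<subseteq> {..<n} \<and> K \<noteq> {} \<and> card K \<le> \<tau> n}"
    let ?f = "\<lambda>K. real N ^ card K * contraction (\<alpha> n) (card K) ^ (n - card K)"
    have fin: "finite ?KK" by (rule finite_subset[of _ "Pow {..<n}"]) auto
    have f: "?f K \<le> (real N * real n powr (- c')) ^ card K + x ^ card K * real N ^ card K * exp (real (\<tau> n) * (- ln x + L) - real n * L)"
      if K: "K \<in> ?KK" for K
    proof -
      let ?s = "card K"
      have s: "?s \<le> \<tau> n" "?s \<le> n" using K card_mono[of "{..<n}" K] by auto
      show ?thesis
      proof (cases "2 * \<alpha> n * ?s \<le> \<eta>")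
        case True
        have "contraction (\<alpha> n) ?s ^ (n - ?s) \<le> exp (- \<alpha> n * (1 - \<alpha> n) * ?s * (1 - 2 * \<alpha> n * ?s)) ^ (n - ?s)"
          by (intro power_mono contraction_le_exp a) simp
        \<comment> \<open>Writing n - |K| as n (1 - |K|/n) displays the three corrections to the
          exponent c ln n that each outlier contributes.\<close>
        also have "\<dots> = exp (- (?s * ((\<alpha> n * n) * ((1 - \<alpha> n) * (1 - 2 * \<alpha> n * ?s) * (1 - ?s / n)))))"
          using s n by (simp add: exp_of_nat_mult[symmetric] of_nat_diff field_simps)
        also have "\<dots> \<le> exp (- (?s * (c' * ln n)))"
        proof -
          have sn: "?s / n \<le> \<eta>" using s \<tau>n n by (simp add: field_simps)
          have "(1 - \<eta>) * (1 - \<eta>) * (1 - \<eta>) \<le> (1 - \<alpha> n) * (1 - 2 * \<alpha> n * ?s) * (1 - ?s / n)"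
            using a True sn \<eta> by (intro mult_mono) auto
          moreover have "1 - 3 * \<eta> \<le> (1 - \<eta>) * (1 - \<eta>) * (1 - \<eta>)"
          proof -
            have "0 \<le> \<eta>\<^sup>2 * (3 - \<eta>)" using \<eta> by simp
            then show ?thesis by (simp add: algebra_simps power2_eq_square)
          qed
          moreover have "1 - 3 * \<eta> = c' / c" by (simp add: \<eta>_def field_simps)
          ultimately have "c * ln n * (c' / c) \<le> c * ln n * ((1 - \<alpha> n) * (1 - 2 * \<alpha> n * ?s) * (1 - ?s / n))"
            using c ln0 by (intro mult_left_mono) auto
          then have "c' * ln n \<le> \<alpha> n * n * ((1 - \<alpha> n) * (1 - 2 * \<alpha> n * ?s) * (1 - ?s / n))"
            unfolding an using c by (simp add: mult.commute)
          then have "?s * (c' * ln n) \<le> ?s * (\<alpha> n * n * ((1 - \<alpha> n) * (1 - 2 * \<alpha> n * ?s) * (1 - ?s / n)))"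
            by (intro mult_left_mono) auto
          then show ?thesis by simp
        qed
        also have "\<dots> = (real n powr (- c')) ^ ?s"
          using n by (simp add: powr_def exp_of_nat_mult[symmetric])
        finally have "?f K \<le> real N ^ ?s * (real n powr (- c')) ^ ?s"
          by (intro mult_left_mono) auto
        moreover have "0 \<le> x ^ ?s * real N ^ ?s * exp (real (\<tau> n) * (- ln x + L) - real n * L)"
          using x by simp
        ultimately show ?thesis by (simp add: power_mult_distrib)
      next
        case False
        have "contraction (\<alpha> n) ?s ^ (n - ?s) \<le> \<rho> ^ (n - ?s)"
          unfolding \<rho>_def using False by (intro power_mono contraction_le_const a) auto
        also have "\<dots> \<le> \<rho> ^ (n - \<tau> n)"
          using \<rho> s by (intro power_decreasing) auto
        also have "\<dots> \<le> \<rho> powr (real n - real (\<tau> n))"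
        proof -
          have "\<tau> n \<le> n" using \<tau>n \<eta> n
            by (metis less_eq_real_def mult_left_le_one_le of_nat_0_le_iff of_nat_le_iff order_trans)
          then show ?thesis using \<rho> by (simp add: powr_realpow[symmetric] of_nat_diff)
        qed
        also have "\<dots> = exp (real (\<tau> n) * L - real n * L)"
          using \<rho> by (simp add: powr_def L_def algebra_simps)
        \<comment> \<open>Since |K| \<le> \<tau> and x \<le> 1, inserting the weight x^|K| costs at
          most x^(-\<tau>), which is exp (o(n)).\<close>
        also have "\<dots> \<le> x ^ ?s * exp (real (\<tau> n) * (- ln x + L) - real n * L)"
        proof -
          have "x ^ \<tau> n \<le> x ^ ?s" using x s by (intro power_decreasing) auto
          moreover have "x ^ \<tau> n = exp (real (\<tau> n) * ln x)"
            using x by (simp add: exp_of_nat_mult)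
          ultimately have "exp (real (\<tau> n) * ln x) * exp (real (\<tau> n) * (- ln x + L) - real n * L) \<le> x ^ ?s * exp (real (\<tau> n) * (- ln x + L) - real n * L)"
            by (intro mult_right_mono) auto
          then show ?thesis by (simp add: exp_add[symmetric] algebra_simps)
        qed
        finally have "?f K \<le> real N ^ ?s * (x ^ ?s * exp (real (\<tau> n) * (- ln x + L) - real n * L))"
          by (intro mult_left_mono) auto
        also have "\<dots> = x ^ ?s * real N ^ ?s * exp (real (\<tau> n) * (- ln x + L) - real n * L)"
          by (simp only: mult_ac)
        finally have "?f K \<le> x ^ ?s * real N ^ ?s * exp (real (\<tau> n) * (- ln x + L) - real n * L)" .
        moreover have "0 \<le> (real N * real n powr (- c')) ^ ?s"
          by (intro zero_le_power mult_nonneg_nonneg) auto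
        ultimately show ?thesis by linarith
      qed
    qed
    have "sum ?f ?KK \<le> (\<Sum>K\<in>?KK. (real N * real n powr (- c')) ^ card K + x ^ card K * real N ^ card K * exp (real (\<tau> n) * (- ln x + L) - real n * L))"
      by (intro sum_mono f)
    \<comment> \<open>The size restriction is dropped, so that both sums become binomial
      expansions.\<close>
    also have "\<dots> \<le> (\<Sum>K\<in>Pow {..<n} - {{}}. (real N * real n powr (- c')) ^ card K + x ^ card K * real N ^ card K * exp (real (\<tau> n) * (- ln x + L) - real n * L))"
      using x by (intro sum_mono2) auto
    also have "\<dots> = (\<Sum>K\<in>Pow {..<n} - {{}}. (real N * real n powr (- c')) ^ card K) + (\<Sum>K\<in>Pow {..<n} - {{}}. (x * real N) ^ card K) * exp (real (\<tau> n) * (- ln x + L) - real n * L)"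
      by (simp add: sum.distrib sum_distrib_right power_mult_distrib)
    also have "\<dots> \<le> small n + (1 + x * real N) ^ n * exp (real (\<tau> n) * (- ln x + L) - real n * L)"
      using x by (intro add_mono mult_right_mono) (auto simp: sum_diff1 sum_Pow_power_card small_def)
    also have "(1 + x * real N) ^ n \<le> exp (real n * L / 2)"
    proof -
      have "(1 + x * real N) ^ n \<le> exp (L / 2) ^ n"
      proof (rule power_mono)
        have "1 + x * real N \<le> 1 + L / 2" using x by (simp add: mult.commute)
        then show "1 + x * real N \<le> exp (L / 2)"
          using exp_ge_add_one_self[of "L / 2"] by linarith
      qed (use x in simp)
      then show ?thesis by (simp add: exp_of_nat_mult[symmetric])
    qed
    finally show ?case
      by (simp add: mid_def mult_exp_exp algebra_simps)
  qed
  show ?thesis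
  proof (rule tendsto_sandwich[where f = "\<lambda>_. 0", OF _ ev])
    show "(\<lambda>n. small n + mid n) \<longlonglongrightarrow> 0"
      using tendsto_add[OF small mid] by simp
  qed (auto intro!: always_eventually sum_nonneg)
qed

lemma sum_bad_tendsto_0:
  fixes c \<kappa> :: real and N :: nat
  assumes c: "c > 1" and \<kappa>: "\<kappa> > 0" and N: "N > 0"
    and \<alpha>: "\<And>n. n \<ge> 1 \<Longrightarrow> \<alpha> n = c * ln (real n) / real n"
    and weights: "eventually (\<lambda>n. pair_weights V N perp Ws n (\<theta> n) (\<delta> n) (good n) (\<alpha> n) \<kappa>) sequentially"
  shows "(\<lambda>n. (\<Sum>u | u \<in> {..<n} \<rightarrow>\<^sub>E V \<and> \<not> good n u. pair_weights.weight n (\<theta> n) (\<delta> n) u) / real N ^ n) \<longlonglongrightarrow> 0"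
proof -
  let ?t = frequency
  define \<tau> where "\<tau> n = 2 * N\<^sup>2 * ?t n" for n
  have \<tau>: "(\<lambda>n. real (\<tau> n) / real n) \<longlonglongrightarrow> 0"
    using tendsto_mult_right_zero[OF frequency_over_n, of "2 * real N ^ 2"] by (simp add: \<tau>_def)
  have N1: "real N \<ge> 1" using N by linarith
  \<comment> \<open>B1 to B4 are the terms of \<open>sum_bad_le\<close> divided by N^n, the first
    two written as exponentials so that linear growth rates can be compared.\<close>
  define B1 where "B1 n = exp (real n * ln (real N) - \<kappa> * \<alpha> n * real (?t n * ?t n))" for n
  define B2 where "B2 n = exp (real (\<tau> n) * ln (2 * real N ^ 2) + real n * ln (1 - 1 / (2 * real N)))" for n
  define B3 where "B3 n = contraction (\<alpha> n) 1 ^ n" for n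
  define B4 where "B4 n = (\<Sum>K | K \<subseteq> {..<n} \<and> K \<noteq> {} \<and> card K \<le> \<tau> n. real N ^ card K * contraction (\<alpha> n) (card K) ^ (n - card K))" for n
  have B1: "B1 \<longlonglongrightarrow> 0"
    unfolding B1_def
  proof (rule exp_linear_decay[of 1])
    have "eventually (\<lambda>n. c * ln (real n) / real n * (real (?t n) * real (?t n)) / real n \<ge> (ln (real N) + 1) / \<kappa>) sequentially"
      using frequency_square_large[of c] c unfolding filterlim_at_top by simp
    then show "eventually (\<lambda>n. real n * ln (real N) - \<kappa> * \<alpha> n * real (?t n * ?t n) \<le> - 1 * real n) sequentially"
      using eventually_ge_at_top[of 1]
    proof eventually_elim
      case (elim n)
      then have "(ln (real N) + 1) / \<kappa> \<le> \<alpha> n * real (?t n * ?t n) / real n"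
        by (simp add: \<alpha>)
      then have "(ln (real N) + 1) * real n \<le> \<kappa> * (\<alpha> n * real (?t n * ?t n))"
        using \<kappa> elim by (simp add: divide_le_eq le_divide_eq mult_ac)
      then show ?case by (simp add: algebra_simps)
    qed
  qed simp
  have l: "ln (1 - 1 / (2 * real N)) < 0"
    using N1 by (subst ln_less_zero_iff) (auto simp: field_simps)
  have B2: "B2 \<longlonglongrightarrow> 0"
    unfolding B2_def
  proof (rule exp_linear_decay[of "- ln (1 - 1 / (2 * real N)) / 2"])
    have "(\<lambda>n. real (\<tau> n) / real n * ln (2 * real N ^ 2)) \<longlonglongrightarrow> 0 * ln (2 * real N ^ 2)"
      by (intro tendsto_intros \<tau>)
    then have "eventually (\<lambda>n. real (\<tau> n) / real n * ln (2 * real N ^ 2) < - ln (1 - 1 / (2 * real N)) / 2) sequentially"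
      using l by (intro order_tendstoD(2)) auto
    then show "eventually (\<lambda>n. real (\<tau> n) * ln (2 * real N ^ 2) + real n * ln (1 - 1 / (2 * real N))
       \<le> - (- ln (1 - 1 / (2 * real N)) / 2) * real n) sequentially"
      using eventually_ge_at_top[of 1]
    proof eventually_elim
      case (elim n)
      then have "real (\<tau> n) * ln (2 * real N ^ 2) \<le> real n * (- ln (1 - 1 / (2 * real N)) / 2)"
        by (simp add: field_simps)
      then show ?case by (simp add: field_simps)
    qed
  qed (use l in simp)
  have \<alpha>_lim: "\<alpha> \<longlonglongrightarrow> 0"
  proof (rule Lim_transform_eventually)
    show "(\<lambda>n. c * ln (real n) / real n) \<longlonglongrightarrow> 0" by real_asymp
    show "eventually (\<lambda>n. c * ln (real n) / real n = \<alpha> n) sequentially"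
      using eventually_ge_at_top[of 1] by eventually_elim (simp add: \<alpha>)
  qed
  have B3: "B3 \<longlonglongrightarrow> 0"
  proof (rule tendsto_sandwich[where f = "\<lambda>_. 0" and h = "\<lambda>n. exp (- (c * ln (real n) / 4))"])
    show "(\<lambda>n. exp (- (c * ln (real n) / 4))) \<longlonglongrightarrow> 0" using c by real_asymp
    have ev\<alpha>: "eventually (\<lambda>n. \<alpha> n < 1/4) sequentially"
      by (intro order_tendstoD(2)[OF \<alpha>_lim]) auto
    show "eventually (\<lambda>n. B3 n \<le> exp (- (c * ln (real n) / 4))) sequentially"
      using ev\<alpha> eventually_ge_at_top[of 1]
    proof eventually_elim
      case (elim n)
      have a: "0 \<le> \<alpha> n" "\<alpha> n \<le> 1/4" "\<alpha> n * n = c * ln n"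
        using \<alpha>[of n] elim c by auto
      have "B3 n \<le> exp (- \<alpha> n * (1 - \<alpha> n) * real 1 * (1 - 2 * \<alpha> n * real 1)) ^ n"
        unfolding B3_def using a by (intro power_mono contraction_le_exp) auto
      also have "\<dots> = exp (- (\<alpha> n * n * ((1 - \<alpha> n) * (1 - 2 * \<alpha> n))))"
        by (simp add: exp_of_nat_mult[symmetric] mult_ac)
      \<comment> \<open>No outliers have to be chosen here, so any positive power of 1/n suffices
        and the crude bound 1/2 for both factors is harmless.\<close>
      also have "\<dots> \<le> exp (- (\<alpha> n * n * ((1/2) * (1/2))))"
      proof -
        have "(1/2) * (1/2) \<le> (1 - \<alpha> n) * (1 - 2 * \<alpha> n)"
          using a by (intro mult_mono) auto
        then have "\<alpha> n * n * ((1/2) * (1/2)) \<le> \<alpha> n * n * ((1 - \<alpha> n) * (1 - 2 * \<alpha> n))"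
          using a(1) by (intro mult_left_mono) simp_all
        then show ?thesis by simp
      qed
      finally show ?case using a by simp
    qed
  qed (auto intro!: always_eventually simp: B3_def)
  have B4: "B4 \<longlonglongrightarrow> 0"
    unfolding B4_def by (rule sum_outlier_sets_tendsto_0[OF c N \<alpha> \<tau>])
  have lim: "(\<lambda>n. B1 n + 2 ^ N\<^sup>2 * (B2 n + (B3 n + B4 n))) \<longlonglongrightarrow> 0"
    using tendsto_add[OF B1 tendsto_mult_right_zero[OF tendsto_add_zero[OF B2 tendsto_add_zero[OF B3 B4]], of "2 ^ N\<^sup>2"]] by simp
  show ?thesis
  proof (rule tendsto_sandwich[where f = "\<lambda>_. 0", OF _ _ _ lim])
    show "eventually (\<lambda>n. 0 \<le> (\<Sum>u | u \<in> {..<n} \<rightarrow>\<^sub>E V \<and> \<not> good n u. pair_weights.weight n (\<theta> n) (\<delta> n) u) / real N ^ n) sequentially"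
      using weights
    proof eventually_elim
      case (elim n)
      interpret pair_weights V N perp Ws n "\<theta> n" "\<delta> n" "good n" "\<alpha> n" \<kappa> by (rule elim)
      show ?case using weight_nonneg by (intro divide_nonneg_nonneg sum_nonneg) auto
    qed
    show "eventually (\<lambda>n. (\<Sum>u | u \<in> {..<n} \<rightarrow>\<^sub>E V \<and> \<not> good n u. pair_weights.weight n (\<theta> n) (\<delta> n) u) / real N ^ n
       \<le> B1 n + 2 ^ N\<^sup>2 * (B2 n + (B3 n + B4 n))) sequentially"
      using weights
    proof eventually_elim
      case (elim n)
      interpret pair_weights V N perp Ws n "\<theta> n" "\<delta> n" "good n" "\<alpha> n" \<kappa> by (rule elim)
      let ?NN = "real N ^ n"
      have NN: "?NN > 0" using N by simp
      have e1: "real N ^ (2 * n) * exp (- \<kappa> * \<alpha> n * real (?t n * ?t n)) = ?NN * B1 n"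
      proof -
        have "real N ^ (2 * n) = ?NN * exp (real n * ln (real N))"
          using N by (simp add: exp_of_nat_mult mult_2 power_add)
        then show ?thesis by (simp add: B1_def exp_diff exp_minus divide_inverse mult_ac)
      qed
      have e2: "(2 * real N ^ 2) ^ \<tau> n * (real N - 1/2) ^ n = ?NN * B2 n"
      proof -
        have "(2 * real N ^ 2) ^ \<tau> n = exp (real (\<tau> n) * ln (2 * real N ^ 2))"
          using N by (simp add: exp_of_nat_mult)
        moreover have "(real N - 1/2) ^ n = ?NN * exp (real n * ln (1 - 1 / (2 * real N)))"
        proof -
          have p: "1 - 1 / (2 * real N) > 0" using N1 by (simp add: field_simps)
          have "real N - 1/2 = real N * (1 - 1 / (2 * real N))" using N by (simp add: field_simps)
          then have "(real N - 1/2) ^ n = ?NN * (1 - 1 / (2 * real N)) ^ n" by (simp add: power_mult_distrib)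
          then show ?thesis using p by (simp only: exp_of_nat_mult exp_ln)
        qed
        ultimately show ?thesis by (simp add: B2_def exp_add mult_ac)
      qed
      have e3: "(real N * contraction (\<alpha> n) 1) ^ n = ?NN * B3 n"
        by (simp add: B3_def power_mult_distrib)
      have e4: "(\<Sum>K | K \<subseteq> {..<n} \<and> K \<noteq> {} \<and> card K \<le> \<tau> n.
          real N ^ (2 * card K) * (real N * contraction (\<alpha> n) (card K)) ^ (n - card K)) = ?NN * B4 n"
        unfolding B4_def sum_distrib_left
      proof (rule sum.cong)
        fix K assume "K \<in> {K. K \<subseteq> {..<n} \<and> K \<noteq> {} \<and> card K \<le> \<tau> n}"
        then have "card K \<le> n" using card_mono[of "{..<n}" K] by auto
        then have "real N ^ (2 * card K) * real N ^ (n - card K) = ?NN * real N ^ card K"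
          by (simp add: add.commute flip: power_add)
        then show "real N ^ (2 * card K) * (real N * contraction (\<alpha> n) (card K)) ^ (n - card K) = ?NN * (real N ^ card K * contraction (\<alpha> n) (card K) ^ (n - card K))"
          by (simp add: power_mult_distrib)
      qed simp
      have "(\<Sum>u | u \<in> {..<n} \<rightarrow>\<^sub>E V \<and> \<not> good n u. weight u) \<le> ?NN * B1 n + 2 ^ N\<^sup>2 * (?NN * B2 n + (?NN * B3 n + ?NN * B4 n))"
        using sum_bad_le[of "?t n"] unfolding \<tau>_def[symmetric] e1 e2 e3 e4 .
      also have "\<dots> = (B1 n + 2 ^ N\<^sup>2 * (B2 n + (B3 n + B4 n))) * ?NN"
        by (simp add: algebra_simps)
      finally show ?case using NN by (simp add: divide_le_eq)
    qed
  qed simp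
qed

section \<open>Isotropic subgroups of a group times its dual\<close>

text \<open>For u = (f, C) and v = (g, D) this is D(f): bilinear, but neither symmetric nor, for
  nontrivial G, nondegenerate.\<close>

definition pairing :: "'a \<times> ('a \<Rightarrow> complex) \<Rightarrow> 'a \<times> ('a \<Rightarrow> complex) \<Rightarrow> complex" where
  "pairing u v = snd v (fst u)"

text \<open>The base with which a free off-diagonal entry A_ij occurs as exponent in the expansion.
  In the symmetric case A_ji equals A_ij and the two pairings multiply; in the alternating case A_ji
  = - A_ij, and inversion on the circle is conjugation.\<close>

definition form :: "mat_kind \<Rightarrow> 'a \<times> ('a \<Rightarrow> complex) \<Rightarrow> 'a \<times> ('a \<Rightarrow> complex) \<Rightarrow> complex" where
  "form K u v = (case K of General \<Rightarrow> pairing u v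
     | Symmetric \<Rightarrow> pairing u v * pairing v u
     | Alternating \<Rightarrow> pairing u v * cnj (pairing v u))"

definition form_orth :: "mat_kind \<Rightarrow> 'a \<times> ('a \<Rightarrow> complex) \<Rightarrow> 'a \<times> ('a \<Rightarrow> complex) \<Rightarrow> bool" where
  "form_orth K u v \<longleftrightarrow> form K u v = 1 \<and> form K v u = 1"

text \<open>The diagonal is separate because A_ii occurs only once, whereas the symmetric
  \<open>form\<close> of an element with itself is the square of the pairing.\<close>

definition entry_form :: "mat_kind \<Rightarrow> (nat \<Rightarrow> 'a \<times> ('a \<Rightarrow> complex)) \<Rightarrow> nat \<times> nat \<Rightarrow> complex" where
  "entry_form K u = (\<lambda>(i, j). if i = j then pairing (u i) (u i) else form K (u i) (u j))"

definition special :: "mat_kind \<Rightarrow> nat \<Rightarrow> (nat \<Rightarrow> 'a \<times> ('a \<Rightarrow> complex)) \<Rightarrow> bool" where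
  "special K n u \<longleftrightarrow> (\<forall>e\<in>free_entries K n. entry_form K u e = 1)"

lemma free_entries_subset: "free_entries K n \<subseteq> {..<n} \<times> {..<n}"
  by (cases K) (auto simp: free_entries_def)

lemma finite_free_entries [simp]: "finite (free_entries K n)"
  by (rule finite_subset[OF free_entries_subset]) auto

locale finite_abelian = comm_group G for G :: "('a, 'm) monoid_scheme" (structure) +
  assumes fin: "finite (carrier G)"
begin

abbreviation "VV \<equiv> G \<times>\<times> char_group G"

lemma order_pos: "order G > 0"
  using fin by (simp add: order_gt_0_iff_finite)

lemma comm_group_VV: "comm_group VV"
proof -
  interpret X: comm_group "char_group G" by (rule comm_group_char_group[OF is_group])
  interpret V: group VV by (rule DirProd_group[OF is_group X.is_group])
  show ?thesis
    by (rule V.group_comm_groupI) (auto simp: m_comm mult.commute)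
qed

lemma carrier_VV [simp]: "carrier VV = carrier G \<times> chars G"
  by simp

lemma finite_VV: "finite (carrier VV)"
  using fin finite_chars[OF is_group fin] by simp

lemma card_VV: "card (carrier VV) = (order G)\<^sup>2"
  using card_chars[OF comm_group_axioms fin] by (simp add: card_cartesian_product order_def power2_eq_square)

lemma mult_VV: "u \<otimes>\<^bsub>VV\<^esub> v = (fst u \<otimes> fst v, \<lambda>x\<in>carrier G. snd u x * snd v x)"
  by (cases u; cases v) simp

lemma pairing_mult:
  assumes "u \<in> carrier VV" "v \<in> carrier VV" "w \<in> carrier VV"
  shows "pairing (u \<otimes>\<^bsub>VV\<^esub> v) w = pairing u w * pairing v w"
    and "pairing w (u \<otimes>\<^bsub>VV\<^esub> v) = pairing w u * pairing w v"
  using assms by (auto simp: pairing_def mult_VV chars_mult)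

lemma norm_pairing: "u \<in> carrier VV \<Longrightarrow> v \<in> carrier VV \<Longrightarrow> cmod (pairing u v) = 1"
  by (auto simp: pairing_def chars_norm)

lemma pairing_power_order: "u \<in> carrier VV \<Longrightarrow> v \<in> carrier VV \<Longrightarrow> pairing u v ^ order G = 1"
  using chars_pow_order[OF is_group fin] by (auto simp: pairing_def)

lemma form_mult:
  assumes "u \<in> carrier VV" "v \<in> carrier VV" "w \<in> carrier VV"
  shows "form K (u \<otimes>\<^bsub>VV\<^esub> v) w = form K u w * form K v w"
    and "form K w (u \<otimes>\<^bsub>VV\<^esub> v) = form K w u * form K w v"
  using pairing_mult[OF assms] by (auto simp: form_def split: mat_kind.splits)

lemma norm_form: "u \<in> carrier VV \<Longrightarrow> v \<in> carrier VV \<Longrightarrow> cmod (form K u v) = 1"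
  using norm_pairing[of u v] norm_pairing[of v u] by (auto simp: form_def norm_mult split: mat_kind.splits)

lemma form_power_order:
  assumes "u \<in> carrier VV" "v \<in> carrier VV"
  shows "form K u v ^ order G = 1"
proof -
  have *: "pairing u v ^ order G = 1" "pairing v u ^ order G = 1"
    using pairing_power_order assms by blast+
  have "cnj (pairing v u) ^ order G = 1"
    using *(2) by (metis complex_cnj_one complex_cnj_power)
  with * show ?thesis
    by (cases K) (simp_all add: form_def power_mult_distrib)
qed

lemma form_swap:
  assumes "K \<noteq> General" "u \<in> carrier VV" "v \<in> carrier VV"
  shows "form K u v = 1 \<longleftrightarrow> form K v u = 1"
proof (cases K)
  case Alternating
  have "form K v u = cnj (form K u v)" by (simp add: form_def Alternating mult.commute)
  then show ?thesis by (metis complex_cnj_cnj complex_cnj_one)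
qed (use assms in \<open>auto simp: form_def mult.commute\<close>)

section \<open>Isotropic subgroups and orthogonal complements\<close>

definition isotropic :: "mat_kind \<Rightarrow> ('a \<times> ('a \<Rightarrow> complex)) set set" where
  "isotropic K = {W. subgroup W VV \<and> (\<forall>u\<in>W. \<forall>v\<in>W. form K u v = 1)}"

lemma subgroup_orthogonal:
  assumes "u \<in> carrier VV"
  shows "subgroup {v \<in> carrier VV. form_orth K u v} VV"
proof -
  interpret V: comm_group VV by (rule comm_group_VV)
  have one: "form K u \<one>\<^bsub>VV\<^esub> = 1" "form K \<one>\<^bsub>VV\<^esub> u = 1"
  proof -
    have "form K u (\<one>\<^bsub>VV\<^esub> \<otimes>\<^bsub>VV\<^esub> \<one>\<^bsub>VV\<^esub>) = form K u \<one>\<^bsub>VV\<^esub> * form K u \<one>\<^bsub>VV\<^esub>"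
      "form K (\<one>\<^bsub>VV\<^esub> \<otimes>\<^bsub>VV\<^esub> \<one>\<^bsub>VV\<^esub>) u = form K \<one>\<^bsub>VV\<^esub> u * form K \<one>\<^bsub>VV\<^esub> u"
      using form_mult[OF V.one_closed V.one_closed assms] by auto
    moreover have "form K u \<one>\<^bsub>VV\<^esub> \<noteq> 0" "form K \<one>\<^bsub>VV\<^esub> u \<noteq> 0"
      using norm_form[OF assms V.one_closed] norm_form[OF V.one_closed assms] by (metis norm_zero zero_neq_one)+
    ultimately show "form K u \<one>\<^bsub>VV\<^esub> = 1" "form K \<one>\<^bsub>VV\<^esub> u = 1"
      unfolding V.r_one[OF V.one_closed] by auto
  qed
  show ?thesis
  proof (rule V.finite_subgroupI)
    show "finite (carrier VV)" by (rule finite_VV)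
    show "{v \<in> carrier VV. form_orth K u v} \<noteq> {}"
      using one V.one_closed unfolding form_orth_def by blast
    fix a b assume "a \<in> {v \<in> carrier VV. form_orth K u v}" "b \<in> {v \<in> carrier VV. form_orth K u v}"
    then show "a \<otimes>\<^bsub>VV\<^esub> b \<in> {v \<in> carrier VV. form_orth K u v}"
      using form_mult[of a b u] assms V.m_closed[of a b] by (simp add: form_orth_def del: carrier_VV DirProd_def)
  qed blast
qed

text \<open>The elements orthogonal to a fixed one form a subgroup; applied twice, this extends
  orthogonality from S to the generated subgroup in one argument and then in the other.\<close>

lemma isotropic_generate:
  assumes "S \<subseteq> carrier VV" "\<And>u v. u \<in> S \<Longrightarrow> v \<in> S \<Longrightarrow> form_orth K u v"
  shows "generate VV S \<in> isotropic K"
proof -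
  interpret V: comm_group VV by (rule comm_group_VV)
  have sub: "generate VV S \<subseteq> carrier VV"
    using V.generate_incl[OF assms(1)] .
  have 1: "form_orth K u v" if "u \<in> S" "v \<in> generate VV S" for u v
    using V.generate_subgroup_incl[OF _ subgroup_orthogonal[of u K], of S] assms that by blast
  have 2: "form_orth K u v" if "u \<in> generate VV S" "v \<in> generate VV S" for u v
  proof -
    have "v \<in> carrier VV" using that sub by blast
    then have "generate VV S \<subseteq> {x \<in> carrier VV. form_orth K v x}"
      using 1 that assms(1) by (intro V.generate_subgroup_incl subgroup_orthogonal) (auto simp: form_orth_def)
    then show ?thesis using that by (auto simp: form_orth_def)
  qed
  then show ?thesis
    unfolding isotropic_def using V.generate_is_subgroup[OF assms(1)] by (auto simp: form_orth_def)
qed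

text \<open>Against w = (f, C) the test elements are (\<one>, D) with D(f) \<noteq> 1, or (g,
  trivial) with C(g) \<noteq> 1. The general form is excluded because a bare pairing is trivial
  against every w with trivial character component.\<close>

lemma form_nondegenerate:
  assumes "K \<noteq> General" "w \<in> carrier VV" "w \<noteq> \<one>\<^bsub>VV\<^esub>"
  shows "\<exists>v\<in>carrier VV. form K v w \<noteq> 1"
proof -
  obtain f C where w: "w = (f, C)" "f \<in> carrier G" "C \<in> chars G" using assms by auto
  show ?thesis
  proof (cases "f = \<one>")
    case False
    obtain D where D: "D \<in> chars G" "D f \<noteq> 1"
      using char_separates[OF comm_group_axioms fin w(2) False] by blast
    have "cnj (D f) \<noteq> 1" using D(2) by (metis complex_cnj_cnj complex_cnj_one)
    then have "form K (\<one>, D) w \<noteq> 1"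
      using w D assms(1) chars_one[OF is_group w(3)] by (cases K) (auto simp: form_def pairing_def)
    then show ?thesis using D by (intro bexI[of _ "(\<one>, D)"]) auto
  next
    case True
    then have "C \<noteq> triv_char G" using assms(3) w by auto
    then obtain g where g: "g \<in> carrier G" "C g \<noteq> 1"
      using chars_eqI[OF w(3) triv_char_in_chars[OF is_group]] by (auto simp: triv_char_def)
    have "form K (g, triv_char G) w \<noteq> 1"
      using w True g assms(1) by (cases K) (auto simp: form_def pairing_def triv_char_def)
    then show ?thesis using g by (intro bexI[of _ "(g, triv_char G)"]) auto
  qed
qed

lemma form_char_left:
  assumes "subgroup W VV" "u \<in> carrier VV"
  shows "(\<lambda>w\<in>W. form K u w) \<in> chars (VV\<lparr>carrier := W\<rparr>)"
proof -
  interpret V: comm_group VV by (rule comm_group_VV)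
  have WV: "W \<subseteq> carrier VV" using subgroup.subset[OF assms(1)] .
  have "restrict (form K u) (carrier (VV\<lparr>carrier := W\<rparr>)) \<in> chars (VV\<lparr>carrier := W\<rparr>)"
  proof (rule charsI)
    show "group (VV\<lparr>carrier := W\<rparr>)" by (rule V.subgroup_imp_group[OF assms(1)])
    fix x assume "x \<in> carrier (VV\<lparr>carrier := W\<rparr>)"
    then have x: "x \<in> carrier VV" using WV by auto
    show "cmod (form K u x) = 1" using norm_form x assms(2) by blast
    fix y assume "y \<in> carrier (VV\<lparr>carrier := W\<rparr>)"
    then have y: "y \<in> carrier VV" using WV by auto
    show "form K u (x \<otimes>\<^bsub>VV\<lparr>carrier := W\<rparr>\<^esub> y) = form K u x * form K u y"
      using form_mult[OF x y assms(2)] by simp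
  qed
  then show ?thesis by simp
qed

lemma form_char_right:
  assumes "subgroup W VV" "u \<in> carrier VV"
  shows "(\<lambda>w\<in>W. form K w u) \<in> chars (VV\<lparr>carrier := W\<rparr>)"
proof -
  interpret V: comm_group VV by (rule comm_group_VV)
  have WV: "W \<subseteq> carrier VV" using subgroup.subset[OF assms(1)] .
  have "restrict (\<lambda>w. form K w u) (carrier (VV\<lparr>carrier := W\<rparr>)) \<in> chars (VV\<lparr>carrier := W\<rparr>)"
  proof (rule charsI)
    show "group (VV\<lparr>carrier := W\<rparr>)" by (rule V.subgroup_imp_group[OF assms(1)])
    fix x assume "x \<in> carrier (VV\<lparr>carrier := W\<rparr>)"
    then have x: "x \<in> carrier VV" using WV by auto
    show "cmod (form K x u) = 1" using norm_form x assms(2) by blast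
    fix y assume "y \<in> carrier (VV\<lparr>carrier := W\<rparr>)"
    then have y: "y \<in> carrier VV" using WV by auto
    show "form K (x \<otimes>\<^bsub>VV\<lparr>carrier := W\<rparr>\<^esub> y) u = form K x u * form K y u"
      using form_mult[OF x y assms(2)] by simp
  qed
  then show ?thesis by simp
qed

text \<open>The sum of \<open>form K v w\<close> over v in V and w in W is evaluated by
  orthogonality in both orders: one leaves the complement of W, the other, by nondegeneracy, only
  the neutral w.\<close>

lemma card_mult_complement:
  assumes "K \<noteq> General" "subgroup W VV"
  shows "card W * card {v \<in> carrier VV. \<forall>w\<in>W. form K v w = 1} = (order G)\<^sup>2"
proof -
  interpret V: comm_group VV by (rule comm_group_VV)
  have WV: "W \<subseteq> carrier VV" using subgroup.subset[OF assms(2)] .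
  have finW: "finite W" using finite_subset[OF WV finite_VV] .
  have oneW: "\<one>\<^bsub>VV\<^esub> \<in> W" using subgroup.one_closed[OF assms(2)] .
  let ?P = "{v \<in> carrier VV. \<forall>w\<in>W. form K v w = 1}"
  have "(\<Sum>v\<in>carrier VV. \<Sum>w\<in>W. form K v w) = (\<Sum>v\<in>carrier VV. if \<forall>w\<in>W. form K v w = 1 then of_nat (card W) else 0)"
  proof (rule sum.cong)
    fix v assume v: "v \<in> carrier VV"
    have "(\<Sum>w\<in>W. (\<lambda>w\<in>W. form K v w) w) = (if \<forall>w\<in>W. (\<lambda>w\<in>W. form K v w) w = 1 then of_nat (card W) else 0)"
      using sum_char[OF V.subgroup_imp_group[OF assms(2)] _ form_char_left[OF assms(2) v]] finW
      by (simp add: order_def)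
    then show "(\<Sum>w\<in>W. form K v w) = (if \<forall>w\<in>W. form K v w = 1 then of_nat (card W) else 0)"
      by simp
  qed simp
  also have "\<dots> = of_nat (card W * card ?P)"
    using finite_VV by (simp add: sum.If_cases Int_def mult.commute del: carrier_VV)
  finally have 1: "(\<Sum>v\<in>carrier VV. \<Sum>w\<in>W. form K v w) = of_nat (card W * card ?P)" .
  have "(\<Sum>v\<in>carrier VV. \<Sum>w\<in>W. form K v w) = (\<Sum>w\<in>W. \<Sum>v\<in>carrier VV. form K v w)"
    by (rule sum.swap)
  also have "\<dots> = (\<Sum>w\<in>W. if w = \<one>\<^bsub>VV\<^esub> then of_nat ((order G)\<^sup>2) else 0)"
  proof (rule sum.cong)
    fix w assume w: "w \<in> W"
    then have wV: "w \<in> carrier VV" using WV by blast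
    have ch: "(\<lambda>v\<in>carrier VV. form K v w) \<in> chars VV"
      by (rule charsI[OF _ _ V.is_group]) (auto simp only: norm_form[OF _ wV] form_mult[OF _ _ wV])
    have "(\<Sum>v\<in>carrier VV. form K v w) = (if \<forall>v\<in>carrier VV. form K v w = 1 then of_nat (order VV) else 0)"
      using sum_char[OF V.is_group finite_VV ch] by simp
    moreover have "(\<forall>v\<in>carrier VV. form K v w = 1) \<longleftrightarrow> w = \<one>\<^bsub>VV\<^esub>"
    proof
      assume "w = \<one>\<^bsub>VV\<^esub>"
      then show "\<forall>v\<in>carrier VV. form K v w = 1"
        using subgroup.one_closed[OF subgroup_orthogonal[of _ K]] by (auto simp: form_orth_def)
    qed (use form_nondegenerate[OF assms(1) wV] in blast)
    ultimately show "(\<Sum>v\<in>carrier VV. form K v w) = (if w = \<one>\<^bsub>VV\<^esub> then of_nat ((order G)\<^sup>2) else 0)"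
      using card_VV by (simp add: order_def del: carrier_VV)
  qed simp
  also have "\<dots> = of_nat ((order G)\<^sup>2)"
    using finW oneW by (simp add: sum.delta)
  finally show ?thesis using 1 by (simp only: of_nat_eq_iff)
qed

text \<open>W is contained in its complement and the two sizes multiply to |G|^2; equality |W| = |G|
  therefore means that W is its own complement.\<close>

lemma isotropic_card:
  assumes "W \<in> isotropic K"
  shows "card W \<le> order G"
    and "card W = order G \<Longrightarrow> u \<in> carrier VV - W \<Longrightarrow> \<exists>w\<in>W. form K u w \<noteq> 1 \<or> form K w u \<noteq> 1"
proof -
  \<comment> \<open>The general form is degenerate, but a subgroup isotropic for it is also
    isotropic for the symmetrised form.\<close>
  define K' where "K' = (if K = General then Symmetric else K)"
  have K': "K' \<noteq> General" by (simp add: K'_def)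
  have W: "subgroup W VV" "\<And>u v. u \<in> W \<Longrightarrow> v \<in> W \<Longrightarrow> form K u v = 1"
    using assms by (auto simp: isotropic_def)
  have WV: "W \<subseteq> carrier VV" using subgroup.subset[OF W(1)] .
  have imp: "form K' u v = 1" if "form K u v = 1" "form K v u = 1" for u v
    using that by (cases K) (auto simp: K'_def form_def)
  let ?P = "{v \<in> carrier VV. \<forall>w\<in>W. form K' v w = 1}"
  have sub: "W \<subseteq> ?P"
  proof
    fix v assume v: "v \<in> W"
    have "form K' v w = 1" if "w \<in> W" for w
      using imp W(2) v that by blast
    then show "v \<in> ?P" using v WV by blast
  qed
  have finP: "finite ?P" using finite_VV by simp
  have eq: "card W * card ?P = (order G)\<^sup>2" by (rule card_mult_complement[OF K' W(1)])
  have le: "card W \<le> card ?P" by (rule card_mono[OF finP sub])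
  have "card W * card W \<le> (order G)\<^sup>2"
    using mult_le_mono2[OF le, of "card W"] unfolding eq .
  then show "card W \<le> order G"
    by (simp flip: power2_eq_square)
  assume N: "card W = order G" and u: "u \<in> carrier VV - W"
  have "card ?P = order G" using eq N order_pos by (simp add: power2_eq_square)
  then have "W = ?P" using card_subset_eq[OF finP sub] N by simp
  then have "u \<notin> ?P" using u by blast
  then obtain w where "w \<in> W" "form K' u w \<noteq> 1" using u by blast
  then show "\<exists>w\<in>W. form K u w \<noteq> 1 \<or> form K w u \<noteq> 1" using imp by blast
qed

end

section \<open>The Fourier weights of a balanced matrix\<close>

text \<open>The value 1 outside the free entries lets products run over all pairs of indices for
  every kind of matrix.\<close>

definition entry_weight :: "mat_kind \<Rightarrow> nat \<Rightarrow> nat \<Rightarrow> (nat \<times> nat \<Rightarrow> nat \<Rightarrow> real) \<Rightarrow> nat \<times> nat \<Rightarrow> complex \<Rightarrow> real" where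
  "entry_weight K n a p e z = (if e \<in> free_entries K n then cmod (char_fun a (p e) z) else 1)"

text \<open>Both positions are combined so that the weight is symmetric; for symmetric and
  alternating matrices one of the two factors is 1 when i and j differ.\<close>

definition off_diag_weight ::
  "mat_kind \<Rightarrow> nat \<Rightarrow> nat \<Rightarrow> (nat \<times> nat \<Rightarrow> nat \<Rightarrow> real) \<Rightarrow> nat \<Rightarrow> nat \<Rightarrow> 'a \<times> ('a \<Rightarrow> complex) \<Rightarrow> 'a \<times> ('a \<Rightarrow> complex) \<Rightarrow> real" where
  "off_diag_weight K n a p i j u v = entry_weight K n a p (i, j) (form K u v) * entry_weight K n a p (j, i) (form K v u)"

definition diag_weight ::
  "mat_kind \<Rightarrow> nat \<Rightarrow> nat \<Rightarrow> (nat \<times> nat \<Rightarrow> nat \<Rightarrow> real) \<Rightarrow> nat \<Rightarrow> 'a \<times> ('a \<Rightarrow> complex) \<Rightarrow> real" where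
  "diag_weight K n a p i u = entry_weight K n a p (i, i) (pairing u u)"

lemma free_entries_either: "i < n \<Longrightarrow> j < n \<Longrightarrow> i \<noteq> j \<Longrightarrow> (i, j) \<in> free_entries K n \<or> (j, i) \<in> free_entries K n"
  by (cases K) (auto simp: free_entries_def)

lemma free_entries_General: "i < n \<Longrightarrow> j < n \<Longrightarrow> (i, j) \<in> free_entries General n"
  by (auto simp: free_entries_def)

lemma prod_square_index_pairs:
  fixes f :: "nat \<times> nat \<Rightarrow> 'b :: comm_monoid_mult"
  shows "(\<Prod>e\<in>{..<n} \<times> {..<n}. f e) = (\<Prod>(i, j)\<in>index_pairs n. f (i, j) * f (j, i)) * (\<Prod>i<n. f (i, i))"
proof -
  let ?D = "(\<lambda>i. (i, i)) ` {..<n}" and ?U = "index_pairs n" and ?L = "prod.swap ` index_pairs n"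
  have "{..<n} \<times> {..<n} = (?U \<union> ?L) \<union> ?D"
    by (auto simp: index_pairs_def image_iff)
  moreover have "(?U \<union> ?L) \<inter> ?D = {}" "?U \<inter> ?L = {}"
    by (auto simp: index_pairs_def)
  ultimately have "(\<Prod>e\<in>{..<n} \<times> {..<n}. f e) = prod f ?U * prod f ?L * prod f ?D"
    by (simp add: prod.union_disjoint)
  moreover have "prod f ?L = (\<Prod>e\<in>?U. f (snd e, fst e))"
    by (subst prod.reindex) (auto simp: inj_on_def split_beta intro!: prod.cong)
  moreover have "prod f ?D = (\<Prod>i<n. f (i, i))"
    by (subst prod.reindex) (auto simp: inj_on_def)
  ultimately show ?thesis
    by (simp add: prod.distrib split_beta)
qed

lemma (in comm_group) comm_group_subgroup:
  assumes "subgroup H G"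
  shows "comm_group (G\<lparr>carrier := H\<rparr>)"
proof (rule group.group_comm_groupI[OF subgroup_imp_group[OF assms]])
  fix x y assume "x \<in> carrier (G\<lparr>carrier := H\<rparr>)" "y \<in> carrier (G\<lparr>carrier := H\<rparr>)"
  then show "x \<otimes>\<^bsub>G\<lparr>carrier := H\<rparr>\<^esub> y = y \<otimes>\<^bsub>G\<lparr>carrier := H\<rparr>\<^esub> x"
    using m_comm subgroup.subset[OF assms] by auto
qed

section \<open>Decay of the Fourier weights\<close>

context finite_abelian
begin

context
  fixes K :: mat_kind and n :: nat and \<alpha> :: real and p :: "nat \<times> nat \<Rightarrow> nat \<Rightarrow> real"
  assumes \<alpha>: "0 < \<alpha>" "\<alpha> \<le> 1/2"
    and p: "\<And>e. e \<in> free_entries K n \<Longrightarrow> balanced_law (order G) \<alpha> (p e)"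
begin

abbreviation "N \<equiv> order G"
abbreviation "ew \<equiv> entry_weight K n N p"

lemma entry_weight_bounds: "cmod z = 1 \<Longrightarrow> 0 \<le> ew e z \<and> ew e z \<le> 1"
  using cmod_char_fun_le_1[OF p] by (auto simp: entry_weight_def)

text \<open>For \<alpha> \<le> 1/2 the loss 2 \<alpha> (1 - \<alpha>) is at least \<alpha>; the 1/2
  in the exponent comes from removing the square.\<close>

lemma entry_weight_decay:
  assumes "e \<in> free_entries K n" "z ^ N = 1" "z \<noteq> 1"
  shows "ew e z \<le> exp (- (root_gap N / 2) * \<alpha>)"
proof -
  have "(ew e z)\<^sup>2 \<le> 1 - root_gap N * (2 * \<alpha> * (1 - \<alpha>))"
    using cmod_char_fun_bound[OF p[OF assms(1)] _ \<alpha>(2) assms(2,3) order_pos] \<alpha> assms(1)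
    by (simp add: entry_weight_def)
  also have "\<dots> \<le> 1 - root_gap N * \<alpha>"
  proof -
    have "\<alpha> * 1 \<le> \<alpha> * (2 * (1 - \<alpha>))" using \<alpha> by (intro mult_left_mono) auto
    then have "\<alpha> \<le> 2 * \<alpha> * (1 - \<alpha>)" by (simp add: algebra_simps)
    then have "root_gap N * \<alpha> \<le> root_gap N * (2 * \<alpha> * (1 - \<alpha>))"
      using root_gap(1)[OF order_pos] by (intro mult_left_mono) auto
    then show ?thesis by simp
  qed
  also have "\<dots> \<le> exp (- (root_gap N * \<alpha>))"
    using exp_ge_add_one_self[of "- (root_gap N * \<alpha>)"] by simp
  also have "\<dots> = (exp (- (root_gap N / 2) * \<alpha>))\<^sup>2"
    by (simp add: exp_double[symmetric])
  finally show ?thesis by (rule power2_le_imp_le) simp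
qed

lemma off_diag_factor_le:
  assumes "i < n" "k < n" "i \<noteq> k" "x \<in> carrier VV" "w \<in> carrier VV"
  shows "off_diag_weight K n N p i k w x \<le> ew (i, k) (form K w x)"
    and "off_diag_weight K n N p i k w x \<le> ew (k, i) (form K x w)"
  unfolding off_diag_weight_def
  using entry_weight_bounds[OF norm_form[OF assms(4,5)]] entry_weight_bounds[OF norm_form[OF assms(5,4)]]
  by (simp_all add: mult_left_le mult_left_le_one_le)

lemma off_diag_bounds:
  assumes "u \<in> carrier VV" "v \<in> carrier VV"
  shows "0 \<le> off_diag_weight K n N p i j u v \<and> off_diag_weight K n N p i j u v \<le> 1"
  unfolding off_diag_weight_def
  using entry_weight_bounds[OF norm_form[OF assms]] entry_weight_bounds[OF norm_form[OF assms(2,1)]]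
  by (simp add: mult_le_one)

lemma diag_bounds:
  assumes "u \<in> carrier VV"
  shows "0 \<le> diag_weight K n N p i u \<and> diag_weight K n N p i u \<le> 1"
  unfolding diag_weight_def using entry_weight_bounds[OF norm_pairing[OF assms assms]] .

text \<open>For symmetric and alternating matrices only one of the two positions is free, but there
  nontriviality of the form does not depend on the order of its arguments. For general matrices both
  positions are free, so whichever order is nontrivial can be used.\<close>

lemma off_diag_not_orthogonal:
  assumes ij: "i < n" "j < n" "i \<noteq> j" and uv: "u \<in> carrier VV" "v \<in> carrier VV" "\<not> form_orth K u v"
  shows "off_diag_weight K n N p i j u v \<le> exp (- (root_gap N / 2) * \<alpha>)"
proof -
  have "((i, j) \<in> free_entries K n \<and> form K u v \<noteq> 1) \<or> ((j, i) \<in> free_entries K n \<and> form K v u \<noteq> 1)"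
  proof (cases "K = General")
    case True
    then show ?thesis using uv ij free_entries_General by (auto simp: form_orth_def)
  next
    case False
    then show ?thesis
      using uv(3) form_swap[OF False uv(1,2)] free_entries_either[OF ij, of K] by (auto simp: form_orth_def)
  qed
  then show ?thesis
  proof
    assume "(i, j) \<in> free_entries K n \<and> form K u v \<noteq> 1"
    then have "ew (i, j) (form K u v) \<le> exp (- (root_gap N / 2) * \<alpha>)"
      using entry_weight_decay form_power_order[OF uv(1,2)] by blast
    then show ?thesis using off_diag_factor_le(1)[OF ij uv(2,1)] by linarith
  next
    assume "(j, i) \<in> free_entries K n \<and> form K v u \<noteq> 1"
    then have "ew (j, i) (form K v u) \<le> exp (- (root_gap N / 2) * \<alpha>)"
      using entry_weight_decay form_power_order[OF uv(2,1)] by blast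
    then show ?thesis using off_diag_factor_le(2)[OF ij uv(2,1)] by linarith
  qed
qed

text \<open>Since W is its own complement, an outlier x pairs nontrivially with W in an order that
  belongs to a free entry. Keeping only that factor, the weight is dominated by a characteristic
  function along a nontrivial character of W.\<close>

lemma off_diag_outlier:
  assumes W: "W \<in> isotropic K" "card W = N" and ik: "i < n" "k < n" "i \<noteq> k" and x: "x \<in> carrier VV - W"
  shows "\<exists>\<xi> e. \<xi> \<in> chars (VV\<lparr>carrier := W\<rparr>) \<and> (\<exists>w\<in>W. \<xi> w \<noteq> 1) \<and> (\<forall>w\<in>W. \<xi> w ^ N = 1) \<and>
     e \<in> free_entries K n \<and> (\<forall>w\<in>W. off_diag_weight K n N p i k w x \<le> cmod (char_fun N (p e) (\<xi> w)))"
proof -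
  have sub: "subgroup W VV" using W by (simp add: isotropic_def)
  have WV: "W \<subseteq> carrier VV" using subgroup.subset[OF sub] .
  have xV: "x \<in> carrier VV" using x by blast
  obtain w where w: "w \<in> W" "form K x w \<noteq> 1 \<or> form K w x \<noteq> 1"
    using isotropic_card(2)[OF W x] by blast
  have wV: "w \<in> carrier VV" using w WV by blast
  have "((i, k) \<in> free_entries K n \<and> form K w x \<noteq> 1) \<or> ((k, i) \<in> free_entries K n \<and> form K x w \<noteq> 1)"
  proof (cases "K = General")
    case True
    then show ?thesis using w ik free_entries_General by auto
  next
    case False
    then show ?thesis
      using w(2) form_swap[OF False wV xV] free_entries_either[OF ik, of K] by auto
  qed
  then show ?thesis
  proof
    assume a: "(i, k) \<in> free_entries K n \<and> form K w x \<noteq> 1"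
    show ?thesis
    proof (intro exI conjI)
      show "(\<lambda>w\<in>W. form K w x) \<in> chars (VV\<lparr>carrier := W\<rparr>)" by (rule form_char_right[OF sub xV])
      show "\<exists>w\<in>W. (\<lambda>w\<in>W. form K w x) w \<noteq> 1" using w(1) a by (intro bexI[of _ w]) auto
      show "\<forall>w\<in>W. (\<lambda>w\<in>W. form K w x) w ^ N = 1" using WV form_power_order[OF _ xV] by auto
      show "(i, k) \<in> free_entries K n" using a by simp
      show "\<forall>w\<in>W. off_diag_weight K n N p i k w x \<le> cmod (char_fun N (p (i, k)) ((\<lambda>w\<in>W. form K w x) w))"
      proof
        fix w assume "w \<in> W"
        then show "off_diag_weight K n N p i k w x \<le> cmod (char_fun N (p (i, k)) ((\<lambda>w\<in>W. form K w x) w))"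
          using off_diag_factor_le(1)[OF ik xV, of w] WV a by (auto simp: entry_weight_def)
      qed
    qed
  next
    assume a: "(k, i) \<in> free_entries K n \<and> form K x w \<noteq> 1"
    show ?thesis
    proof (intro exI conjI)
      show "(\<lambda>w\<in>W. form K x w) \<in> chars (VV\<lparr>carrier := W\<rparr>)" by (rule form_char_left[OF sub xV])
      show "\<exists>w\<in>W. (\<lambda>w\<in>W. form K x w) w \<noteq> 1" using w(1) a by (intro bexI[of _ w]) auto
      show "\<forall>w\<in>W. (\<lambda>w\<in>W. form K x w) w ^ N = 1" using WV form_power_order[OF xV] by auto
      show "(k, i) \<in> free_entries K n" using a by simp
      show "\<forall>w\<in>W. off_diag_weight K n N p i k w x \<le> cmod (char_fun N (p (k, i)) ((\<lambda>w\<in>W. form K x w) w))"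
      proof
        fix w assume "w \<in> W"
        then show "off_diag_weight K n N p i k w x \<le> cmod (char_fun N (p (k, i)) ((\<lambda>w\<in>W. form K x w) w))"
          using off_diag_factor_le(2)[OF ik xV, of w] WV a by (auto simp: entry_weight_def)
      qed
    qed
  qed
qed

lemma sum_off_diag_outliers:
  assumes W: "W \<in> isotropic K" "card W = N" and Q: "Q \<subseteq> {..<n}" and i: "i < n" "i \<notin> Q"
    and x: "\<And>k. k \<in> Q \<Longrightarrow> x k \<in> carrier VV - W"
  shows "(\<Sum>w\<in>W. \<Prod>k\<in>Q. off_diag_weight K n N p i k w (x k)) \<le> N * contraction \<alpha> (card Q)"
proof -
  interpret V: comm_group VV by (rule comm_group_VV)
  have sub: "subgroup W VV" using W by (simp add: isotropic_def)
  have WV: "W \<subseteq> carrier VV" using subgroup.subset[OF sub] .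
  have finW: "finite W" using finite_subset[OF WV finite_VV] .
  have finQ: "finite Q" using Q finite_subset by blast
  let ?P = "\<lambda>k \<xi> e. \<xi> \<in> chars (VV\<lparr>carrier := W\<rparr>) \<and> (\<exists>w\<in>W. \<xi> w \<noteq> 1) \<and> (\<forall>w\<in>W. \<xi> w ^ N = 1) \<and>
     e \<in> free_entries K n \<and> (\<forall>w\<in>W. off_diag_weight K n N p i k w (x k) \<le> cmod (char_fun N (p e) (\<xi> w)))"
  have "\<forall>k\<in>Q. \<exists>z. ?P k (fst z) (snd z)"
  proof
    fix k assume k: "k \<in> Q"
    have "k < n" "i \<noteq> k" using k Q i by auto
    from off_diag_outlier[OF W i(1) this x[OF k]]
    obtain \<xi> e where "?P k \<xi> e" by blast
    then show "\<exists>z. ?P k (fst z) (snd z)" by (intro exI[of _ "(\<xi>, e)"]) simp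
  qed
  then obtain z where z: "\<And>k. k \<in> Q \<Longrightarrow> ?P k (fst (z k)) (snd (z k))"
    unfolding bchoice_iff by blast
  have cg: "comm_group (VV\<lparr>carrier := W\<rparr>)"
    by (rule V.comm_group_subgroup[OF sub])
  have "(\<Sum>w\<in>W. \<Prod>k\<in>Q. off_diag_weight K n N p i k w (x k))
      \<le> (\<Sum>w\<in>W. \<Prod>k\<in>Q. cmod (char_fun N (p (snd (z k))) (fst (z k) w)))"
  proof (intro sum_mono prod_mono conjI)
    fix w k assume wk: "w \<in> W" "k \<in> Q"
    have "x k \<in> carrier VV" "w \<in> carrier VV" using x[OF wk(2)] wk WV by blast+
    then show "0 \<le> off_diag_weight K n N p i k w (x k)" using off_diag_bounds by blast
    show "off_diag_weight K n N p i k w (x k) \<le> cmod (char_fun N (p (snd (z k))) (fst (z k) w))"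
      using z[OF wk(2)] wk(1) by blast
  qed
  also have "\<dots> = (\<Sum>w\<in>carrier (VV\<lparr>carrier := W\<rparr>). \<Prod>k\<in>Q. cmod (char_fun N (p (snd (z k))) (fst (z k) w)))"
    by simp
  also have "\<dots> \<le> real (order (VV\<lparr>carrier := W\<rparr>)) * sqrt ((1 + (1 - 4 * \<alpha> * (1 - \<alpha>)) ^ card Q) / 2)"
  proof (rule sum_prod_char_fun_le[OF cg _ finQ order_pos _ \<alpha>(2)])
    show "finite (carrier (VV\<lparr>carrier := W\<rparr>))" using finW by simp
    show "0 \<le> \<alpha>" using \<alpha> by simp
    fix k assume k: "k \<in> Q"
    show "fst (z k) \<in> chars (VV\<lparr>carrier := W\<rparr>)" using z[OF k] by blast
    show "\<exists>w\<in>carrier (VV\<lparr>carrier := W\<rparr>). fst (z k) w \<noteq> 1" using z[OF k] by simp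
    show "balanced_law N \<alpha> (p (snd (z k)))" using z[OF k] p by blast
    show "fst (z k) w ^ N = 1" if "w \<in> carrier (VV\<lparr>carrier := W\<rparr>)" for w
      using z[OF k] that by simp
  qed
  also have "\<dots> = N * contraction \<alpha> (card Q)"
    using W by (simp add: order_def contraction_def)
  finally show ?thesis .
qed

text \<open>In the symmetric case w -> \<open>pairing w w\<close> is a character on an isotropic W,
  because its polarisation is the form, which is trivial there. If this character is trivial, all
  assignments into W are special; otherwise the diagonal factors contract as for one outlier. For
  the other two kinds every assignment into W is special.\<close>

lemma diag_inside:
  assumes W: "W \<in> isotropic K" "card W = N"
  shows "(\<forall>u\<in>{..<n} \<rightarrow>\<^sub>E W. special K n u) \<or> (\<forall>i<n. (\<Sum>w\<in>W. diag_weight K n N p i w) \<le> N * contraction \<alpha> 1)"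
proof (cases "\<forall>u\<in>{..<n} \<rightarrow>\<^sub>E W. special K n u")
  case False
  interpret V: comm_group VV by (rule comm_group_VV)
  have sub: "subgroup W VV" using W by (simp add: isotropic_def)
  have iso: "form K u v = 1" if "u \<in> W" "v \<in> W" for u v using W that by (simp add: isotropic_def)
  have WV: "W \<subseteq> carrier VV" using subgroup.subset[OF sub] .
  have finW: "finite W" using finite_subset[OF WV finite_VV] .
  obtain u where u: "u \<in> {..<n} \<rightarrow>\<^sub>E W" "\<not> special K n u" using False by blast
  obtain i j where e: "(i, j) \<in> free_entries K n" "entry_form K u (i, j) \<noteq> 1"
    using u(2) by (auto simp: special_def)
  have ij: "i < n" "j < n" using free_entries_subset[of K n] e(1) by auto
  then have uW: "u i \<in> W" "u j \<in> W" using u(1) by auto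
  have "i = j" using e(2) iso[OF uW] by (auto simp: entry_form_def split: if_splits)
  then have q: "pairing (u i) (u i) \<noteq> 1" using e(2) by (simp add: entry_form_def)
  have K: "K = Symmetric"
  proof (cases K)
    case General
    then show ?thesis using q iso[OF uW(1) uW(1)] by (simp add: form_def)
  next
    case Alternating
    then show ?thesis using e(1) \<open>i = j\<close> by (simp add: free_entries_def)
  qed
  let ?W = "VV\<lparr>carrier := W\<rparr>"
  have cg: "comm_group ?W" by (rule V.comm_group_subgroup[OF sub])
  have "restrict (\<lambda>w. pairing w w) (carrier ?W) \<in> chars ?W"
  proof (rule charsI)
    show "group ?W" using cg by (simp add: comm_group.axioms)
    fix x assume "x \<in> carrier ?W"
    then have x: "x \<in> W" "x \<in> carrier VV" using WV by auto
    show "cmod (pairing x x) = 1" using norm_pairing x by blast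
    fix y assume "y \<in> carrier ?W"
    then have y: "y \<in> W" "y \<in> carrier VV" using WV by auto
    have xy: "x \<otimes>\<^bsub>VV\<^esub> y \<in> carrier VV" using x y V.m_closed by blast
    have "pairing (x \<otimes>\<^bsub>VV\<^esub> y) (x \<otimes>\<^bsub>VV\<^esub> y) = (pairing x x * pairing x y) * (pairing y x * pairing y y)"
      using pairing_mult[OF x(2) y(2)] xy x y by (simp del: carrier_VV)
    also have "\<dots> = pairing x x * pairing y y * form K x y" by (simp add: form_def K)
    finally show "pairing (x \<otimes>\<^bsub>?W\<^esub> y) (x \<otimes>\<^bsub>?W\<^esub> y) = pairing x x * pairing y y"
      using iso[OF x(1) y(1)] by simp
  qed
  then have ch: "(\<lambda>w\<in>W. pairing w w) \<in> chars ?W" by simp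
  have "(\<Sum>w\<in>W. diag_weight K n N p k w) \<le> N * contraction \<alpha> 1" if k: "k < n" for k
  proof -
    have kE: "(k, k) \<in> free_entries K n" using k K by (simp add: free_entries_def)
    \<comment> \<open>A product over a single index brings the diagonal sum into the shape of
      \<open>sum_prod_char_fun_le\<close>.\<close>
    have "(\<Sum>w\<in>W. diag_weight K n N p k w) = (\<Sum>w\<in>carrier ?W. \<Prod>_\<in>{()}. cmod (char_fun N (p (k, k)) ((\<lambda>w\<in>W. pairing w w) w)))"
      using kE by (simp add: diag_weight_def entry_weight_def)
    also have "\<dots> \<le> real (order ?W) * sqrt ((1 + (1 - 4 * \<alpha> * (1 - \<alpha>)) ^ card {()}) / 2)"
    proof (rule sum_prod_char_fun_le[OF cg _ _ order_pos _ \<alpha>(2)])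
      show "\<exists>w\<in>carrier ?W. (\<lambda>w\<in>W. pairing w w) w \<noteq> 1" using q uW(1) by (intro bexI[of _ "u i"]) auto
      show "(\<lambda>w\<in>W. pairing w w) w ^ N = 1" if "w \<in> carrier ?W" for w
        using that WV pairing_power_order[of w w] by auto
      show "(\<lambda>w\<in>W. pairing w w) \<in> chars ?W" by (rule ch)
      show "balanced_law N \<alpha> (p (k, k))" by (rule p[OF kE])
    qed (use finW \<alpha> in simp_all)
    also have "\<dots> = N * contraction \<alpha> 1"
      using W by (simp add: order_def contraction_def)
    finally show ?thesis .
  qed
  then show ?thesis by blast
qed blast

lemma pair_weights_fourier:
  "pair_weights (carrier VV) N (form_orth K) (isotropic K) n (off_diag_weight K n N p) (diag_weight K n N p)
     (special K n) \<alpha> (root_gap N / 2)"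
proof
  show "finite (carrier VV)" by (rule finite_VV)
  show "card (carrier VV) = N\<^sup>2" by (rule card_VV)
  show "N > 0" by (rule order_pos)
  show "W \<subseteq> carrier VV \<and> card W \<le> N" if "W \<in> isotropic K" for W
    using that isotropic_card(1)[OF that] subgroup.subset[of W VV] by (simp add: isotropic_def del: carrier_VV)
  show "\<exists>W\<in>isotropic K. S \<subseteq> W" if "S \<subseteq> carrier VV" "\<And>u v. u \<in> S \<Longrightarrow> v \<in> S \<Longrightarrow> form_orth K u v" for S
    using isotropic_generate[OF that] generate.incl[of _ S VV] by (intro bexI[of _ "generate VV S"]) auto
  show "off_diag_weight K n N p i j u v = off_diag_weight K n N p j i v u" for i j u v
    by (simp add: off_diag_weight_def mult.commute)
  show "0 \<le> off_diag_weight K n N p i j u v \<and> off_diag_weight K n N p i j u v \<le> 1"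
    if "u \<in> carrier VV" "v \<in> carrier VV" for i j u v using off_diag_bounds that by blast
  show "0 \<le> diag_weight K n N p i u \<and> diag_weight K n N p i u \<le> 1" if "u \<in> carrier VV" for i u
    using diag_bounds that by blast
qed (use off_diag_not_orthogonal sum_off_diag_outliers diag_inside in \<open>simp_all del: carrier_VV\<close>)

lemma prod_entries_eq_weight:
  fixes u :: "nat \<Rightarrow> 'a \<times> ('a \<Rightarrow> complex)"
  shows "(\<Prod>e\<in>free_entries K n. cmod (char_fun N (p e) (entry_form K u e)))
     = pair_weights.weight n (off_diag_weight K n N p) (diag_weight K n N p) u"
proof -
  have "(\<Prod>e\<in>free_entries K n. cmod (char_fun N (p e) (entry_form K u e)))
      = (\<Prod>e\<in>{..<n} \<times> {..<n}. ew e (entry_form K u e))"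
    using free_entries_subset[of K n] by (intro prod.mono_neutral_cong_left) (auto simp: entry_weight_def)
  also have "\<dots> = pair_weights.weight n (off_diag_weight K n N p) (diag_weight K n N p) u"
    unfolding prod_square_index_pairs pair_weights.weight_def[OF pair_weights_fourier]
    by (intro arg_cong2[of _ _ _ _ "(*)"] prod.cong)
       (auto simp: off_diag_weight_def diag_weight_def entry_form_def index_pairs_def)
  finally show ?thesis .
qed

end

end

section \<open>Characters of tensor squares\<close>

lemma generated_eqI:
  assumes "comm_group G" "finite (carrier G)" "S \<subseteq> carrier G" "generate G S = carrier G"
    and "\<And>x. x \<in> S \<Longrightarrow> f x = (g x :: complex)"
    and "\<And>x y. x \<in> carrier G \<Longrightarrow> y \<in> carrier G \<Longrightarrow> f (x \<otimes>\<^bsub>G\<^esub> y) = f x * f y"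
    and "\<And>x y. x \<in> carrier G \<Longrightarrow> y \<in> carrier G \<Longrightarrow> g (x \<otimes>\<^bsub>G\<^esub> y) = g x * g y"
    and "f \<one>\<^bsub>G\<^esub> = g \<one>\<^bsub>G\<^esub>" "x \<in> carrier G"
  shows "f x = g x"
proof -
  interpret comm_group G by fact
  have "subgroup {x \<in> carrier G. f x = g x} G"
    using assms(2,6,7,8) by (intro finite_subgroupI) auto
  then have "generate G S \<subseteq> {x \<in> carrier G. f x = g x}"
    using assms(3,5) by (intro generate_subgroup_incl) auto
  then show ?thesis using assms(4,9) by blast
qed

text \<open>Adjoining a generator x of bounded order multiplies the subgroup by the finite cyclic
  group of x. The finiteness of the tensor group, a quotient of an infinite group, rests on
  this.\<close>

lemma (in comm_group) finite_generate:
  assumes "finite X" "X \<subseteq> carrier G" "a > 0" "\<And>x. x \<in> X \<Longrightarrow> x [^] (a::nat) = \<one>"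
  shows "finite (generate G X)"
  using assms(1,2,4)
proof (induction X rule: finite_induct)
  case empty
  then show ?case by (simp add: generate_empty)
next
  case (insert x X)
  have x: "x \<in> carrier G" "x [^] a = \<one>" using insert.prems by auto
  have X: "X \<subseteq> carrier G" using insert.prems by auto
  have sx: "subgroup (generate G {x}) G" using x by (intro generate_is_subgroup) auto
  have sX: "subgroup (generate G X) G" using X by (intro generate_is_subgroup)
  have "generate G {x} \<subseteq> (\<lambda>k. x [^] k) ` {..<a}"
  proof
    fix y assume "y \<in> generate G {x}"
    then obtain k :: int where y: "y = x [^] k" using generate_pow[OF x(1)] by auto
    have "x [^] k = x [^] (int a * (k div int a) + k mod int a)" by simp
    also have "\<dots> = x [^] (int a * (k div int a)) \<otimes> x [^] (k mod int a)"
      using x(1) by (simp only: int_pow_mult)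
    also have "x [^] (int a * (k div int a)) = (x [^] int a) [^] (k div int a)"
      using x(1) by (simp only: int_pow_pow)
    also have "\<dots> = \<one>" using x by (simp add: int_pow_int)
    also have "k mod int a = int (nat (k mod int a))" using assms(3) by simp
    also have "\<one> \<otimes> x [^] \<dots> = x [^] nat (k mod int a)" using x by (simp add: int_pow_int)
    finally have "y = x [^] nat (k mod int a)" using y by simp
    moreover have "nat (k mod int a) < a" using assms(3) by (simp add: nat_less_iff)
    ultimately show "y \<in> (\<lambda>k. x [^] k) ` {..<a}" by blast
  qed
  then have fx: "finite (generate G {x})" by (rule finite_subset) simp
  have fX: "finite (generate G X)" using insert by auto
  have "generate G (insert x X) \<subseteq> generate G X <#> generate G {x}"
  proof (rule generate_subgroup_incl)
    show "subgroup (generate G X <#> generate G {x}) G" by (rule mult_subgroups[OF sX sx])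
    show "insert x X \<subseteq> generate G X <#> generate G {x}"
    proof
      fix y assume "y \<in> insert x X"
      then consider "y = x" | "y \<in> X" by blast
      then show "y \<in> generate G X <#> generate G {x}"
      proof cases
        case 1
        then have "y = \<one> \<otimes> x" using x by simp
        then show ?thesis unfolding set_mult_def
          using generate.one[of G X] generate.incl[of x "{x}" G] by blast
      next
        case 2
        then have "y = y \<otimes> \<one>" using X by auto
        then show ?thesis unfolding set_mult_def
          using generate.one[of G "{x}"] generate.incl[OF 2, of G] by blast
      qed
    qed
  qed
  moreover have "finite (generate G X <#> generate G {x})"
    unfolding set_mult_def using fx fX by auto
  ultimately show ?case by (rule finite_subset)
qed

section \<open>The tensor square as a quotient of a free abelian group\<close>

context finite_abelian
begin

abbreviation "FF \<equiv> free_Abelian_group (carrier G \<times> carrier G)"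
abbreviation "TT \<equiv> tensor_group G G"
abbreviation "pt \<equiv> pure_tensor G G"

lemma frag_diff_closed: "a \<in> carrier FF \<Longrightarrow> b \<in> carrier FF \<Longrightarrow> a - b \<in> carrier FF"
  using keys_diff[of a b] by auto

lemma frag_of_closed: "x \<in> carrier G \<Longrightarrow> y \<in> carrier G \<Longrightarrow> frag_of (x, y) \<in> carrier FF"
  by simp

lemma tensor_relations_subset: "tensor_relations G G \<subseteq> carrier FF"
proof
  fix r assume "r \<in> tensor_relations G G"
  then consider x x' y where "r = frag_of (x \<otimes> x', y) - frag_of (x, y) - frag_of (x', y)" "x \<in> carrier G" "x' \<in> carrier G" "y \<in> carrier G"
    | x y y' where "r = frag_of (x, y \<otimes> y') - frag_of (x, y) - frag_of (x, y')" "x \<in> carrier G" "y \<in> carrier G" "y' \<in> carrier G"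
    unfolding tensor_relations_def by blast
  then show "r \<in> carrier FF"
    by cases (auto simp only: intro!: frag_diff_closed frag_of_closed m_closed)
qed

lemma subgroup_tensor_kernel: "subgroup (tensor_kernel G G) FF"
  unfolding tensor_kernel_def by (intro group.generate_is_subgroup tensor_relations_subset) simp

lemma normal_tensor_kernel: "tensor_kernel G G \<lhd> FF"
  using comm_group.subgroup_imp_normal[OF abelian_free_Abelian_group subgroup_tensor_kernel] .

lemma comm_group_TT: "comm_group TT"
  unfolding tensor_group_def
  by (rule comm_group.abelian_FactGroup[OF abelian_free_Abelian_group subgroup_tensor_kernel])

definition quot :: "('a \<times> 'a \<Rightarrow>\<^sub>0 int) \<Rightarrow> ('a \<times> 'a \<Rightarrow>\<^sub>0 int) set" where
  "quot c = tensor_kernel G G #>\<^bsub>FF\<^esub> c"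

lemma quot_hom: "quot \<in> hom FF TT"
  unfolding quot_def[abs_def] tensor_group_def by (rule normal.r_coset_hom_Mod[OF normal_tensor_kernel])

lemma quot_add: "a \<in> carrier FF \<Longrightarrow> b \<in> carrier FF \<Longrightarrow> quot (a + b) = quot a \<otimes>\<^bsub>TT\<^esub> quot b"
  using hom_mult[OF quot_hom, of a b] by simp

lemma quot_kernel: "r \<in> tensor_kernel G G \<Longrightarrow> quot r = \<one>\<^bsub>TT\<^esub>"
  using group.coset_join2[OF group_free_Abelian_group _ subgroup_tensor_kernel] subgroup.mem_carrier[OF subgroup_tensor_kernel]
  by (simp add: quot_def tensor_group_def FactGroup_def del: carrier_free_Abelian_group_iff)

lemma carrier_TT: "carrier TT = quot ` carrier FF"
  unfolding tensor_group_def quot_def[abs_def] by (simp add: carrier_FactGroup)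

lemma pt_eq: "pt x y = quot (frag_of (x, y))"
  by (simp add: pure_tensor_def quot_def)

lemma pt_closed: "x \<in> carrier G \<Longrightarrow> y \<in> carrier G \<Longrightarrow> pt x y \<in> carrier TT"
  unfolding pt_eq carrier_TT by (intro imageI frag_of_closed)

text \<open>The relation c - a - b lies in the kernel, so c and a + b have the same image.\<close>

lemma quot_relation:
  assumes "c - a - b \<in> tensor_relations G G" "a \<in> carrier FF" "b \<in> carrier FF" "c \<in> carrier FF"
  shows "quot c = quot a \<otimes>\<^bsub>TT\<^esub> quot b"
proof -
  interpret T: comm_group TT by (rule comm_group_TT)
  have r: "c - a - b \<in> tensor_kernel G G"
    unfolding tensor_kernel_def by (rule generate.incl[OF assms(1)])
  have rc: "c - a - b \<in> carrier FF" using assms tensor_relations_subset by blast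
  have q: "quot a \<in> carrier TT" "quot b \<in> carrier TT" using assms by (auto simp only: carrier_TT)
  have "a + b \<in> carrier FF" using monoid.m_closed[of FF a b] assms
    by (metis group.is_monoid group_free_Abelian_group mult_free_Abelian_group)
  then have "quot ((c - a - b) + (a + b)) = quot (c - a - b) \<otimes>\<^bsub>TT\<^esub> (quot a \<otimes>\<^bsub>TT\<^esub> quot b)"
    using quot_add rc assms by metis
  then show ?thesis using quot_kernel[OF r] q by simp
qed

lemma pt_mult_left:
  assumes "x \<in> carrier G" "x' \<in> carrier G" "y \<in> carrier G"
  shows "pt (x \<otimes> x') y = pt x y \<otimes>\<^bsub>TT\<^esub> pt x' y"
  unfolding pt_eq
proof (rule quot_relation)
  show "frag_of (x \<otimes> x', y) - frag_of (x, y) - frag_of (x', y) \<in> tensor_relations G G"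
    unfolding tensor_relations_def using assms by blast
qed (use assms in \<open>auto intro!: frag_of_closed\<close>)

lemma pt_mult_right:
  assumes "x \<in> carrier G" "y \<in> carrier G" "y' \<in> carrier G"
  shows "pt x (y \<otimes> y') = pt x y \<otimes>\<^bsub>TT\<^esub> pt x y'"
  unfolding pt_eq
proof (rule quot_relation)
  show "frag_of (x, y \<otimes> y') - frag_of (x, y) - frag_of (x, y') \<in> tensor_relations G G"
    unfolding tensor_relations_def using assms by blast
qed (use assms in \<open>auto intro!: frag_of_closed\<close>)

lemma pt_one_left: "y \<in> carrier G \<Longrightarrow> pt \<one> y = \<one>\<^bsub>TT\<^esub>"
proof -
  assume y: "y \<in> carrier G"
  interpret T: comm_group TT by (rule comm_group_TT)
  show ?thesis
    using pt_mult_left[OF one_closed one_closed y] pt_closed[OF one_closed y] T.r_cancel_one' by simp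
qed

lemma pt_pow_left:
  assumes "x \<in> carrier G" "y \<in> carrier G"
  shows "pt (x [^] (k::nat)) y = pt x y [^]\<^bsub>TT\<^esub> k"
proof -
  interpret T: comm_group TT by (rule comm_group_TT)
  show ?thesis
    using assms by (induction k) (auto simp: pt_one_left pt_mult_left)
qed

lemma generate_pt: "generate TT ((\<lambda>(x, y). pt x y) ` (carrier G \<times> carrier G)) = carrier TT"
proof
  interpret T: comm_group TT by (rule comm_group_TT)
  let ?P = "(\<lambda>(x, y). pt x y) ` (carrier G \<times> carrier G)"
  have sub: "?P \<subseteq> carrier TT" using pt_closed by auto
  show "generate TT ?P \<subseteq> carrier TT" by (rule T.generate_incl[OF sub])
  interpret P: subgroup "generate TT ?P" TT by (rule T.generate_is_subgroup[OF sub])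
  interpret q: group_hom FF TT quot
    by (intro group_hom.intro group_hom_axioms.intro quot_hom T.is_group group_free_Abelian_group)
  show "carrier TT \<subseteq> generate TT ?P"
  proof
    fix t assume "t \<in> carrier TT"
    then obtain c where c: "c \<in> carrier FF" "t = quot c" unfolding carrier_TT by blast
    have "Poly_Mapping.keys c \<subseteq> carrier G \<times> carrier G" using c by simp
    then have "quot c \<in> generate TT ?P"
    proof (rule free_Abelian_group_induct)
      show "quot 0 \<in> generate TT ?P" using q.hom_one P.one_closed by simp
    next
      fix a b :: "'a \<times> 'a \<Rightarrow>\<^sub>0 int"
      assume ab: "Poly_Mapping.keys a \<subseteq> carrier G \<times> carrier G" "Poly_Mapping.keys b \<subseteq> carrier G \<times> carrier G"
        "quot a \<in> generate TT ?P" "quot b \<in> generate TT ?P"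
      have "quot (a - b) = quot a \<otimes>\<^bsub>TT\<^esub> inv\<^bsub>TT\<^esub> (quot b)"
      proof -
        have ab': "a \<in> carrier FF" "b \<in> carrier FF" using ab by auto
        have "a - b = a \<otimes>\<^bsub>FF\<^esub> inv\<^bsub>FF\<^esub> b" using ab by simp
        then show ?thesis
          by (simp only: q.hom_mult[OF ab'(1) group.inv_closed[OF group_free_Abelian_group ab'(2)]] q.hom_inv[OF ab'(2)])
      qed
      then show "quot (a - b) \<in> generate TT ?P"
        using ab P.m_closed P.m_inv_closed by simp
    next
      fix z assume "z \<in> carrier G \<times> carrier G"
      then show "quot (frag_of z) \<in> generate TT ?P"
        by (intro generate.incl) (auto simp: pt_eq)
    qed
    then show "t \<in> generate TT ?P" using c by simp
  qed
qed

text \<open>Finitely many pure tensors generate, and each is annihilated by |G|.\<close>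

lemma finite_TT: "finite (carrier TT)"
proof -
  interpret T: comm_group TT by (rule comm_group_TT)
  have "finite (generate TT ((\<lambda>(x, y). pt x y) ` (carrier G \<times> carrier G)))"
  proof (rule T.finite_generate[OF _ _ order_pos])
    fix t assume "t \<in> (\<lambda>(x, y). pt x y) ` (carrier G \<times> carrier G)"
    then obtain x y where "x \<in> carrier G" "y \<in> carrier G" "t = pt x y" by auto
    then show "t [^]\<^bsub>TT\<^esub> order G = \<one>\<^bsub>TT\<^esub>"
      by (simp add: pt_pow_left[symmetric] pow_order_eq_1 pt_one_left)
  qed (use fin pt_closed in auto)
  then show ?thesis by (simp add: generate_pt)
qed

text \<open>A bilinear map extends to the free abelian group on pairs and kills the bilinearity
  relations there, so it factors through the tensor group.\<close>

lemma tensor_universal: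
  assumes "\<And>x y. x \<in> carrier G \<Longrightarrow> y \<in> carrier G \<Longrightarrow> cmod (b x y) = 1"
    and bl: "\<And>x x' y. x \<in> carrier G \<Longrightarrow> x' \<in> carrier G \<Longrightarrow> y \<in> carrier G \<Longrightarrow> b (x \<otimes> x') y = b x y * b x' y"
    and br: "\<And>x y y'. x \<in> carrier G \<Longrightarrow> y \<in> carrier G \<Longrightarrow> y' \<in> carrier G \<Longrightarrow> b x (y \<otimes> y') = b x y * b x y'"
  obtains \<tau> where "\<tau> \<in> hom TT circle_group" "\<And>x y. x \<in> carrier G \<Longrightarrow> y \<in> carrier G \<Longrightarrow> \<tau> (pt x y) = b x y"
proof -
  obtain h where h: "h \<in> hom FF circle_group" "\<And>z. z \<in> carrier G \<times> carrier G \<Longrightarrow> h (frag_of z) = (\<lambda>(x, y). b x y) z"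
  proof -
    have "(\<lambda>(x, y). b x y) ` (carrier G \<times> carrier G) \<subseteq> carrier circle_group" using assms(1) by auto
    from comm_group.free_Abelian_group_universal[OF comm_group_circle this] that show thesis by metis
  qed
  interpret h: group_hom FF circle_group h
    by (intro group_hom.intro group_hom_axioms.intro h group_circle group_free_Abelian_group)
  have hrel: "h (c - a - b') = 1" if "a \<in> carrier FF" "b' \<in> carrier FF" "c \<in> carrier FF" "h c = h a * h b'" for a b' c
  proof -
    have 1: "c - a - b' \<in> carrier FF" using that frag_diff_closed by blast
    have 2: "a + b' \<in> carrier FF" using monoid.m_closed[of FF a b'] that
      by (metis group.is_monoid group_free_Abelian_group mult_free_Abelian_group)
    have "h ((c - a - b') + (a + b')) = h (c - a - b') * (h a * h b')"
      using hom_mult[OF h(1) 1 2] hom_mult[OF h(1) that(1,2)] by simp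
    moreover have "h a * h b' \<noteq> 0"
      using h.hom_closed[OF that(1)] h.hom_closed[OF that(2)] by auto
    ultimately show ?thesis using that(4) by simp
  qed
  have "tensor_relations G G \<subseteq> kernel FF circle_group h"
  proof
    fix r assume r: "r \<in> tensor_relations G G"
    then consider x x' y where "r = frag_of (x \<otimes> x', y) - frag_of (x, y) - frag_of (x', y)" "x \<in> carrier G" "x' \<in> carrier G" "y \<in> carrier G"
      | x y y' where "r = frag_of (x, y \<otimes> y') - frag_of (x, y) - frag_of (x, y')" "x \<in> carrier G" "y \<in> carrier G" "y' \<in> carrier G"
      unfolding tensor_relations_def by blast
    then have "h r = 1"
      by cases (auto simp: h(2) bl br intro!: hrel)
    then show "r \<in> kernel FF circle_group h"
      using subsetD[OF tensor_relations_subset r] by (simp add: kernel_def del: carrier_free_Abelian_group_iff)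
  qed
  then have "tensor_kernel G G \<subseteq> kernel FF circle_group h"
    unfolding tensor_kernel_def by (rule group.generate_subgroup_incl[OF group_free_Abelian_group _ h.subgroup_kernel])
  from h.FactGroup_universal_kernel[OF normal_tensor_kernel this]
  obtain \<tau> where "\<tau> \<in> hom TT circle_group" "\<And>c. c \<in> carrier FF \<Longrightarrow> \<tau> (quot c) = h c"
    unfolding tensor_group_def quot_def by blast
  then show thesis
    using that h(2) frag_of_closed unfolding pt_eq by simp
qed

lemma tensor_hom_eqI:
  assumes "\<tau> \<in> hom TT circle_group" "\<tau>' \<in> hom TT circle_group"
    and "\<And>x y. x \<in> carrier G \<Longrightarrow> y \<in> carrier G \<Longrightarrow> \<tau> (pt x y) = \<tau>' (pt x y)" "t \<in> carrier TT"
  shows "\<tau> t = \<tau>' t"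
proof -
  interpret T: comm_group TT by (rule comm_group_TT)
  show ?thesis
  proof (rule generated_eqI[OF comm_group_TT finite_TT _ generate_pt])
    show "\<tau> \<one>\<^bsub>TT\<^esub> = \<tau>' \<one>\<^bsub>TT\<^esub>"
      using hom_one[OF assms(1)] hom_one[OF assms(2)] by simp
  qed (use assms pt_closed hom_mult[OF assms(1)] hom_mult[OF assms(2)] in auto)
qed

lemma tensor_hom_mult:
  assumes "\<tau> \<in> hom TT circle_group" "x \<in> carrier G" "y \<in> carrier G" "z \<in> carrier G"
  shows "\<tau> (pt (x \<otimes> y) z) = \<tau> (pt x z) * \<tau> (pt y z)" "\<tau> (pt z (x \<otimes> y)) = \<tau> (pt z x) * \<tau> (pt z y)"
  using assms hom_mult[OF assms(1)] by (simp_all add: pt_mult_left pt_mult_right pt_closed)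

lemma tensor_hom_norm:
  assumes "\<tau> \<in> hom TT circle_group" "x \<in> carrier G" "y \<in> carrier G"
  shows "cmod (\<tau> (pt x y)) = 1"
  using hom_in_carrier[OF assms(1) pt_closed[OF assms(2,3)]] by simp

lemma tensor_hom_one:
  assumes "\<tau> \<in> hom TT circle_group" "x \<in> carrier G"
  shows "\<tau> (pt \<one> x) = 1" "\<tau> (pt x \<one>) = 1"
proof -
  have "\<tau> (pt \<one> x) = \<tau> (pt \<one> x) * \<tau> (pt \<one> x)" "\<tau> (pt x \<one>) = \<tau> (pt x \<one>) * \<tau> (pt x \<one>)"
    using tensor_hom_mult[OF assms(1) one_closed one_closed assms(2)] by simp_all
  then show "\<tau> (pt \<one> x) = 1" "\<tau> (pt x \<one>) = 1"
    using tensor_hom_norm[OF assms(1) one_closed assms(2)] tensor_hom_norm[OF assms(1,2) one_closed] by auto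
qed

lemma char_finprod:
  assumes "\<xi> \<in> chars G" "finite A" "f \<in> A \<rightarrow> carrier G"
  shows "\<xi> (\<Otimes>j\<in>A. f j) = (\<Prod>j\<in>A. \<xi> (f j))"
  using assms(2,3)
proof (induction A rule: finite_induct)
  case empty
  then show ?case using chars_one[OF is_group assms(1)] by simp
next
  case (insert x A)
  then have "f x \<in> carrier G" "f \<in> A \<rightarrow> carrier G" by auto
  then show ?case
    using insert chars_mult[OF assms(1)] by (simp add: finprod_insert finprod_closed)
qed

section \<open>Characters of quotients of the tensor square, read off on a generating tuple\<close>

context
  fixes F :: "nat \<Rightarrow> 'a" and n :: nat
  assumes F: "\<And>j. j < n \<Longrightarrow> F j \<in> carrier G" and gen: "generate G (F ` {..<n}) = carrier G"
begin

lemma eq_on_generators: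
  assumes "\<And>j. j < n \<Longrightarrow> f (F j) = (g (F j) :: complex)"
    and "\<And>x y. x \<in> carrier G \<Longrightarrow> y \<in> carrier G \<Longrightarrow> f (x \<otimes> y) = f x * f y"
    and "\<And>x y. x \<in> carrier G \<Longrightarrow> y \<in> carrier G \<Longrightarrow> g (x \<otimes> y) = g x * g y"
    and "f \<one> = g \<one>" "x \<in> carrier G"
  shows "f x = g x"
  by (rule generated_eqI[OF comm_group_axioms fin _ gen]) (use assms F in auto)

text \<open>The quotient is counted by its characters, that is, by bilinear maps trivial on R. Such
  a map is determined by the characters g -> \<tau>(g \<otimes> F j), since the F j generate; the
  last two assumptions say that the families arising in this way are exactly those in
  \<open>SS\<close>.\<close>

lemma card_eq_order_quotient:
  assumes R: "R \<subseteq> carrier TT"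
    and 1: "\<And>\<tau>. \<tau> \<in> hom TT circle_group \<Longrightarrow> (\<And>r. r \<in> R \<Longrightarrow> \<tau> r = 1) \<Longrightarrow>
       (\<lambda>j\<in>{..<n}. \<lambda>g\<in>carrier G. \<tau> (pt g (F j))) \<in> SS"
    and 2: "\<And>C. C \<in> SS \<Longrightarrow> C \<in> {..<n} \<rightarrow>\<^sub>E chars G \<and>
       (\<exists>\<tau>\<in>hom TT circle_group. (\<forall>r\<in>R. \<tau> r = 1) \<and> (\<forall>j<n. \<forall>g\<in>carrier G. \<tau> (pt g (F j)) = C j g))"
  shows "card SS = order (TT Mod generate TT R)"
proof -
  interpret T: comm_group TT by (rule comm_group_TT)
  let ?D = "generate TT R"
  let ?Q = "TT Mod ?D"
  let ?\<rho> = "\<lambda>t. ?D #>\<^bsub>TT\<^esub> t"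
  have sub: "subgroup ?D TT" by (rule T.generate_is_subgroup[OF R])
  have norm: "?D \<lhd> TT" by (rule T.subgroup_imp_normal[OF sub])
  interpret Q: comm_group ?Q by (rule T.abelian_FactGroup[OF sub])
  have carrier_Q: "carrier ?Q = ?\<rho> ` carrier TT" by (simp add: carrier_FactGroup)
  have finQ: "finite (carrier ?Q)" unfolding carrier_Q using finite_TT by simp
  have \<rho>: "?\<rho> \<in> hom TT ?Q" by (rule normal.r_coset_hom_Mod[OF norm])
  define \<Psi> where "\<Psi> \<xi> = (\<lambda>j\<in>{..<n}. \<lambda>g\<in>carrier G. \<xi> (?\<rho> (pt g (F j))))" for \<xi> :: "_ \<Rightarrow> complex"
  have comp: "(\<lambda>t. \<xi> (?\<rho> t)) \<in> hom TT circle_group" if "\<xi> \<in> chars ?Q" for \<xi>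
    using that \<rho> by (auto simp: chars_def hom_def Pi_iff)
  have "bij_betw \<Psi> (chars ?Q) SS"
    unfolding bij_betw_def
  proof
    show "inj_on \<Psi> (chars ?Q)"
    proof (rule inj_onI)
      fix \<xi> \<xi>' assume \<xi>: "\<xi> \<in> chars ?Q" "\<xi>' \<in> chars ?Q" and eq: "\<Psi> \<xi> = \<Psi> \<xi>'"
      have gen_eq: "\<xi> (?\<rho> (pt g (F j))) = \<xi>' (?\<rho> (pt g (F j)))" if "g \<in> carrier G" "j < n" for g j
        using fun_cong[OF fun_cong[OF eq, of j], of g] that by (simp add: \<Psi>_def)
      have pt_eq: "\<xi> (?\<rho> (pt x y)) = \<xi>' (?\<rho> (pt x y))" if "x \<in> carrier G" "y \<in> carrier G" for x y
        by (rule eq_on_generators[where f = "\<lambda>y. \<xi> (?\<rho> (pt x y))" and g = "\<lambda>y. \<xi>' (?\<rho> (pt x y))"])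
           (use that gen_eq tensor_hom_mult(2)[OF comp[OF \<xi>(1)]] tensor_hom_mult(2)[OF comp[OF \<xi>(2)]]
             tensor_hom_one(2)[OF comp[OF \<xi>(1)]] tensor_hom_one(2)[OF comp[OF \<xi>(2)]] in simp_all)
      have "\<xi> (?\<rho> t) = \<xi>' (?\<rho> t)" if "t \<in> carrier TT" for t
        using tensor_hom_eqI[OF comp[OF \<xi>(1)] comp[OF \<xi>(2)] pt_eq that] .
      then show "\<xi> = \<xi>'"
        by (intro chars_eqI[OF \<xi>]) (auto simp: carrier_Q)
    qed
    show "\<Psi> ` chars ?Q = SS"
    proof
      show "\<Psi> ` chars ?Q \<subseteq> SS"
      proof
        fix C assume "C \<in> \<Psi> ` chars ?Q"
        then obtain \<xi> where \<xi>: "\<xi> \<in> chars ?Q" "C = \<Psi> \<xi>" by blast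
        have "\<xi> (?\<rho> r) = 1" if "r \<in> R" for r
        proof -
          have "r \<in> ?D" using that by (rule generate.incl)
          then have "?\<rho> r = \<one>\<^bsub>?Q\<^esub>"
            using T.coset_join2[OF _ sub] that R by (auto simp: FactGroup_def)
          then show ?thesis using chars_one[OF Q.is_group \<xi>(1)] by simp
        qed
        then show "C \<in> SS" unfolding \<xi>(2) \<Psi>_def by (intro 1 comp[OF \<xi>(1)])
      qed
      show "SS \<subseteq> \<Psi> ` chars ?Q"
      proof
        fix C assume "C \<in> SS"
        from 2[OF this] obtain \<tau> where C: "C \<in> {..<n} \<rightarrow>\<^sub>E chars G" and \<tau>: "\<tau> \<in> hom TT circle_group"
          "\<And>r. r \<in> R \<Longrightarrow> \<tau> r = 1" "\<And>j g. j < n \<Longrightarrow> g \<in> carrier G \<Longrightarrow> \<tau> (pt g (F j)) = C j g"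
          by blast
        interpret t: group_hom TT circle_group \<tau>
          by (intro group_hom.intro group_hom_axioms.intro T.is_group group_circle \<tau>(1))
        have "?D \<subseteq> kernel TT circle_group \<tau>"
          using \<tau>(2) R by (intro T.generate_subgroup_incl t.subgroup_kernel) (auto simp: kernel_def)
        from t.FactGroup_universal_kernel[OF norm this]
        obtain \<xi> where \<xi>: "\<xi> \<in> hom ?Q circle_group" "\<And>t. t \<in> carrier TT \<Longrightarrow> \<xi> (?\<rho> t) = \<tau> t" by metis
        have rc: "restrict \<xi> (carrier ?Q) \<in> chars ?Q"
          using \<xi>(1) Q.m_closed by (auto simp: chars_def hom_def Pi_iff)
        have "C = \<Psi> (restrict \<xi> (carrier ?Q))"
        proof (rule extensionalityI[of _ "{..<n}"])
          fix j assume j: "j \<in> {..<n}"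
          then have Cj: "C j \<in> chars G" using C by auto
          show "C j = \<Psi> (restrict \<xi> (carrier ?Q)) j"
          proof (rule extensionalityI[OF chars_extensional[OF Cj]])
            show "\<Psi> (restrict \<xi> (carrier ?Q)) j \<in> extensional (carrier G)" using j by (simp add: \<Psi>_def)
            fix g assume g: "g \<in> carrier G"
            have p: "pt g (F j) \<in> carrier TT" using g j F by (intro pt_closed) auto
            then have "?\<rho> (pt g (F j)) \<in> carrier ?Q" unfolding carrier_Q by (rule imageI)
            then show "C j g = \<Psi> (restrict \<xi> (carrier ?Q)) j g"
              using \<xi>(2)[OF p] \<tau>(3)[of j g] g j by (simp add: \<Psi>_def)
          qed
        qed (use C in \<open>simp_all add: \<Psi>_def PiE_iff\<close>)
        then show "C \<in> \<Psi> ` chars ?Q" using rc by blast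
      qed
    qed
  qed
  then have "card SS = card (chars ?Q)" by (simp add: bij_betw_same_card)
  then show ?thesis using card_chars[OF Q.comm_group_axioms finQ] by simp
qed

section \<open>Monomials in the generators and extension of bilinear maps\<close>

definition monomial :: "(nat \<Rightarrow> nat) \<Rightarrow> 'a" where
  "monomial m = (\<Otimes>j\<in>{..<n}. F j [^] m j)"

lemma monomial_closed: "monomial m \<in> carrier G"
  unfolding monomial_def using F by (intro finprod_closed) auto

lemma monomial_mult: "monomial m \<otimes> monomial m' = monomial (\<lambda>j. m j + m' j)"
proof -
  have "monomial (\<lambda>j. m j + m' j) = (\<Otimes>j\<in>{..<n}. F j [^] m j \<otimes> F j [^] m' j)"
    unfolding monomial_def using F by (intro finprod_cong') (auto simp: nat_pow_mult)
  also have "\<dots> = monomial m \<otimes> monomial m'"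
    unfolding monomial_def using F by (intro finprod_multf) auto
  finally show ?thesis by simp
qed

lemma monomial_generator:
  assumes "i < n"
  shows "monomial (\<lambda>j. if i = j then 1 else 0) = F i"
proof -
  have "monomial (\<lambda>j. if i = j then 1 else 0) = (\<Otimes>j\<in>{..<n}. if i = j then F j else \<one>)"
    unfolding monomial_def using F by (intro finprod_cong') auto
  also have "\<dots> = F i" using assms F by (intro finprod_singleton) auto
  finally show ?thesis .
qed

lemma monomial_surj:
  assumes "y \<in> carrier G"
  obtains m where "y = monomial m"
proof -
  have "subgroup (range monomial) G"
    using fin monomial_closed monomial_mult by (intro finite_subgroupI) auto
  then have "generate G (F ` {..<n}) \<subseteq> range monomial"
    using monomial_generator[symmetric] by (intro generate_subgroup_incl) auto
  then show thesis using assms gen that by blast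
qed

lemma char_monomial:
  assumes "\<xi> \<in> chars G"
  shows "\<xi> (monomial m) = (\<Prod>j<n. \<xi> (F j) ^ m j)"
  unfolding monomial_def using F by (subst char_finprod[OF assms]) (auto simp: chars_pow[OF is_group assms])

text \<open>The bilinear map \<open>b\<close> with \<open>C j = b (\<cdot>, F j)\<close> is computed from any expression of its second argument as a
  monomial in the generators; the symmetry of \<open>C\<close> makes the result independent of that expression.\<close>

lemma bilinear_extension:
  assumes C: "\<And>j. j < n \<Longrightarrow> C j \<in> chars G"
    and \<sigma>: "\<And>z w. \<sigma> (z * w) = \<sigma> z * \<sigma> w" "\<sigma> 1 = 1"
    and C\<sigma>: "\<And>i j. i < n \<Longrightarrow> j < n \<Longrightarrow> C j (F i) = \<sigma> (C i (F j))"
  obtains \<tau> where "\<tau> \<in> hom TT circle_group" "\<And>j g. j < n \<Longrightarrow> g \<in> carrier G \<Longrightarrow> \<tau> (pt g (F j)) = C j g"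
    "\<And>x y. x \<in> carrier G \<Longrightarrow> y \<in> carrier G \<Longrightarrow> \<tau> (pt x y) = \<sigma> (\<tau> (pt y x))"
proof -
  define cexp where "cexp x m = (\<Prod>j<n. C j x ^ m j)" for x and m :: "nat \<Rightarrow> nat"
  have \<sigma>_pow: "\<sigma> (z ^ k) = \<sigma> z ^ k" for z k by (induction k) (auto simp: \<sigma>)
  have \<sigma>_prod: "\<sigma> (\<Prod>j<k. f j) = (\<Prod>j<k. \<sigma> (f j))" for k and f :: "nat \<Rightarrow> complex"
    by (induction k) (auto simp: \<sigma>)
  have cexp_mult: "cexp (x \<otimes> y) m = cexp x m * cexp y m" if "x \<in> carrier G" "y \<in> carrier G" for x y m
    using that C by (simp add: cexp_def chars_mult power_mult_distrib prod.distrib)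
  have cexp_one: "cexp \<one> m = 1" for m
    using C by (simp add: cexp_def chars_one[OF is_group])
  have wd: "cexp x m = cexp x m'" if eq: "monomial m = monomial m'" and x: "x \<in> carrier G" for x m m'
  proof (rule eq_on_generators[of "\<lambda>x. cexp x m" "\<lambda>x. cexp x m'"])
    fix i assume i: "i < n"
    have "cexp (F i) m = \<sigma> (C i (monomial m))" for m
      using C\<sigma>[OF i] by (simp add: cexp_def char_monomial[OF C[OF i]] \<sigma>_prod \<sigma>_pow)
    then show "cexp (F i) m = cexp (F i) m'" using eq by simp
  qed (use x cexp_mult cexp_one in auto)
  define b where "b x y = cexp x (SOME m. y = monomial m)" for x y
  have b: "b x (monomial m) = cexp x m" if "x \<in> carrier G" for x m
    unfolding b_def by (rule wd[OF someI_ex[of "\<lambda>m'. monomial m = monomial m'", symmetric] that]) blast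
  have b_gen: "b x (F j) = C j x" if "x \<in> carrier G" "j < n" for x j
  proof -
    have "b x (F j) = (\<Prod>i<n. C i x ^ (if j = i then 1 else 0))"
      using b[OF that(1), of "\<lambda>i. if j = i then 1 else 0"] monomial_generator[OF that(2)] by (simp add: cexp_def)
    also have "\<dots> = (\<Prod>i<n. if i = j then C i x else 1)" by (intro prod.cong) auto
    also have "\<dots> = C j x" using that by (simp add: prod.delta)
    finally show ?thesis .
  qed
  have bl: "b (x \<otimes> x') y = b x y * b x' y" if "x \<in> carrier G" "x' \<in> carrier G" for x x' y
    unfolding b_def by (rule cexp_mult[OF that])
  have br: "b x (y \<otimes> y') = b x y * b x y'" if x: "x \<in> carrier G" and y: "y \<in> carrier G" "y' \<in> carrier G" for x y y'
  proof -
    obtain m m' where m: "y = monomial m" "y' = monomial m'" using monomial_surj y by metis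
    show ?thesis
      unfolding m monomial_mult b[OF x] by (simp add: cexp_def power_add prod.distrib)
  qed
  have b1: "cmod (b x y) = 1" if "x \<in> carrier G" for x y
    proof -
    have "cmod (C j x) = 1" if "j < n" for j using chars_norm[OF C[OF that] \<open>x \<in> carrier G\<close>] .
    then show ?thesis by (simp add: b_def cexp_def prod_norm[symmetric] norm_power)
  qed
  obtain \<tau> where \<tau>: "\<tau> \<in> hom TT circle_group" "\<And>x y. x \<in> carrier G \<Longrightarrow> y \<in> carrier G \<Longrightarrow> \<tau> (pt x y) = b x y"
    using tensor_universal[of b] b1 bl br by blast
  \<comment> \<open>The symmetry is extended from pairs of generators one argument at a
    time.\<close>
  have sym1: "\<tau> (pt x (F j)) = \<sigma> (\<tau> (pt (F j) x))" if x: "x \<in> carrier G" and j: "j < n" for x j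
  proof (rule eq_on_generators[of "\<lambda>x. \<tau> (pt x (F j))" "\<lambda>x. \<sigma> (\<tau> (pt (F j) x))"])
    show "\<tau> (pt (F i) (F j)) = \<sigma> (\<tau> (pt (F j) (F i)))" if "i < n" for i
      using that j F C\<sigma>[of i j] \<tau>(2) b_gen by simp
  qed (use x F[OF j] in \<open>simp_all add: tensor_hom_mult[OF \<tau>(1)] tensor_hom_one[OF \<tau>(1)] \<sigma>\<close>)
  have sym2: "\<tau> (pt x y) = \<sigma> (\<tau> (pt y x))" if x: "x \<in> carrier G" and y: "y \<in> carrier G" for x y
  proof (rule eq_on_generators[of "\<lambda>y. \<tau> (pt x y)" "\<lambda>y. \<sigma> (\<tau> (pt y x))"])
    show "\<tau> (pt x (F j)) = \<sigma> (\<tau> (pt (F j) x))" if "j < n" for j by (rule sym1[OF x that])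
  qed (use x y in \<open>simp_all add: tensor_hom_mult[OF \<tau>(1)] tensor_hom_one[OF \<tau>(1)] \<sigma>\<close>)
  show thesis
  proof (rule that[OF \<tau>(1) _ sym2])
    show "\<tau> (pt g (F j)) = C j g" if "j < n" "g \<in> carrier G" for j g
      using \<tau>(2)[OF that(2) F[OF that(1)]] b_gen[OF that(2,1)] by simp
  qed
qed

lemma tensor_hom_family_in_chars:
  assumes "\<tau> \<in> hom TT circle_group" "j < n"
  shows "(\<lambda>g\<in>carrier G. \<tau> (pt g (F j))) \<in> chars G"
  using F[OF assms(2)] by (intro charsI is_group) (simp_all add: tensor_hom_norm[OF assms(1)] tensor_hom_mult[OF assms(1)])

text \<open>The special families are those with C i (F i) = 1 and C j (F i) C i (F j) = 1: the
  values on generators of an alternating bilinear map, that is, of a character of the exterior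
  square.\<close>

lemma card_special_Symmetric:
  "card {C \<in> {..<n} \<rightarrow>\<^sub>E chars G. special Symmetric n (\<lambda>i. (F i, C i))} = order (wedge_square G)"
  unfolding wedge_square_def
proof (rule card_eq_order_quotient)
  let ?R = "{pt g g | g. g \<in> carrier G}"
  show "?R \<subseteq> carrier TT" using pt_closed by blast
  fix \<tau> assume \<tau>: "\<tau> \<in> hom TT circle_group" and R: "\<And>r. r \<in> ?R \<Longrightarrow> \<tau> r = 1"
  have d: "\<tau> (pt g g) = 1" if "g \<in> carrier G" for g using that by (intro R) blast
  have s: "\<tau> (pt g h) * \<tau> (pt h g) = 1" if "g \<in> carrier G" "h \<in> carrier G" for g h
    using d[of "g \<otimes> h"] d[of g] d[of h] that by (simp add: tensor_hom_mult[OF \<tau>] mult.commute)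
  have "special Symmetric n (\<lambda>i. (F i, (\<lambda>j\<in>{..<n}. \<lambda>g\<in>carrier G. \<tau> (pt g (F j))) i))"
    unfolding special_def
  proof
    fix e assume e: "e \<in> free_entries Symmetric n"
    obtain i j where ij: "e = (i, j)" "i < n" "j < n" using e by (auto simp: free_entries_def)
    show "entry_form Symmetric (\<lambda>i. (F i, (\<lambda>j\<in>{..<n}. \<lambda>g\<in>carrier G. \<tau> (pt g (F j))) i)) e = 1"
      using ij F d s by (simp add: entry_form_def form_def pairing_def)
  qed
  then show "(\<lambda>j\<in>{..<n}. \<lambda>g\<in>carrier G. \<tau> (pt g (F j))) \<in> {C \<in> {..<n} \<rightarrow>\<^sub>E chars G. special Symmetric n (\<lambda>i. (F i, C i))}"
    using tensor_hom_family_in_chars[OF \<tau>] by auto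
next
  let ?R = "{pt g g | g. g \<in> carrier G}"
  fix C assume "C \<in> {C \<in> {..<n} \<rightarrow>\<^sub>E chars G. special Symmetric n (\<lambda>i. (F i, C i))}"
  then have C: "C \<in> {..<n} \<rightarrow>\<^sub>E chars G" and sp: "special Symmetric n (\<lambda>i. (F i, C i))" by auto
  have Cc: "C j \<in> chars G" if "j < n" for j using C that by auto
  have diag: "C i (F i) = 1" if "i < n" for i
    using bspec[OF sp[unfolded special_def], of "(i, i)"] that by (simp add: free_entries_def entry_form_def pairing_def)
  have off: "C j (F i) * C i (F j) = 1" if "i < j" "j < n" for i j
    using bspec[OF sp[unfolded special_def], of "(i, j)"] that by (simp add: free_entries_def entry_form_def form_def pairing_def)
  have rel: "C j (F i) = inverse (C i (F j))" if "i < n" "j < n" for i j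
  proof -
    have "C i (F j) * C j (F i) = 1"
    proof (cases i j rule: linorder_cases)
      case less
      then show ?thesis using off[of i j] that by (simp add: mult.commute)
    next
      case equal
      then show ?thesis using diag that by simp
    next
      case greater
      then show ?thesis using off[of j i] that by simp
    qed
    then show ?thesis by (rule inverse_unique[symmetric])
  qed
  obtain \<tau> where \<tau>: "\<tau> \<in> hom TT circle_group" "\<And>j g. j < n \<Longrightarrow> g \<in> carrier G \<Longrightarrow> \<tau> (pt g (F j)) = C j g"
    "\<And>x y. x \<in> carrier G \<Longrightarrow> y \<in> carrier G \<Longrightarrow> \<tau> (pt x y) = inverse (\<tau> (pt y x))"
    using bilinear_extension[of C inverse, OF Cc _ _ rel] by auto
  have cancel: "\<tau> (pt x y) * \<tau> (pt y x) = 1" if "x \<in> carrier G" "y \<in> carrier G" for x y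
    using \<tau>(3)[OF that] tensor_hom_norm[OF \<tau>(1) that] tensor_hom_norm[OF \<tau>(1) that(2,1)]
    by (metis left_inverse norm_zero zero_neq_one)
  \<comment> \<open>Antisymmetry alone leaves a sign in \<tau>(g \<otimes> g), but it makes g ->
    \<tau>(g \<otimes> g) multiplicative, so triviality on the generators suffices.\<close>
  have "\<tau> (pt g g) = 1" if g: "g \<in> carrier G" for g
    by (rule eq_on_generators[of "\<lambda>g. \<tau> (pt g g)" "\<lambda>_. 1"])
       (use g F diag \<tau>(2) cancel in \<open>simp_all add: tensor_hom_mult[OF \<tau>(1)] tensor_hom_one[OF \<tau>(1)]\<close>)
  then show "C \<in> {..<n} \<rightarrow>\<^sub>E chars G \<and> (\<exists>\<tau>\<in>hom TT circle_group. (\<forall>r\<in>?R. \<tau> r = 1) \<and> (\<forall>j<n. \<forall>g\<in>carrier G. \<tau> (pt g (F j)) = C j g))"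
    using C \<tau>(1,2) by blast
qed

text \<open>Here the condition is C j (F i) = C i (F j) for i < j, and none on the diagonal: the
  values of a symmetric bilinear map, so the extension is used with \<sigma> the identity.\<close>

lemma card_special_Alternating:
  "card {C \<in> {..<n} \<rightarrow>\<^sub>E chars G. special Alternating n (\<lambda>i. (F i, C i))} = order (sym_square G)"
  unfolding sym_square_def
proof (rule card_eq_order_quotient)
  let ?R = "{pt g h \<otimes>\<^bsub>TT\<^esub> inv\<^bsub>TT\<^esub> pt h g | g h. g \<in> carrier G \<and> h \<in> carrier G}"
  interpret T: comm_group TT by (rule comm_group_TT)
  show "?R \<subseteq> carrier TT" using pt_closed by blast
  fix \<tau> assume \<tau>: "\<tau> \<in> hom TT circle_group" and R: "\<And>r. r \<in> ?R \<Longrightarrow> \<tau> r = 1"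
  interpret t: group_hom TT circle_group \<tau>
    by (intro group_hom.intro group_hom_axioms.intro T.is_group group_circle \<tau>)
  have s: "\<tau> (pt g h) = \<tau> (pt h g)" if "g \<in> carrier G" "h \<in> carrier G" for g h
  proof -
    let ?x = "pt g h" and ?y = "pt h g"
    have c: "?x \<in> carrier TT" "?y \<in> carrier TT" using that pt_closed by auto
    have "\<tau> (?x \<otimes>\<^bsub>TT\<^esub> inv\<^bsub>TT\<^esub> ?y) = 1" using that by (intro R) blast
    moreover have "?x = (?x \<otimes>\<^bsub>TT\<^esub> inv\<^bsub>TT\<^esub> ?y) \<otimes>\<^bsub>TT\<^esub> ?y" using c by (simp add: T.m_assoc)
    ultimately show ?thesis
      using hom_mult[OF \<tau>, of "?x \<otimes>\<^bsub>TT\<^esub> inv\<^bsub>TT\<^esub> ?y" ?y] c by simp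
  qed
  have "special Alternating n (\<lambda>i. (F i, (\<lambda>j\<in>{..<n}. \<lambda>g\<in>carrier G. \<tau> (pt g (F j))) i))"
    unfolding special_def
  proof
    fix e assume e: "e \<in> free_entries Alternating n"
    obtain i j where ij: "e = (i, j)" "i < n" "j < n" "i \<noteq> j" using e by (auto simp: free_entries_def)
    have "\<tau> (pt (F i) (F j)) * cnj (\<tau> (pt (F j) (F i))) = 1"
      using s[of "F i" "F j"] F ij tensor_hom_norm[OF \<tau>, of "F i" "F j"] by (metis complex_norm_square of_real_1 power_one)
    then show "entry_form Alternating (\<lambda>i. (F i, (\<lambda>j\<in>{..<n}. \<lambda>g\<in>carrier G. \<tau> (pt g (F j))) i)) e = 1"
      using ij F by (simp add: entry_form_def form_def pairing_def)
  qed
  then show "(\<lambda>j\<in>{..<n}. \<lambda>g\<in>carrier G. \<tau> (pt g (F j))) \<in> {C \<in> {..<n} \<rightarrow>\<^sub>E chars G. special Alternating n (\<lambda>i. (F i, C i))}"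
    using tensor_hom_family_in_chars[OF \<tau>] by auto
next
  let ?R = "{pt g h \<otimes>\<^bsub>TT\<^esub> inv\<^bsub>TT\<^esub> pt h g | g h. g \<in> carrier G \<and> h \<in> carrier G}"
  interpret T: comm_group TT by (rule comm_group_TT)
  fix C assume "C \<in> {C \<in> {..<n} \<rightarrow>\<^sub>E chars G. special Alternating n (\<lambda>i. (F i, C i))}"
  then have C: "C \<in> {..<n} \<rightarrow>\<^sub>E chars G" and sp: "special Alternating n (\<lambda>i. (F i, C i))" by auto
  have Cc: "C j \<in> chars G" if "j < n" for j using C that by auto
  have off: "C j (F i) = C i (F j)" if "i < j" "j < n" for i j
  proof -
    have "C j (F i) * cnj (C i (F j)) = 1"
      using bspec[OF sp[unfolded special_def], of "(i, j)"] that by (simp add: free_entries_def entry_form_def form_def pairing_def)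
    moreover have n1: "cmod (C i (F j)) = 1" using chars_norm[OF Cc] F that by simp
    then have "C i (F j) \<noteq> 0" by auto
    ultimately show ?thesis unfolding cnj_eq_inverse[OF n1] by (simp add: field_simps)
  qed
  have rel: "C j (F i) = C i (F j)" if "i < n" "j < n" for i j
    by (cases i j rule: linorder_cases) (use off[of i j] off[of j i] that in auto)
  obtain \<tau> where \<tau>: "\<tau> \<in> hom TT circle_group" "\<And>j g. j < n \<Longrightarrow> g \<in> carrier G \<Longrightarrow> \<tau> (pt g (F j)) = C j g"
    "\<And>x y. x \<in> carrier G \<Longrightarrow> y \<in> carrier G \<Longrightarrow> \<tau> (pt x y) = \<tau> (pt y x)"
    using bilinear_extension[of C "\<lambda>z. z", OF Cc _ _ rel] by auto
  have "\<tau> r = 1" if r: "r \<in> ?R" for r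
  proof -
    obtain g h where gh: "r = pt g h \<otimes>\<^bsub>TT\<^esub> inv\<^bsub>TT\<^esub> pt h g" "g \<in> carrier G" "h \<in> carrier G" using r by blast
    let ?x = "pt g h" and ?y = "pt h g"
    have c: "?x \<in> carrier TT" "?y \<in> carrier TT" using gh pt_closed by auto
    have "?x = r \<otimes>\<^bsub>TT\<^esub> ?y" using c gh(1) by (simp add: T.m_assoc)
    then have "\<tau> ?x = \<tau> r * \<tau> ?y" using hom_mult[OF \<tau>(1), of r ?y] c gh(1) by simp
    moreover have "\<tau> ?y \<noteq> 0" using tensor_hom_norm[OF \<tau>(1) gh(3,2)] by auto
    ultimately show ?thesis using \<tau>(3)[OF gh(2,3)] by simp
  qed
  then show "C \<in> {..<n} \<rightarrow>\<^sub>E chars G \<and> (\<exists>\<tau>\<in>hom TT circle_group. (\<forall>r\<in>?R. \<tau> r = 1) \<and> (\<forall>j<n. \<forall>g\<in>carrier G. \<tau> (pt g (F j)) = C j g))"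
    using C \<tau>(1,2) by blast
qed

text \<open>Every C j takes the value 1 at all the generators F i.\<close>

lemma card_special_General:
  "card {C \<in> {..<n} \<rightarrow>\<^sub>E chars G. special General n (\<lambda>i. (F i, C i))} = 1"
proof -
  have "{C \<in> {..<n} \<rightarrow>\<^sub>E chars G. special General n (\<lambda>i. (F i, C i))} = {\<lambda>j\<in>{..<n}. triv_char G}"
  proof (intro equalityI subsetI)
    fix C assume "C \<in> {C \<in> {..<n} \<rightarrow>\<^sub>E chars G. special General n (\<lambda>i. (F i, C i))}"
    then have C: "C \<in> {..<n} \<rightarrow>\<^sub>E chars G" and sp: "special General n (\<lambda>i. (F i, C i))" by auto
    have "C j = triv_char G" if j: "j < n" for j
    proof -
      have Cj: "C j \<in> chars G" using C j by auto
      have one: "C j (F i) = 1" if "i < n" for i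
        using bspec[OF sp[unfolded special_def], of "(i, j)"] that j
        by (auto simp: free_entries_def entry_form_def form_def pairing_def split: if_splits)
      have "C j x = 1" if x: "x \<in> carrier G" for x
        by (rule eq_on_generators[of "C j" "\<lambda>_. 1"])
           (use x one chars_mult[OF Cj] chars_one[OF is_group Cj] in auto)
      then show ?thesis
        by (intro chars_eqI[OF Cj]) (auto simp: triv_char_def[THEN fun_cong] is_group triv_char_in_chars)
    qed
    then show "C \<in> {\<lambda>j\<in>{..<n}. triv_char G}" using C by (auto simp: fun_eq_iff PiE_iff extensional_def)
  next
    fix C assume "C \<in> {\<lambda>j\<in>{..<n}. triv_char G}"
    then show "C \<in> {C \<in> {..<n} \<rightarrow>\<^sub>E chars G. special General n (\<lambda>i. (F i, C i))}"
      using F is_group by (auto simp: special_def free_entries_def entry_form_def form_def pairing_def triv_char_def[THEN fun_cong] triv_char_in_chars)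
  qed
  then show ?thesis by simp
qed

lemma card_special:
  "card {C \<in> {..<n} \<rightarrow>\<^sub>E chars G. special K n (\<lambda>i. (F i, C i))} =
     (case K of General \<Rightarrow> 1 | Symmetric \<Rightarrow> order (wedge_square G) | Alternating \<Rightarrow> order (sym_square G))"
  using card_special_General card_special_Symmetric card_special_Alternating by (cases K) auto

end

end

section \<open>Surjections from the cokernel\<close>

definition solves :: "('a, 'm) monoid_scheme \<Rightarrow> nat \<Rightarrow> int mat \<Rightarrow> (nat \<Rightarrow> 'a) \<Rightarrow> bool" where
  "solves G n A f \<longleftrightarrow> (\<forall>j<n. (\<Otimes>\<^bsub>G\<^esub>i\<in>{..<n}. f i [^]\<^bsub>G\<^esub> (A $$ (i, j))) = \<one>\<^bsub>G\<^esub>)"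

definition generating :: "('a, 'm) monoid_scheme \<Rightarrow> nat \<Rightarrow> (nat \<Rightarrow> 'a) set" where
  "generating G n = {f \<in> {..<n} \<rightarrow>\<^sub>E carrier G. generate G (f ` {..<n}) = carrier G}"

section \<open>Homomorphisms from the group of integer vectors\<close>

context comm_group
begin

context
  fixes n :: nat
begin

abbreviation "ZZ \<equiv> monoid_vec TYPE(int) n"

lemma ZZ_simps: "carrier ZZ = carrier_vec n" "x \<otimes>\<^bsub>ZZ\<^esub> y = x + y" "\<one>\<^bsub>ZZ\<^esub> = 0\<^sub>v n"
  by (simp_all add: monoid_vec_simps)

definition lin :: "(nat \<Rightarrow> 'a) \<Rightarrow> int vec \<Rightarrow> 'a" where
  "lin f v = (\<Otimes>i\<in>{..<n}. f i [^] (v $ i))"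

lemma lin_closed: "f \<in> {..<n} \<rightarrow> carrier G \<Longrightarrow> lin f v \<in> carrier G"
  unfolding lin_def by (intro finprod_closed) auto

lemma lin_cong: "f \<in> {..<n} \<rightarrow> carrier G \<Longrightarrow> (\<And>i. i < n \<Longrightarrow> f i = g i) \<Longrightarrow> lin f v = lin g v"
  unfolding lin_def by (intro finprod_cong' refl) (auto simp: Pi_iff dest: sym)

lemma lin_add:
  assumes f: "f \<in> {..<n} \<rightarrow> carrier G" and "v \<in> carrier_vec n" "w \<in> carrier_vec n"
  shows "lin f (v + w) = lin f v \<otimes> lin f w"
proof -
  have "lin f (v + w) = (\<Otimes>i\<in>{..<n}. f i [^] (v $ i) \<otimes> f i [^] (w $ i))"
    unfolding lin_def using assms by (intro finprod_cong') (auto simp: int_pow_mult Pi_iff)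
  also have "\<dots> = lin f v \<otimes> lin f w"
    unfolding lin_def using f by (intro finprod_multf) auto
  finally show ?thesis .
qed

lemma lin_hom: "f \<in> {..<n} \<rightarrow> carrier G \<Longrightarrow> lin f \<in> hom ZZ G"
  using lin_closed lin_add by (auto simp: hom_def ZZ_simps)

lemma lin_unit_vec:
  assumes f: "f \<in> {..<n} \<rightarrow> carrier G" and i: "i < n"
  shows "lin f (unit_vec n i) = f i"
proof -
  have "lin f (unit_vec n i) = (\<Otimes>j\<in>{..<n}. if i = j then f j else \<one>)"
    unfolding lin_def using f i by (intro finprod_cong') (auto simp: unit_vec_def Pi_iff int_pow_1)
  also have "\<dots> = f i" using f i by (intro finprod_singleton) auto
  finally show ?thesis .
qed

lemma group_ZZ: "group ZZ" "comm_group ZZ"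
  using comm_group_vec[of n, where 'a = int] by (auto simp: comm_group.axioms)

lemma hom_smult_unit_vec:
  assumes h: "h \<in> hom ZZ G" and i: "i < n"
  shows "h (k \<cdot>\<^sub>v unit_vec n i) = h (unit_vec n i) [^] (k::int)"
proof -
  let ?e = "unit_vec n i :: int vec"
  have hc: "h ?e \<in> carrier G" using hom_in_carrier[OF h] by (simp add: ZZ_simps)
  have step: "h ((k + 1) \<cdot>\<^sub>v ?e) = h (k \<cdot>\<^sub>v ?e) \<otimes> h ?e" for k
  proof -
    have "(k + 1) \<cdot>\<^sub>v ?e = k \<cdot>\<^sub>v ?e + ?e" by (simp add: add_smult_distrib_vec)
    then show ?thesis using hom_mult[OF h, of "k \<cdot>\<^sub>v ?e" ?e] by (simp add: ZZ_simps)
  qed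
  have c: "h (k \<cdot>\<^sub>v ?e) \<in> carrier G" for k using hom_in_carrier[OF h] by (simp add: ZZ_simps)
  show ?thesis
  proof (induction k rule: int_induct[where k = 0])
    case base
    have "h (0\<^sub>v n) = \<one>" using hom_one[OF h group_ZZ(1) is_group] by (simp add: ZZ_simps)
    moreover have "0 \<cdot>\<^sub>v ?e = 0\<^sub>v n" by auto
    ultimately show ?case using hc by simp
  next
    case (step1 k)
    then show ?case using step[of k] hc by (simp add: int_pow_mult int_pow_1)
  next
    case (step2 k)
    have "h (unit_vec n i) [^] k = h ((k - 1) \<cdot>\<^sub>v ?e) \<otimes> h ?e" using step[of "k - 1"] step2 by simp
    moreover have "h (unit_vec n i) [^] k = h (unit_vec n i) [^] (k - 1) \<otimes> h ?e"
      using hc int_pow_mult[OF hc, of "k - 1" 1] by (simp add: int_pow_1)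
    ultimately show ?case using c hc by simp
  qed
qed

lemma hom_eq_lin:
  assumes h: "h \<in> hom ZZ G" and v: "v \<in> carrier_vec n"
  shows "h v = lin (\<lambda>i. h (unit_vec n i)) v"
proof -
  have hc: "h (unit_vec n i) \<in> carrier G" for i using hom_in_carrier[OF h] by (simp add: ZZ_simps)
  \<comment> \<open>Induction on the number of coordinates kept, the others being set to 0.\<close>
  have "k \<le> n \<Longrightarrow> h (vec n (\<lambda>i. if i < k then v $ i else 0)) = (\<Otimes>i\<in>{..<k}. h (unit_vec n i) [^] (v $ i))" for k
  proof (induction k)
    case 0
    have "vec n (\<lambda>i. if i < 0 then v $ i else 0) = \<one>\<^bsub>ZZ\<^esub>" by (auto simp: ZZ_simps)
    then show ?case using hom_one[OF h group_ZZ(1) is_group] by (metis finprod_empty lessThan_0)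
  next
    case (Suc k)
    let ?w = "\<lambda>k. vec n (\<lambda>i. if i < k then v $ i else 0)"
    have "?w (Suc k) = ?w k + v $ k \<cdot>\<^sub>v unit_vec n k"
      using Suc.prems by (intro eq_vecI) (auto simp: unit_vec_def less_Suc_eq)
    then have "h (?w (Suc k)) = h (?w k) \<otimes> h (v $ k \<cdot>\<^sub>v unit_vec n k)"
      using hom_mult[OF h, of "?w k" "v $ k \<cdot>\<^sub>v unit_vec n k"] by (simp add: ZZ_simps)
    also have "\<dots> = (\<Otimes>i\<in>{..<k}. h (unit_vec n i) [^] (v $ i)) \<otimes> h (unit_vec n k) [^] (v $ k)"
      using Suc hom_smult_unit_vec[OF h] by simp
    also have "\<dots> = (\<Otimes>i\<in>{..<Suc k}. h (unit_vec n i) [^] (v $ i))"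
      using hc by (simp add: lessThan_Suc finprod_insert finprod_closed m_comm)
    finally show ?case .
  qed
  from this[of n] have "h (vec n (\<lambda>i. if i < n then v $ i else 0)) = lin (\<lambda>i. h (unit_vec n i)) v"
    by (simp add: lin_def)
  moreover have "vec n (\<lambda>i. if i < n then v $ i else 0) = v" using v by auto
  ultimately show ?thesis by simp
qed

lemma image_lin:
  assumes f: "f \<in> {..<n} \<rightarrow> carrier G"
  shows "lin f ` carrier_vec n = generate G (f ` {..<n})"
proof
  have sub: "f ` {..<n} \<subseteq> carrier G" using f by auto
  interpret P: subgroup "generate G (f ` {..<n})" G by (rule generate_is_subgroup[OF sub])
  show "lin f ` carrier_vec n \<subseteq> generate G (f ` {..<n})"
  proof
    fix y assume "y \<in> lin f ` carrier_vec n"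
    then obtain v where y: "y = lin f v" by blast
    have "(\<Otimes>i\<in>{..<k}. f i [^] (v $ i)) \<in> generate G (f ` {..<n})" if "k \<le> n" for k
      using that
    proof (induction k)
      case 0
      then show ?case by simp
    next
      case (Suc k)
      have "f k [^] (v $ k) \<in> generate G (f ` {..<n})"
        using Suc.prems by (intro subgroup_int_pow_closed[OF P.subgroup_axioms] generate.incl) auto
      moreover have "(\<Otimes>i\<in>{..<Suc k}. f i [^] (v $ i)) = f k [^] (v $ k) \<otimes> (\<Otimes>i\<in>{..<k}. f i [^] (v $ i))"
        unfolding lessThan_Suc using f Suc.prems by (intro finprod_insert) (auto simp: Pi_iff)
      ultimately show ?case using Suc P.m_closed by simp
    qed
    then show "y \<in> generate G (f ` {..<n})" by (simp add: y lin_def)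
  qed
  interpret l: group_hom ZZ G "lin f"
    by (intro group_hom.intro group_hom_axioms.intro group_ZZ is_group lin_hom f)
  have "subgroup (lin f ` carrier ZZ) G" by (rule l.img_is_subgroup)
  then show "generate G (f ` {..<n}) \<subseteq> lin f ` carrier_vec n"
  proof (intro generate_subgroup_incl)
    show "f ` {..<n} \<subseteq> lin f ` carrier_vec n"
    proof
      fix y assume "y \<in> f ` {..<n}"
      then obtain i where "i < n" "y = f i" by auto
      then show "y \<in> lin f ` carrier_vec n"
        using lin_unit_vec[OF f, of i] by (intro image_eqI[of _ _ "unit_vec n i"]) simp_all
    qed
  qed (simp add: ZZ_simps)
qed

section \<open>The cokernel of a fixed matrix\<close>

context
  fixes A :: "int mat"
  assumes A: "A \<in> carrier_mat n n"
begin

abbreviation "HH \<equiv> (\<lambda>v. A *\<^sub>v v) ` carrier_vec n"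

lemma mult_mat_hom: "(\<lambda>v. A *\<^sub>v v) \<in> hom ZZ ZZ"
  using A by (auto simp: hom_def ZZ_simps mult_add_distrib_mat_vec)

lemma subgroup_HH: "subgroup HH ZZ"
proof -
  interpret m: group_hom ZZ ZZ "\<lambda>v. A *\<^sub>v v"
    by (intro group_hom.intro group_hom_axioms.intro group_ZZ mult_mat_hom)
  show ?thesis using m.img_is_subgroup by (simp add: ZZ_simps)
qed

text \<open>A homomorphism kills the image of A as soon as it kills the images of the unit vectors,
  which are the columns of A.\<close>

lemma lin_kills_HH:
  assumes f: "f \<in> {..<n} \<rightarrow> carrier G"
  shows "(\<forall>v\<in>HH. lin f v = \<one>) \<longleftrightarrow> solves G n A f"
proof -
  have col: "lin f (A *\<^sub>v unit_vec n j) = (\<Otimes>i\<in>{..<n}. f i [^] (A $$ (i, j)))" if j: "j < n" for j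
    unfolding lin_def using A j f by (intro finprod_cong') (auto simp: Pi_iff)
  have h: "(\<lambda>v. lin f (A *\<^sub>v v)) \<in> hom ZZ G"
    using mult_mat_hom lin_hom[OF f] by (auto simp: hom_def Pi_iff)
  have "lin f (A *\<^sub>v v) = \<one>" if v: "v \<in> carrier_vec n" and s: "solves G n A f" for v
  proof -
    have "lin f (A *\<^sub>v v) = lin (\<lambda>i. lin f (A *\<^sub>v unit_vec n i)) v"
      by (rule hom_eq_lin[OF h v])
    also have "\<dots> = (\<Otimes>i\<in>{..<n}. \<one>)"
      unfolding lin_def[of _ v] using s col by (intro finprod_cong') (auto simp: solves_def)
    also have "\<dots> = \<one>" by (rule finprod_one_eqI) simp
    finally show ?thesis .
  qed
  moreover have "solves G n A f" if "\<forall>v\<in>HH. lin f v = \<one>"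
    unfolding solves_def using that col by (metis image_eqI unit_vec_carrier)
  ultimately show ?thesis by blast
qed

text \<open>A surjection corresponds to the images of the classes of the unit vectors, which
  generate G by surjectivity; the inverse factors \<open>lin f\<close> through the cokernel.\<close>

lemma card_Sur_cok: "card (Sur (cok n A) G) = card {f \<in> generating G n. solves G n A f}"
proof -
  interpret Z: comm_group ZZ by (rule group_ZZ)
  let ?C = "cok n A"
  let ?\<rho> = "\<lambda>v. HH #>\<^bsub>ZZ\<^esub> v"
  have C: "?C = ZZ Mod HH" by (simp add: cok_def)
  have norm: "HH \<lhd> ZZ" by (rule Z.subgroup_imp_normal[OF subgroup_HH])
  have carrier_C: "carrier ?C = ?\<rho> ` carrier_vec n" by (simp add: C carrier_FactGroup ZZ_simps)
  have \<rho>: "?\<rho> \<in> hom ZZ ?C" unfolding C by (rule normal.r_coset_hom_Mod[OF norm])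
  interpret C: comm_group ?C unfolding C by (rule Z.abelian_FactGroup[OF subgroup_HH])
  define \<Phi> where "\<Phi> \<phi> = (\<lambda>i\<in>{..<n}. \<phi> (?\<rho> (unit_vec n i)))" for \<phi> :: "_ \<Rightarrow> 'a"
  have \<Phi>_lin: "\<phi> (?\<rho> v) = lin (\<Phi> \<phi>) v" and \<Phi>_closed: "\<Phi> \<phi> \<in> {..<n} \<rightarrow> carrier G"
    if \<phi>: "\<phi> \<in> hom ?C G" and v: "v \<in> carrier_vec n" for \<phi> v
  proof -
    have h: "(\<lambda>v. \<phi> (?\<rho> v)) \<in> hom ZZ G" using \<phi> \<rho> by (auto simp: hom_def Pi_iff)
    have c: "(\<lambda>i. \<phi> (?\<rho> (unit_vec n i))) \<in> {..<n} \<rightarrow> carrier G"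
      using hom_in_carrier[OF h] by (auto simp: ZZ_simps)
    show "\<Phi> \<phi> \<in> {..<n} \<rightarrow> carrier G" using c by (auto simp: \<Phi>_def)
    have "\<phi> (?\<rho> v) = lin (\<lambda>i. \<phi> (?\<rho> (unit_vec n i))) v" by (rule hom_eq_lin[OF h v])
    also have "\<dots> = lin (\<Phi> \<phi>) v" by (rule lin_cong[OF c]) (simp add: \<Phi>_def)
    finally show "\<phi> (?\<rho> v) = lin (\<Phi> \<phi>) v" .
  qed
  have "bij_betw \<Phi> (Sur ?C G) {f \<in> generating G n. solves G n A f}"
    unfolding bij_betw_def
  proof
    show "inj_on \<Phi> (Sur ?C G)"
    proof (rule inj_onI)
      fix \<phi> \<phi>' assume \<phi>: "\<phi> \<in> Sur ?C G" "\<phi>' \<in> Sur ?C G" and eq: "\<Phi> \<phi> = \<Phi> \<phi>'"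
      then have h: "\<phi> \<in> hom ?C G" "\<phi>' \<in> hom ?C G" by (auto simp: Sur_def epi_def)
      show "\<phi> = \<phi>'"
      proof (rule extensionalityI[of _ "carrier ?C"])
        fix x assume "x \<in> carrier ?C"
        then obtain v where v: "v \<in> carrier_vec n" "x = ?\<rho> v" unfolding carrier_C by blast
        show "\<phi> x = \<phi>' x" unfolding v(2) \<Phi>_lin[OF h(1) v(1)] \<Phi>_lin[OF h(2) v(1)] eq ..
      qed (use \<phi> in \<open>simp_all add: Sur_def\<close>)
    qed
    show "\<Phi> ` Sur ?C G = {f \<in> generating G n. solves G n A f}"
    proof (intro equalityI subsetI)
      fix f assume "f \<in> \<Phi> ` Sur ?C G"
      then obtain \<phi> where f: "f = \<Phi> \<phi>" and \<phi>: "\<phi> \<in> hom ?C G" "\<phi> ` carrier ?C = carrier G"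
        by (auto simp: Sur_def epi_def)
      have fc: "f \<in> {..<n} \<rightarrow> carrier G" unfolding f using \<Phi>_closed[OF \<phi>(1) zero_carrier_vec] .
      have "generate G (f ` {..<n}) = lin f ` carrier_vec n" using image_lin[OF fc] ..
      also have "\<dots> = (\<lambda>v. \<phi> (?\<rho> v)) ` carrier_vec n"
        using \<Phi>_lin[OF \<phi>(1)] by (auto simp: f)
      also have "\<dots> = carrier G" using \<phi>(2) unfolding carrier_C by (simp add: image_image)
      finally have gen: "generate G (f ` {..<n}) = carrier G" .
      have "lin f v = \<one>" if v: "v \<in> HH" for v
      proof -
        have vc: "v \<in> carrier_vec n" using v A by auto
        have "?\<rho> v = \<one>\<^bsub>?C\<^esub>"
          using Z.coset_join2[OF _ subgroup_HH v] vc by (simp add: C FactGroup_def ZZ_simps)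
        then show ?thesis
          using \<Phi>_lin[OF \<phi>(1) vc] hom_one[OF \<phi>(1) C.is_group is_group] by (simp add: f)
      qed
      then have "solves G n A f" using lin_kills_HH[OF fc] by blast
      moreover have "f \<in> {..<n} \<rightarrow>\<^sub>E carrier G" using fc by (auto simp: f \<Phi>_def PiE_def)
      ultimately show "f \<in> {f \<in> generating G n. solves G n A f}" using gen by (simp add: generating_def)
    next
      fix f assume "f \<in> {f \<in> generating G n. solves G n A f}"
      then have f: "f \<in> {..<n} \<rightarrow>\<^sub>E carrier G" "generate G (f ` {..<n}) = carrier G" "solves G n A f"
        by (auto simp: generating_def)
      have fc: "f \<in> {..<n} \<rightarrow> carrier G" using f(1) by auto
      interpret l: group_hom ZZ G "lin f"
        by (intro group_hom.intro group_hom_axioms.intro group_ZZ is_group lin_hom fc)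
      have "HH \<subseteq> kernel ZZ G (lin f)"
        using lin_kills_HH[OF fc] f(3) A by (auto simp: kernel_def ZZ_simps)
      from l.FactGroup_universal_kernel[OF norm this]
      obtain \<phi> where \<phi>: "\<phi> \<in> hom ?C G" "\<And>v. v \<in> carrier_vec n \<Longrightarrow> \<phi> (?\<rho> v) = lin f v"
        unfolding C ZZ_simps by metis
      define \<phi>' where "\<phi>' = restrict \<phi> (carrier ?C)"
      have \<phi>'_hom: "\<phi>' \<in> hom ?C G" using \<phi>(1) C.m_closed by (auto simp: \<phi>'_def hom_def Pi_iff)
      have eq: "\<phi>' (?\<rho> v) = lin f v" if "v \<in> carrier_vec n" for v
        using \<phi>(2)[OF that] that by (auto simp: \<phi>'_def carrier_C)
      have "\<phi>' ` carrier ?C = lin f ` carrier_vec n"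
        unfolding carrier_C image_image using eq by (intro image_cong) auto
      then have "\<phi>' \<in> Sur ?C G"
        using \<phi>'_hom image_lin[OF fc] f(2) by (simp add: Sur_def epi_def \<phi>'_def)
      moreover have "f = \<Phi> \<phi>'"
      proof (rule extensionalityI[of _ "{..<n}"])
        fix i assume "i \<in> {..<n}"
        then show "f i = \<Phi> \<phi>' i" using eq[of "unit_vec n i"] lin_unit_vec[OF fc] by (simp add: \<Phi>_def)
      qed (use f(1) in \<open>simp_all add: \<Phi>_def PiE_iff\<close>)
      ultimately show "f \<in> \<Phi> ` Sur ?C G" by blast
    qed
  qed
  then show ?thesis by (rule bij_betw_same_card)
qed

end

end

end

section \<open>Independence of the integer entries\<close>

definition centered :: "int \<Rightarrow> int \<Rightarrow> int" where
  "centered p r = (if 2 * r < p then r else r - p)"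

lemma centered_mod:
  assumes "2 * \<bar>x\<bar> < p"
  shows "centered p (x mod p) = x"
proof (cases "x \<ge> 0")
  case True
  then have "x mod p = x" using assms by (intro mod_pos_pos_trivial) auto
  then show ?thesis using assms True by (simp add: centered_def)
next
  case False
  have "x mod p = (x + p) mod p" by simp
  also have "\<dots> = x + p" using assms False by (intro mod_pos_pos_trivial) auto
  finally show ?thesis using assms False by (simp add: centered_def)
qed

lemma exists_prime_sequence: "\<exists>p :: nat \<Rightarrow> int. \<forall>k. prime (p k) \<and> p k > int k"
proof -
  have "\<exists>q :: int. prime q \<and> q > int k" for k
  proof -
    obtain q :: nat where "prime q" "q > k" using bigger_prime by blast
    then show ?thesis by (intro exI[of _ "int q"]) auto
  qed
  then show ?thesis by metis
qed

text \<open>Independence modulo every prime gives independence over the integers: the centred residue of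
  \<open>X\<close> modulo \<open>p\<close> equals \<open>X\<close> as soon as \<open>p > 2 * \<bar>X\<bar>\<close>, and dominated convergence applies.\<close>

lemma (in prob_space) integral_prod_of_indep_mod_primes:
  fixes X :: "'i \<Rightarrow> 'a \<Rightarrow> int" and h :: "'i \<Rightarrow> int \<Rightarrow> complex"
  assumes fin: "finite E" and X: "\<And>e. e \<in> E \<Longrightarrow> X e \<in> measurable M (count_space UNIV)"
    and indep: "\<And>p::int. prime p \<Longrightarrow> indep_vars (\<lambda>_. count_space (carrier (residue_ring p))) (B p) E"
    and B: "\<And>p e \<omega>. prime p \<Longrightarrow> e \<in> E \<Longrightarrow> \<omega> \<in> space M \<Longrightarrow> B p e \<omega> = X e \<omega> mod p"
    and h: "\<And>e x. e \<in> E \<Longrightarrow> cmod (h e x) \<le> 1"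
  shows "(\<integral>\<omega>. (\<Prod>e\<in>E. h e (X e \<omega>)) \<partial>M) = (\<Prod>e\<in>E. \<integral>\<omega>. h e (X e \<omega>) \<partial>M)"
proof -
  obtain p :: "nat \<Rightarrow> int" where p: "\<And>k. prime (p k)" "\<And>k. p k > int k"
    using exists_prime_sequence by blast
  define Y where "Y k e \<omega> = h e (centered (p k) (X e \<omega> mod p k))" for k e \<omega>
  have meas: "(\<lambda>\<omega>. g (X e \<omega>)) \<in> borel_measurable M" if "e \<in> E" for e and g :: "int \<Rightarrow> complex"
    by (rule measurable_compose[OF X[OF that]]) simp
  have Ymeas: "Y k e \<in> borel_measurable M" if "e \<in> E" for k e
    unfolding Y_def[abs_def] by (rule meas[OF that])
  have Y1: "cmod (Y k e \<omega>) \<le> 1" if "e \<in> E" for k e \<omega>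
    unfolding Y_def by (rule h[OF that])
  have Ylim: "(\<lambda>k. Y k e \<omega>) \<longlonglongrightarrow> h e (X e \<omega>)" for e \<omega>
  proof (rule tendsto_eventually)
    show "eventually (\<lambda>k. Y k e \<omega> = h e (X e \<omega>)) sequentially"
      using eventually_ge_at_top[of "nat (2 * \<bar>X e \<omega>\<bar>)"]
    proof eventually_elim
      case (elim k)
      then have "2 * \<bar>X e \<omega>\<bar> < p k" using p(2)[of k] by linarith
      then show ?case by (simp add: Y_def centered_mod)
    qed
  qed
  have prodeq: "(\<integral>\<omega>. (\<Prod>e\<in>E. Y k e \<omega>) \<partial>M) = (\<Prod>e\<in>E. \<integral>\<omega>. Y k e \<omega> \<partial>M)" for k
  proof -
    have ind: "indep_vars (\<lambda>_. borel) (\<lambda>e \<omega>. h e (centered (p k) (B (p k) e \<omega>))) E"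
      by (rule indep_vars_compose2[OF indep[OF p(1)]]) simp
    have eq: "h e (centered (p k) (B (p k) e \<omega>)) = Y k e \<omega>" if "e \<in> E" "\<omega> \<in> space M" for e \<omega>
      using B[OF p(1) that] by (simp add: Y_def)
    have int: "integrable M (\<lambda>\<omega>. h e (centered (p k) (B (p k) e \<omega>)))" if "e \<in> E" for e
    proof (rule integrable_const_bound[of _ 1])
      show "(\<lambda>\<omega>. h e (centered (p k) (B (p k) e \<omega>))) \<in> borel_measurable M"
        using Ymeas[OF that, of k] eq[OF that] by (subst measurable_cong[of _ _ "Y k e"]) auto
    qed (use h[OF that] in auto)
    have "(\<integral>\<omega>. (\<Prod>e\<in>E. Y k e \<omega>) \<partial>M) = (\<integral>\<omega>. (\<Prod>e\<in>E. h e (centered (p k) (B (p k) e \<omega>))) \<partial>M)"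
      by (intro Bochner_Integration.integral_cong prod.cong) (auto simp: eq)
    also have "\<dots> = (\<Prod>e\<in>E. \<integral>\<omega>. h e (centered (p k) (B (p k) e \<omega>)) \<partial>M)"
      by (rule indep_vars_lebesgue_integral[OF fin ind int])
    also have "\<dots> = (\<Prod>e\<in>E. \<integral>\<omega>. Y k e \<omega> \<partial>M)"
      by (intro prod.cong Bochner_Integration.integral_cong) (auto simp: eq)
    finally show ?thesis .
  qed
  have lim1: "(\<lambda>k. \<integral>\<omega>. (\<Prod>e\<in>E. Y k e \<omega>) \<partial>M) \<longlonglongrightarrow> (\<integral>\<omega>. (\<Prod>e\<in>E. h e (X e \<omega>)) \<partial>M)"
  proof (rule integral_dominated_convergence[where w = "\<lambda>_. 1"])
    show "(\<lambda>\<omega>. \<Prod>e\<in>E. h e (X e \<omega>)) \<in> borel_measurable M"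
      by (intro borel_measurable_prod meas)
    show "(\<lambda>\<omega>. \<Prod>e\<in>E. Y k e \<omega>) \<in> borel_measurable M" for k
      by (intro borel_measurable_prod Ymeas)
    show "AE \<omega> in M. (\<lambda>k. \<Prod>e\<in>E. Y k e \<omega>) \<longlonglongrightarrow> (\<Prod>e\<in>E. h e (X e \<omega>))"
      by (intro AE_I2 tendsto_prod Ylim)
    show "AE \<omega> in M. cmod (\<Prod>e\<in>E. Y k e \<omega>) \<le> 1" for k
      using Y1 by (intro AE_I2) (auto simp: prod_norm[symmetric] intro!: prod_le_1)
  qed simp
  have lim2: "(\<lambda>k. \<Prod>e\<in>E. \<integral>\<omega>. Y k e \<omega> \<partial>M) \<longlonglongrightarrow> (\<Prod>e\<in>E. \<integral>\<omega>. h e (X e \<omega>) \<partial>M)"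
  proof (rule tendsto_prod)
    fix e assume e: "e \<in> E"
    show "(\<lambda>k. \<integral>\<omega>. Y k e \<omega> \<partial>M) \<longlonglongrightarrow> (\<integral>\<omega>. h e (X e \<omega>) \<partial>M)"
      by (rule integral_dominated_convergence[where w = "\<lambda>_. 1"])
         (use meas[OF e] Ymeas[OF e] Ylim Y1[OF e] in auto)
  qed
  show ?thesis
    using LIMSEQ_unique[OF lim1] lim2 unfolding prodeq by blast
qed

section \<open>The law of one entry modulo a\<close>

definition residue_law :: "'w measure \<Rightarrow> nat \<Rightarrow> ('w \<Rightarrow> int) \<Rightarrow> nat \<Rightarrow> real" where
  "residue_law M a X r = measure M {\<omega> \<in> space M. X \<omega> mod int a = int r}"

context prob_space
begin

context
  fixes X :: "'a \<Rightarrow> int" and a :: nat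
  assumes X: "X \<in> measurable M (count_space UNIV)" and a: "a > 0"
begin

lemma sets_X: "{\<omega> \<in> space M. P (X \<omega>)} \<in> sets M"
  using measurable_sets[OF X, of "Collect P"] by (simp add: vimage_def Int_def conj_commute)

lemma sum_residue_law:
  assumes "R \<subseteq> {..<a}"
  shows "(\<Sum>r\<in>R. residue_law M a X r) = measure M {\<omega> \<in> space M. nat (X \<omega> mod int a) \<in> R}"
proof -
  have finR: "finite R" using assms finite_subset by blast
  have "(\<Sum>r\<in>R. residue_law M a X r) = measure M (\<Union>r\<in>R. {\<omega> \<in> space M. X \<omega> mod int a = int r})"
    unfolding residue_law_def
  proof (rule finite_measure_finite_Union[symmetric, OF finR])
    show "(\<lambda>r. {\<omega> \<in> space M. X \<omega> mod int a = int r}) ` R \<subseteq> sets M"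
      by (rule image_subsetI) (rule sets_X[of "\<lambda>x. x mod int a = int _"])
    show "disjoint_family_on (\<lambda>r. {\<omega> \<in> space M. X \<omega> mod int a = int r}) R"
      by (auto simp: disjoint_family_on_def)
  qed
  also have "(\<Union>r\<in>R. {\<omega> \<in> space M. X \<omega> mod int a = int r}) = {\<omega> \<in> space M. nat (X \<omega> mod int a) \<in> R}"
  proof (intro equalityI subsetI)
    fix \<omega> assume "\<omega> \<in> {\<omega> \<in> space M. nat (X \<omega> mod int a) \<in> R}"
    then show "\<omega> \<in> (\<Union>r\<in>R. {\<omega> \<in> space M. X \<omega> mod int a = int r})"
      using a by (auto intro!: bexI[of _ "nat (X \<omega> mod int a)"])
  qed auto
  finally show ?thesis .
qed

text \<open>As q divides a, reduction modulo q factors through reduction modulo a, and the residues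
  modulo a in the sum make up one class modulo q.\<close>

lemma balanced_residue_law:
  assumes "\<And>q r. prime q \<Longrightarrow> q dvd a \<Longrightarrow> r < q \<Longrightarrow> measure M {\<omega> \<in> space M. X \<omega> mod int q = int r} \<le> 1 - \<alpha>"
    and "\<alpha> \<le> 1"
  shows "balanced_law a \<alpha> (residue_law M a X)"
  unfolding balanced_law_def
proof (intro conjI allI impI)
  show "0 \<le> residue_law M a X r" for r by (simp add: residue_law_def)
  have "{\<omega> \<in> space M. nat (X \<omega> mod int a) \<in> {..<a}} = space M"
    using a by (auto simp: nat_less_iff)
  then show "(\<Sum>r<a. residue_law M a X r) = 1"
    using sum_residue_law[of "{..<a}"] prob_space by simp
  fix q t :: nat assume q: "prime q" "q dvd a"
  show "(\<Sum>r | r < a \<and> r mod q = t. residue_law M a X r) \<le> 1 - \<alpha>"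
  proof (cases "t < q")
    case False
    have "q > 0" using q prime_gt_0_nat by blast
    then have "{r. r < a \<and> r mod q = t} = {}" using False by auto
    then have "(\<Sum>r | r < a \<and> r mod q = t. residue_law M a X r) = 0" by (simp only: sum.empty)
    then show ?thesis using assms(2) by simp
  next
    case True
    have "nat (x mod int a) mod q = nat (x mod int q)" for x :: int
    proof -
      have "int (nat (x mod int a) mod q) = (x mod int a) mod int q" using a by (simp add: zmod_int)
      also have "\<dots> = x mod int q" using q(2) by (intro mod_mod_cancel) auto
      finally show ?thesis by (metis nat_int)
    qed
    then have "{\<omega> \<in> space M. nat (X \<omega> mod int a) \<in> {r. r < a \<and> r mod q = t}} = {\<omega> \<in> space M. X \<omega> mod int q = int t}"
      using a True q prime_gt_0_nat[OF q(1)] by (auto simp: nat_less_iff)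
    moreover have "{r. r < a \<and> r mod q = t} \<subseteq> {..<a}" by auto
    ultimately show ?thesis
      using sum_residue_law[of "{r. r < a \<and> r mod q = t}"] assms(1)[OF q True] by simp
  qed
qed

lemma integral_power_residue:
  "(\<integral>\<omega>. z ^ nat (X \<omega> mod int a) \<partial>M) = char_fun a (residue_law M a X) z"
proof -
  have ind: "integrable M (\<lambda>\<omega>. indicator {\<omega> \<in> space M. X \<omega> mod int a = int r} \<omega> *\<^sub>R z ^ r)" for r
    using sets_X[of "\<lambda>x. x mod int a = int r"] by (intro integrable_scaleR_left integrable_real_indicator) (auto simp: emeasure_eq_measure)
  have "(\<integral>\<omega>. z ^ nat (X \<omega> mod int a) \<partial>M) = (\<integral>\<omega>. (\<Sum>r<a. indicator {\<omega> \<in> space M. X \<omega> mod int a = int r} \<omega> *\<^sub>R z ^ r) \<partial>M)"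
  proof (rule Bochner_Integration.integral_cong)
    fix \<omega> assume w: "\<omega> \<in> space M"
    let ?s = "nat (X \<omega> mod int a)"
    have s: "?s < a" "X \<omega> mod int a = int ?s" using a by (auto simp: nat_less_iff)
    have "(\<Sum>r<a. indicator {\<omega> \<in> space M. X \<omega> mod int a = int r} \<omega> *\<^sub>R z ^ r) = (\<Sum>r<a. if r = ?s then z ^ r else 0)"
      using w s(2) by (intro sum.cong) (auto simp: indicator_def)
    then show "z ^ ?s = (\<Sum>r<a. indicator {\<omega> \<in> space M. X \<omega> mod int a = int r} \<omega> *\<^sub>R z ^ r)"
      using s(1) by simp
  qed simp
  also have "\<dots> = (\<Sum>r<a. \<integral>\<omega>. indicator {\<omega> \<in> space M. X \<omega> mod int a = int r} \<omega> *\<^sub>R z ^ r \<partial>M)"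
    by (rule Bochner_Integration.integral_sum) (rule ind)
  also have "\<dots> = (\<Sum>r<a. of_real (residue_law M a X r) * z ^ r)"
  proof (rule sum.cong)
    fix r
    show "(\<integral>\<omega>. indicator {\<omega> \<in> space M. X \<omega> mod int a = int r} \<omega> *\<^sub>R z ^ r \<partial>M) = of_real (residue_law M a X r) * z ^ r"
      using sets_X[of "\<lambda>x. x mod int a = int r"]
      by (subst integral_scaleR_left) (auto simp: residue_law_def scaleR_conv_of_real emeasure_eq_measure Int_absorb1)
  qed simp
  finally show ?thesis by (simp add: char_fun_def)
qed

end

end

section \<open>Fourier expansion of the expected number of surjections\<close>

lemma chars_int_pow:
  assumes "group G" "\<xi> \<in> chars G" "x \<in> carrier G"
  shows "\<xi> (x [^]\<^bsub>G\<^esub> (k::int)) = \<xi> x powi k"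
proof -
  interpret group G by fact
  show ?thesis
  proof (cases "k \<ge> 0")
    case True
    then have "k = int (nat k)" by simp
    then show ?thesis
      using chars_pow[OF assms] by (metis int_pow_int power_int_of_nat)
  next
    case False
    define m where "m = nat (- k)"
    have k: "k = - int m" using False by (simp add: m_def)
    have "\<xi> (x [^]\<^bsub>G\<^esub> k) = inverse (\<xi> (x [^]\<^bsub>G\<^esub> m))"
      unfolding k using chars_inv[OF assms(1,2)] assms(3) by (simp add: int_pow_neg_int)
    also have "\<dots> = \<xi> x powi k"
      unfolding k chars_pow[OF assms] by (simp add: power_int_minus)
    finally show ?thesis .
  qed
qed

text \<open>Reducing the exponent modulo a replaces an unbounded integer power by one of at most a
  values, so that its expectation is a value of \<open>char_fun\<close>.\<close>

lemma powi_eq_power_mod: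
  fixes z :: complex
  assumes "z ^ a = 1" "a > 0"
  shows "z powi k = z ^ nat (k mod int a)"
proof -
  have z0: "z \<noteq> 0" using assms by (metis power_0_left zero_neq_one less_irrefl)
  have "z powi k = z powi (int a * (k div int a) + k mod int a)" by simp
  also have "\<dots> = z powi (int a * (k div int a)) * z powi (k mod int a)"
    using z0 by (subst power_int_add) auto
  also have "z powi (int a * (k div int a)) = 1"
    using assms(1) by (simp add: power_int_mult)
  also have "z powi (k mod int a) = z ^ nat (k mod int a)"
    using assms(2) by (simp add: power_int_def)
  finally show ?thesis by simp
qed

lemma free_entries_Symmetric: "free_entries Symmetric n = index_pairs n \<union> (\<lambda>i. (i, i)) ` {..<n}"
  by (auto simp: free_entries_def index_pairs_def)

lemma free_entries_Alternating: "free_entries Alternating n = index_pairs n"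
  by (auto simp: free_entries_def index_pairs_def)

section \<open>Expansion for a fixed matrix\<close>

context finite_abelian
begin

text \<open>Grouping the positions (i, j) and (j, i) and using the relation between their entries
  leaves one power per free entry; this computation dictates \<open>form\<close> and
  \<open>entry_form\<close>.\<close>

lemma prod_pairing_eq_prod_free_entries:
  assumes u: "\<And>i. i < n \<Longrightarrow> u i \<in> carrier VV" and A: "A \<in> mat_space K int_ring n"
  shows "(\<Prod>e\<in>{..<n} \<times> {..<n}. case e of (i, j) \<Rightarrow> pairing (u i) (u j) powi (A $$ (i, j)))
      = (\<Prod>e\<in>free_entries K n. entry_form K u e powi (A $$ e))"
proof (cases K)
  case General
  have "free_entries K n = {..<n} \<times> {..<n}" by (auto simp: free_entries_def General)
  moreover have "(case e of (i, j) \<Rightarrow> pairing (u i) (u j) powi (A $$ (i, j))) = entry_form K u e powi (A $$ e)" for e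
    by (cases e) (simp add: entry_form_def form_def General)
  ultimately show ?thesis by simp
next
  case Symmetric
  have sym: "A $$ (j, i) = A $$ (i, j)" if "i < n" "j < n" for i j
    using A that by (simp add: mat_space_def Symmetric)
  have "(\<Prod>e\<in>{..<n} \<times> {..<n}. case e of (i, j) \<Rightarrow> pairing (u i) (u j) powi (A $$ (i, j)))
     = (\<Prod>e\<in>index_pairs n. entry_form K u e powi (A $$ e)) * (\<Prod>i<n. entry_form K u (i, i) powi (A $$ (i, i)))"
    unfolding prod_square_index_pairs
  proof (intro arg_cong2[of _ _ _ _ "(*)"] prod.cong refl)
    fix e assume "e \<in> index_pairs n"
    then obtain i j where e: "e = (i, j)" "i < j" "j < n" by (auto simp: index_pairs_def)
    show "(case e of (i, j) \<Rightarrow> (case (i, j) of (i, j) \<Rightarrow> pairing (u i) (u j) powi (A $$ (i, j))) *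
        (case (j, i) of (i, j) \<Rightarrow> pairing (u i) (u j) powi (A $$ (i, j)))) = entry_form K u e powi (A $$ e)"
      using e sym[of i j] by (simp add: entry_form_def form_def Symmetric power_int_mult_distrib)
  qed (simp add: entry_form_def)
  also have "(\<Prod>i<n. entry_form K u (i, i) powi (A $$ (i, i))) = (\<Prod>e\<in>(\<lambda>i. (i, i)) ` {..<n}. entry_form K u e powi (A $$ e))"
    by (subst prod.reindex) (auto simp: inj_on_def)
  also have "(\<Prod>e\<in>index_pairs n. entry_form K u e powi (A $$ e)) * \<dots> = (\<Prod>e\<in>free_entries K n. entry_form K u e powi (A $$ e))"
    unfolding Symmetric free_entries_Symmetric by (subst prod.union_disjoint[OF finite_index_pairs]) (auto simp: index_pairs_def)
  finally show ?thesis .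
next
  case Alternating
  have alt: "A $$ (j, i) = - (A $$ (i, j))" "A $$ (i, i) = 0" if "i < n" "j < n" for i j
    using A that unfolding mat_space_def Alternating mat_kind.case int_a_inv_eq int_zero_eq by blast+
  have "(\<Prod>e\<in>{..<n} \<times> {..<n}. case e of (i, j) \<Rightarrow> pairing (u i) (u j) powi (A $$ (i, j)))
     = (\<Prod>e\<in>index_pairs n. entry_form K u e powi (A $$ e)) * (\<Prod>i<n. 1)"
    unfolding prod_square_index_pairs
  proof (intro arg_cong2[of _ _ _ _ "(*)"] prod.cong refl)
    fix e assume "e \<in> index_pairs n"
    then obtain i j where e: "e = (i, j)" "i < j" "j < n" by (auto simp: index_pairs_def)
    have n1: "cmod (pairing (u j) (u i)) = 1" using norm_pairing u e by simp
    \<comment> \<open>The sign in A_ji = - A_ij inverts the base, and on the circle the inverse is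
      the conjugate.\<close>
    have "pairing (u j) (u i) powi (A $$ (j, i)) = cnj (pairing (u j) (u i)) powi (A $$ (i, j))"
      using alt(1)[of i j] e by (simp add: cnj_eq_inverse[OF n1] power_int_minus power_int_inverse)
    then show "(case e of (i, j) \<Rightarrow> (case (i, j) of (i, j) \<Rightarrow> pairing (u i) (u j) powi (A $$ (i, j))) *
        (case (j, i) of (i, j) \<Rightarrow> pairing (u i) (u j) powi (A $$ (i, j)))) = entry_form K u e powi (A $$ e)"
      using e by (simp add: entry_form_def form_def Alternating power_int_mult_distrib)
  qed (use alt(2) in simp)
  then show ?thesis by (simp add: Alternating free_entries_Alternating)
qed

lemma entry_form_power_order:
  assumes u: "\<And>i. i < n \<Longrightarrow> u i \<in> carrier VV" and e: "e \<in> free_entries K n"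
  shows "entry_form K u e ^ order G = 1"
proof -
  obtain i j where ij: "e = (i, j)" "i < n" "j < n" using e free_entries_subset[of K n] by auto
  then show ?thesis
    using form_power_order[OF u[OF ij(2)] u[OF ij(3)], of K] pairing_power_order[OF u[OF ij(2)] u[OF ij(2)]]
    by (auto simp: entry_form_def)
qed

text \<open>There is one equation per column, hence one character C j per column: |G| times the
  indicator of an equation is the sum of all characters at its left side, and expanding the product
  over j gives the sum over families.\<close>

lemma solves_fourier:
  assumes f: "f \<in> {..<n} \<rightarrow>\<^sub>E carrier G" and A: "A \<in> mat_space K int_ring n"
  shows "of_nat (order G) ^ n * (of_bool (solves G n A f) :: complex)
     = (\<Sum>C\<in>{..<n} \<rightarrow>\<^sub>E chars G. \<Prod>e\<in>free_entries K n. entry_form K (\<lambda>i. (f i, C i)) e ^ nat (A $$ e mod int (order G)))"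
proof -
  have fc: "f i \<in> carrier G" if "i < n" for i using f that by auto
  define y where "y j = (\<Otimes>i\<in>{..<n}. f i [^] (A $$ (i, j)))" for j
  have yc: "y j \<in> carrier G" for j unfolding y_def using fc by (intro finprod_closed) auto
  have "of_nat (order G) ^ n * (of_bool (solves G n A f) :: complex) = (\<Prod>j<n. of_nat (order G) * (of_bool (y j = \<one>)))"
    by (auto simp: solves_def y_def prod.distrib)
  also have "\<dots> = (\<Prod>j<n. \<Sum>\<xi>\<in>chars G. \<xi> (y j))"
    by (intro prod.cong) (auto simp: sum_chars_at[OF comm_group_axioms fin yc] card_chars[OF comm_group_axioms fin])
  also have "\<dots> = (\<Sum>C\<in>{..<n} \<rightarrow>\<^sub>E chars G. \<Prod>j<n. C j (y j))"
    using finite_chars[OF is_group fin] by (intro prod_sum_PiE) auto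
  also have "\<dots> = (\<Sum>C\<in>{..<n} \<rightarrow>\<^sub>E chars G. \<Prod>e\<in>free_entries K n. entry_form K (\<lambda>i. (f i, C i)) e ^ nat (A $$ e mod int (order G)))"
  proof (rule sum.cong)
    fix C assume C: "C \<in> {..<n} \<rightarrow>\<^sub>E chars G"
    let ?u = "\<lambda>i. (f i, C i)"
    have u: "?u i \<in> carrier VV" if "i < n" for i using C fc that by auto
    have "C j (y j) = (\<Prod>i<n. pairing (?u i) (?u j) powi (A $$ (i, j)))" if j: "j < n" for j
    proof -
      have Cj: "C j \<in> chars G" using C j by auto
      have "C j (y j) = (\<Prod>i<n. C j (f i [^] (A $$ (i, j))))"
        unfolding y_def using fc by (intro char_finprod[OF Cj]) auto
      also have "\<dots> = (\<Prod>i<n. pairing (?u i) (?u j) powi (A $$ (i, j)))"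
        using fc by (intro prod.cong) (auto simp: chars_int_pow[OF is_group Cj] pairing_def)
      finally show ?thesis .
    qed
    then have "(\<Prod>j<n. C j (y j)) = (\<Prod>j<n. \<Prod>i<n. pairing (?u i) (?u j) powi (A $$ (i, j)))"
      by (intro prod.cong) auto
    also have "\<dots> = (\<Prod>i<n. \<Prod>j<n. pairing (?u i) (?u j) powi (A $$ (i, j)))"
      by (rule prod.swap)
    also have "\<dots> = (\<Prod>e\<in>{..<n} \<times> {..<n}. case e of (i, j) \<Rightarrow> pairing (?u i) (?u j) powi (A $$ (i, j)))"
      by (simp add: prod.cartesian_product)
    also have "\<dots> = (\<Prod>e\<in>free_entries K n. entry_form K ?u e powi (A $$ e))"
      by (rule prod_pairing_eq_prod_free_entries[OF u A])
    also have "\<dots> = (\<Prod>e\<in>free_entries K n. entry_form K ?u e ^ nat (A $$ e mod int (order G)))"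
      by (intro prod.cong refl powi_eq_power_mod entry_form_power_order[OF u] order_pos) auto
    finally show "(\<Prod>j<n. C j (y j)) = (\<Prod>e\<in>free_entries K n. entry_form K ?u e ^ nat (A $$ e mod int (order G)))" .
  qed simp
  finally show ?thesis .
qed

lemma finite_generating: "finite (generating G n)"
proof (rule finite_subset)
  show "generating G n \<subseteq> {..<n} \<rightarrow>\<^sub>E carrier G" unfolding generating_def by blast
  show "finite ({..<n} \<rightarrow>\<^sub>E carrier G)" using fin by (intro finite_PiE) simp_all
qed

section \<open>Expectation over the random matrix\<close>

definition entry_law :: "'w measure \<Rightarrow> ('w \<Rightarrow> int mat) \<Rightarrow> nat \<times> nat \<Rightarrow> nat \<Rightarrow> real" where
  "entry_law M A e = residue_law M (order G) (\<lambda>\<omega>. A \<omega> $$ e)"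

context
  fixes M :: "'w measure" and A :: "'w \<Rightarrow> int mat" and K :: mat_kind and n :: nat and \<alpha> :: real
  assumes M: "prob_space M" and rand: "random_matrix M K int_ring n A" and bal: "balanced_mat M \<alpha> K n A"
    and \<alpha>: "0 < \<alpha>" "\<alpha> \<le> 1/2"
begin

lemma A_mat_space: "\<omega> \<in> space M \<Longrightarrow> A \<omega> \<in> mat_space K int_ring n"
  using measurable_space[OF rand[unfolded random_matrix_def]] by simp

lemma A_carrier: "\<omega> \<in> space M \<Longrightarrow> A \<omega> \<in> carrier_mat n n"
  using A_mat_space[of \<omega>] by (simp add: mat_space_def)

lemma entry_measurable: "(\<lambda>\<omega>. A \<omega> $$ e) \<in> measurable M (count_space UNIV)"
  using rand unfolding random_matrix_def by (rule measurable_compose) simp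

lemma entry_mod:
  assumes "e \<in> free_entries K n" "\<omega> \<in> space M"
  shows "map_mat (\<lambda>a. a mod p) (A \<omega>) $$ e = A \<omega> $$ e mod p"
proof -
  obtain i j where "e = (i, j)" "i < n" "j < n" using assms free_entries_subset[of K n] by auto
  then show ?thesis using A_carrier[OF assms(2)] by simp
qed

lemma balanced_entry_law:
  assumes e: "e \<in> free_entries K n"
  shows "balanced_law (order G) \<alpha> (entry_law M A e)"
  unfolding entry_law_def
proof (rule prob_space.balanced_residue_law[OF M entry_measurable order_pos])
  show "\<alpha> \<le> 1" using \<alpha> by simp
  fix q r :: nat assume q: "prime q" "r < q"
  have "balanced_elem M \<alpha> (int q) (\<lambda>\<omega>. map_mat (\<lambda>a. a mod int q) (A \<omega>) $$ e)"
    using bal e q(1) unfolding balanced_mat_def balanced_mat_mod_def by simp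
  moreover have "int r \<in> carrier (residue_ring (int q))" using q by (simp add: residue_ring_def)
  ultimately have "measure M {\<omega> \<in> space M. map_mat (\<lambda>a. a mod int q) (A \<omega>) $$ e = int r} \<le> 1 - \<alpha>"
    unfolding balanced_elem_def by blast
  moreover have "{\<omega> \<in> space M. map_mat (\<lambda>a. a mod int q) (A \<omega>) $$ e = int r} = {\<omega> \<in> space M. A \<omega> $$ e mod int q = int r}"
    using entry_mod[OF e] by auto
  ultimately show "measure M {\<omega> \<in> space M. A \<omega> $$ e mod int q = int r} \<le> 1 - \<alpha>" by simp
qed

lemma integral_prod_entries:
  assumes z: "\<And>e. e \<in> free_entries K n \<Longrightarrow> cmod (z e) = 1"
  shows "(\<integral>\<omega>. (\<Prod>e\<in>free_entries K n. z e ^ nat (A \<omega> $$ e mod int (order G))) \<partial>M)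
     = (\<Prod>e\<in>free_entries K n. char_fun (order G) (entry_law M A e) (z e))"
proof -
  have "(\<integral>\<omega>. (\<Prod>e\<in>free_entries K n. z e ^ nat (A \<omega> $$ e mod int (order G))) \<partial>M)
    = (\<Prod>e\<in>free_entries K n. \<integral>\<omega>. z e ^ nat (A \<omega> $$ e mod int (order G)) \<partial>M)"
  proof (rule prob_space.integral_prod_of_indep_mod_primes[OF M, where B = "\<lambda>p e \<omega>. map_mat (\<lambda>a. a mod p) (A \<omega>) $$ e"
        and X = "\<lambda>e \<omega>. A \<omega> $$ e" and h = "\<lambda>e x. z e ^ nat (x mod int (order G))"])
    show "prob_space.indep_vars M (\<lambda>_. count_space (carrier (residue_ring p))) (\<lambda>e \<omega>. map_mat (\<lambda>a. a mod p) (A \<omega>) $$ e) (free_entries K n)"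
      if "prime p" for p
      using bal that unfolding balanced_mat_def balanced_mat_mod_def by blast
  qed (use entry_measurable entry_mod z in \<open>simp_all add: norm_power\<close>)
  also have "\<dots> = (\<Prod>e\<in>free_entries K n. char_fun (order G) (entry_law M A e) (z e))"
    unfolding entry_law_def
    by (intro prod.cong refl prob_space.integral_power_residue[OF M entry_measurable order_pos])
  finally show ?thesis .
qed

text \<open>The expansion is a finite sum of bounded terms, so the expectation is taken termwise,
  and independence splits each term into characteristic functions of entries.\<close>

lemma expected_surjections:
  "of_nat (order G) ^ n * complex_of_real (\<integral>\<omega>. real (card (Sur (cok n (A \<omega>)) G)) \<partial>M)
     = (\<Sum>f\<in>generating G n. \<Sum>C\<in>{..<n} \<rightarrow>\<^sub>E chars G.
          \<Prod>e\<in>free_entries K n. char_fun (order G) (entry_law M A e) (entry_form K (\<lambda>i. (f i, C i)) e))"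
proof -
  interpret M: prob_space M by (rule M)
  let ?t = "\<lambda>f C \<omega>. \<Prod>e\<in>free_entries K n. entry_form K (\<lambda>i. (f i, C i)) e ^ nat (A \<omega> $$ e mod int (order G))"
  have VV: "(f i, C i) \<in> carrier VV" if "f \<in> generating G n" "C \<in> {..<n} \<rightarrow>\<^sub>E chars G" "i < n" for f C i
    using that by (auto simp: generating_def)
  have norm1: "cmod (entry_form K (\<lambda>i. (f i, C i)) e) = 1"
    if "f \<in> generating G n" "C \<in> {..<n} \<rightarrow>\<^sub>E chars G" "e \<in> free_entries K n" for f C e
    using entry_form_power_order[OF VV[OF that(1,2)] that(3)] order_pos by (rule root_of_unity_norm)
  have int: "integrable M (?t f C)" if "f \<in> generating G n" "C \<in> {..<n} \<rightarrow>\<^sub>E chars G" for f C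
  proof (rule M.integrable_const_bound[of _ 1])
    show "AE \<omega> in M. cmod (?t f C \<omega>) \<le> 1"
      using norm1[OF that] by (intro AE_I2) (simp add: prod_norm[symmetric] norm_power)
    show "?t f C \<in> borel_measurable M"
      by (intro borel_measurable_prod measurable_compose[OF entry_measurable]) simp
  qed
  have "of_nat (order G) ^ n * complex_of_real (\<integral>\<omega>. real (card (Sur (cok n (A \<omega>)) G)) \<partial>M)
     = (\<integral>\<omega>. of_nat (order G) ^ n * complex_of_real (real (card (Sur (cok n (A \<omega>)) G))) \<partial>M)"
    by (simp only: integral_mult_right_zero integral_complex_of_real)
  also have "\<dots> = (\<integral>\<omega>. (\<Sum>f\<in>generating G n. \<Sum>C\<in>{..<n} \<rightarrow>\<^sub>E chars G. ?t f C \<omega>) \<partial>M)"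
  proof (rule Bochner_Integration.integral_cong)
    fix \<omega> assume w: "\<omega> \<in> space M"
    have "complex_of_real (real (card (Sur (cok n (A \<omega>)) G))) = (\<Sum>f\<in>generating G n. of_bool (solves G n (A \<omega>) f))"
      unfolding card_Sur_cok[OF A_carrier[OF w]] using finite_generating by (simp add: sum.If_cases of_bool_def Int_def)
    then have "of_nat (order G) ^ n * complex_of_real (real (card (Sur (cok n (A \<omega>)) G)))
       = (\<Sum>f\<in>generating G n. of_nat (order G) ^ n * of_bool (solves G n (A \<omega>) f))"
      by (simp only: sum_distrib_left)
    also have "\<dots> = (\<Sum>f\<in>generating G n. \<Sum>C\<in>{..<n} \<rightarrow>\<^sub>E chars G. ?t f C \<omega>)"
      by (intro sum.cong refl solves_fourier A_mat_space[OF w]) (simp add: generating_def)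
    finally show "of_nat (order G) ^ n * complex_of_real (real (card (Sur (cok n (A \<omega>)) G)))
       = (\<Sum>f\<in>generating G n. \<Sum>C\<in>{..<n} \<rightarrow>\<^sub>E chars G. ?t f C \<omega>)" .
  qed simp
  also have "\<dots> = (\<Sum>f\<in>generating G n. \<Sum>C\<in>{..<n} \<rightarrow>\<^sub>E chars G. \<integral>\<omega>. ?t f C \<omega> \<partial>M)"
    using int by (simp add: Bochner_Integration.integral_sum Bochner_Integration.integrable_sum)
  also have "\<dots> = (\<Sum>f\<in>generating G n. \<Sum>C\<in>{..<n} \<rightarrow>\<^sub>E chars G.
          \<Prod>e\<in>free_entries K n. char_fun (order G) (entry_law M A e) (entry_form K (\<lambda>i. (f i, C i)) e))"
    by (intro sum.cong refl integral_prod_entries norm1)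
  finally show ?thesis .
qed

lemma pair_weights_entry_law:
  "pair_weights (carrier VV) (order G) (form_orth K) (isotropic K) n (off_diag_weight K n (order G) (entry_law M A))
     (diag_weight K n (order G) (entry_law M A)) (special K n) \<alpha> (root_gap (order G) / 2)"
  by (rule pair_weights_fourier[OF \<alpha> balanced_entry_law])

abbreviation "wt \<equiv> pair_weights.weight n (off_diag_weight K n (order G) (entry_law M A)) (diag_weight K n (order G) (entry_law M A))"

text \<open>A special pair (f, C) contributes exactly 1, all characteristic functions being
  evaluated at 1, and \<open>card_special\<close> counts these C for each generating f. The error
  sum is enlarged by dropping the condition that f generates.\<close>

lemma expected_surjections_error:
  "cmod (of_nat (order G) ^ n * complex_of_real (\<integral>\<omega>. real (card (Sur (cok n (A \<omega>)) G)) \<partial>M)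
      - of_nat (card (generating G n) * (case K of General \<Rightarrow> 1 | Symmetric \<Rightarrow> order (wedge_square G) | Alternating \<Rightarrow> order (sym_square G))))
   \<le> (\<Sum>u | u \<in> {..<n} \<rightarrow>\<^sub>E carrier VV \<and> \<not> special K n u. wt u)"
proof -
  let ?S = "case K of General \<Rightarrow> 1 | Symmetric \<Rightarrow> order (wedge_square G) | Alternating \<Rightarrow> order (sym_square G)"
  let ?CC = "{..<n} \<rightarrow>\<^sub>E chars G"
  let ?u = "\<lambda>f C i. (f i, C i)"
  let ?p = "\<lambda>u. \<Prod>e\<in>free_entries K n. char_fun (order G) (entry_law M A e) (entry_form K u e)"
  let ?N = "{z \<in> generating G n \<times> ?CC. \<not> special K n (?u (fst z) (snd z))}"
  have finC: "finite ?CC" using finite_chars[OF is_group fin] by (intro finite_PiE) auto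
  have "(\<Sum>C\<in>?CC. ?p (?u f C)) = of_nat ?S + (\<Sum>C\<in>{C \<in> ?CC. \<not> special K n (?u f C)}. ?p (?u f C))" if f: "f \<in> generating G n" for f
  proof -
    have "(\<Sum>C\<in>?CC. ?p (?u f C)) = (\<Sum>C\<in>{C \<in> ?CC. special K n (?u f C)}. ?p (?u f C)) + (\<Sum>C\<in>{C \<in> ?CC. \<not> special K n (?u f C)}. ?p (?u f C))"
      using finC by (subst sum.union_disjoint[symmetric]) (auto intro!: sum.cong)
    also have "(\<Sum>C\<in>{C \<in> ?CC. special K n (?u f C)}. ?p (?u f C)) = (\<Sum>C\<in>{C \<in> ?CC. special K n (?u f C)}. 1)"
      by (intro sum.cong refl prod.neutral) (auto simp: special_def char_fun_one[OF balanced_entry_law])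
    also have "\<dots> = of_nat ?S"
    proof -
      have "card {C \<in> ?CC. special K n (?u f C)} = ?S"
        using f by (intro card_special) (auto simp: generating_def)
      then show ?thesis by simp
    qed
    finally show ?thesis .
  qed
  then have "of_nat (order G) ^ n * complex_of_real (\<integral>\<omega>. real (card (Sur (cok n (A \<omega>)) G)) \<partial>M)
     = of_nat (card (generating G n) * ?S) + (\<Sum>f\<in>generating G n. \<Sum>C\<in>{C \<in> ?CC. \<not> special K n (?u f C)}. ?p (?u f C))"
    unfolding expected_surjections by (simp add: sum.distrib)
  moreover have "(\<Sum>f\<in>generating G n. \<Sum>C\<in>{C \<in> ?CC. \<not> special K n (?u f C)}. ?p (?u f C)) = (\<Sum>z\<in>?N. ?p (?u (fst z) (snd z)))"
    using finC finite_generating by (subst sum.Sigma) (auto intro!: sum.cong)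
  ultimately have "cmod (of_nat (order G) ^ n * complex_of_real (\<integral>\<omega>. real (card (Sur (cok n (A \<omega>)) G)) \<partial>M)
      - of_nat (card (generating G n) * ?S)) = cmod (\<Sum>z\<in>?N. ?p (?u (fst z) (snd z)))"
    by simp
  also have "\<dots> \<le> (\<Sum>z\<in>?N. cmod (?p (?u (fst z) (snd z))))"
    by (rule norm_sum)
  also have "\<dots> \<le> (\<Sum>u | u \<in> {..<n} \<rightarrow>\<^sub>E carrier VV \<and> \<not> special K n u. wt u)"
  \<comment> \<open>Splitting u into its two coordinate families recovers the pair (f, C), so
    distinct pairs are charged to distinct assignments.\<close>
  proof (rule sum_le_included[where i = "\<lambda>u. (\<lambda>i\<in>{..<n}. fst (u i), \<lambda>i\<in>{..<n}. snd (u i))"])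
    interpret W: pair_weights "carrier VV" "order G" "form_orth K" "isotropic K" n
      "off_diag_weight K n (order G) (entry_law M A)" "diag_weight K n (order G) (entry_law M A)" "special K n" \<alpha> "root_gap (order G) / 2"
      by (rule pair_weights_entry_law)
    show "finite ?N" using finC finite_generating by auto
    show "finite {u. u \<in> {..<n} \<rightarrow>\<^sub>E carrier VV \<and> \<not> special K n u}"
      using W.finite_assignments by (rule rev_finite_subset) blast
    show "\<forall>u\<in>{u. u \<in> {..<n} \<rightarrow>\<^sub>E carrier VV \<and> \<not> special K n u}. 0 \<le> wt u"
      using W.weight_nonneg by blast
    show "\<forall>z\<in>?N. \<exists>u\<in>{u. u \<in> {..<n} \<rightarrow>\<^sub>E carrier VV \<and> \<not> special K n u}.
       (\<lambda>i\<in>{..<n}. fst (u i), \<lambda>i\<in>{..<n}. snd (u i)) = z \<and> cmod (?p (?u (fst z) (snd z))) \<le> wt u"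
    proof
      fix z assume z: "z \<in> ?N"
      obtain f C where fC: "z = (f, C)" "f \<in> generating G n" "C \<in> ?CC" "\<not> special K n (?u f C)" using z by auto
      have f: "f \<in> {..<n} \<rightarrow>\<^sub>E carrier G" using fC(2) by (simp add: generating_def)
      define u where "u = (\<lambda>i\<in>{..<n}. (f i, C i))"
      have ef: "entry_form K u e = entry_form K (?u f C) e" if e: "e \<in> free_entries K n" for e
      proof -
        obtain i j where "e = (i, j)" "i < n" "j < n" using e free_entries_subset[of K n] by auto
        then show ?thesis by (simp add: entry_form_def u_def)
      qed
      have "u \<in> {..<n} \<rightarrow>\<^sub>E carrier VV" unfolding u_def using f fC(3) by auto
      moreover have "\<not> special K n u" using fC(4) ef by (simp add: special_def)
      moreover have "(\<lambda>i\<in>{..<n}. fst (u i)) = f"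
        by (rule extensionalityI[of _ "{..<n}"]) (use f in \<open>simp_all add: u_def PiE_iff\<close>)
      moreover have "(\<lambda>i\<in>{..<n}. snd (u i)) = C"
        by (rule extensionalityI[of _ "{..<n}"]) (use fC(3) in \<open>simp_all add: u_def PiE_iff\<close>)
      moreover have "cmod (?p (?u f C)) = wt u"
      proof -
        have "cmod (?p (?u f C)) = (\<Prod>e\<in>free_entries K n. cmod (char_fun (order G) (entry_law M A e) (entry_form K u e)))"
          using ef by (simp add: prod_norm[symmetric])
        also have "\<dots> = wt u" by (rule prod_entries_eq_weight[OF \<alpha> balanced_entry_law])
        finally show ?thesis .
      qed
      ultimately show "\<exists>u\<in>{u. u \<in> {..<n} \<rightarrow>\<^sub>E carrier VV \<and> \<not> special K n u}.
         (\<lambda>i\<in>{..<n}. fst (u i), \<lambda>i\<in>{..<n}. snd (u i)) = z \<and> cmod (?p (?u (fst z) (snd z))) \<le> wt u"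
        unfolding fC(1) by (intro bexI[of _ u]) simp_all
    qed
  qed
  finally show ?thesis .
qed

end

text \<open>A tuple that does not generate has all its values in a proper subset of G. There are at
  most 2^N such subsets, each allowing at most (N - 1)^n tuples, a negligible part of N^n.\<close>

lemma card_generating_asymp: "(\<lambda>n. real (card (generating G n)) / real (order G) ^ n) \<longlonglongrightarrow> 1"
proof -
  let ?N = "order G"
  have N1: "real ?N \<ge> 1" using order_pos by linarith
  let ?r = "(real ?N - 1) / real ?N"
  have lim: "(\<lambda>n. 1 - 2 ^ ?N * ?r ^ n) \<longlonglongrightarrow> 1 - 2 ^ ?N * 0"
  proof (intro tendsto_intros LIMSEQ_power_zero)
    have "0 \<le> ?r" "?r < 1" using N1 by (simp_all add: divide_less_eq)
    then show "norm ?r < 1" by simp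
  qed
  show ?thesis
  proof (rule tendsto_sandwich[of "\<lambda>n. 1 - 2 ^ ?N * ?r ^ n" _ _ "\<lambda>_. 1"])
    show "eventually (\<lambda>n. real (card (generating G n)) / real ?N ^ n \<le> 1) sequentially"
    proof (rule always_eventually, rule allI)
      fix n :: nat
      have "card (generating G n) \<le> card ({..<n} \<rightarrow>\<^sub>E carrier G)"
        unfolding generating_def using fin by (intro card_mono finite_PiE) auto
      also have "\<dots> = ?N ^ n" by (simp add: card_PiE order_def)
      finally have "real (card (generating G n)) \<le> real ?N ^ n" by (metis of_nat_le_iff of_nat_power)
      then show "real (card (generating G n)) / real ?N ^ n \<le> 1" using N1 by (simp add: divide_le_eq)
    qed
    show "eventually (\<lambda>n. 1 - 2 ^ ?N * ?r ^ n \<le> real (card (generating G n)) / real ?N ^ n) sequentially"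
    proof (rule always_eventually, rule allI)
      fix n :: nat
      let ?P = "{..<n} \<rightarrow>\<^sub>E carrier G"
      let ?HH = "{H \<in> Pow (carrier G). H \<noteq> carrier G}"
      have finP: "finite ?P" using fin by (intro finite_PiE) auto
      have sub: "?P - generating G n \<subseteq> (\<Union>H\<in>?HH. {..<n} \<rightarrow>\<^sub>E H)"
      proof
        fix f assume f: "f \<in> ?P - generating G n"
        then have fP: "f \<in> ?P" and ne: "generate G (f ` {..<n}) \<noteq> carrier G" by (auto simp: generating_def)
        have sub: "f ` {..<n} \<subseteq> carrier G" using fP by auto
        have "f \<in> {..<n} \<rightarrow>\<^sub>E generate G (f ` {..<n})"
        proof (rule PiE_I)
          show "f i \<in> generate G (f ` {..<n})" if "i \<in> {..<n}" for i
            using that by (intro generate.incl) auto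
        qed (use fP in \<open>rule PiE_arb\<close>)
        then show "f \<in> (\<Union>H\<in>?HH. {..<n} \<rightarrow>\<^sub>E H)" using ne generate_incl[OF sub] by blast
      qed
      have "card (?P - generating G n) \<le> card (\<Union>H\<in>?HH. {..<n} \<rightarrow>\<^sub>E H)"
        using fin by (intro card_mono sub finite_UN_I finite_PiE) (auto intro: finite_subset)
      also have "\<dots> \<le> (\<Sum>H\<in>?HH. card ({..<n} \<rightarrow>\<^sub>E H))"
        using fin by (intro card_UN_le) auto
      also have "\<dots> \<le> (\<Sum>H\<in>?HH. (?N - 1) ^ n)"
      proof (rule sum_mono)
        fix H assume "H \<in> ?HH"
        then have "card H < ?N" unfolding order_def using fin by (intro psubset_card_mono) auto
        then have "card H ^ n \<le> (?N - 1) ^ n" by (intro power_mono) auto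
        then show "card ({..<n} \<rightarrow>\<^sub>E H) \<le> (?N - 1) ^ n" by (simp add: card_PiE)
      qed
      also have "\<dots> = card ?HH * (?N - 1) ^ n" by simp
      also have "\<dots> \<le> 2 ^ ?N * (?N - 1) ^ n"
      proof (rule mult_right_mono)
        have "card ?HH \<le> card (Pow (carrier G))" using fin by (intro card_mono) auto
        then show "card ?HH \<le> 2 ^ ?N" using fin by (simp add: card_Pow order_def)
      qed simp
      finally have 1: "card (?P - generating G n) \<le> 2 ^ ?N * (?N - 1) ^ n" .
      have gs: "generating G n \<subseteq> ?P" by (auto simp: generating_def)
      have "card ?P = card (?P - generating G n) + card (generating G n)"
        using card_Diff_subset[OF finite_subset[OF gs finP] gs] card_mono[OF finP gs] by simp
      then have "?N ^ n \<le> 2 ^ ?N * (?N - 1) ^ n + card (generating G n)"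
        using 1 by (simp add: card_PiE order_def)
      then have "real (?N ^ n) \<le> real (2 ^ ?N * (?N - 1) ^ n + card (generating G n))" by (simp only: of_nat_le_iff)
      then have "real ?N ^ n \<le> 2 ^ ?N * (real ?N - 1) ^ n + real (card (generating G n))"
        using order_pos by (simp add: of_nat_diff)
      then have "(real ?N ^ n - 2 ^ ?N * (real ?N - 1) ^ n) / real ?N ^ n \<le> real (card (generating G n)) / real ?N ^ n"
        using N1 by (intro divide_right_mono) auto
      moreover have "1 - 2 ^ ?N * ?r ^ n = (real ?N ^ n - 2 ^ ?N * (real ?N - 1) ^ n) / real ?N ^ n"
        unfolding power_divide using N1 by (simp only: diff_divide_distrib[of "real ?N ^ n"] times_divide_eq_right) simp
      ultimately show "1 - 2 ^ ?N * ?r ^ n \<le> real (card (generating G n)) / real ?N ^ n" by (simp only:)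
    qed
  qed (use lim in simp_all)
qed

end

theorem theorem6p2:
  fixes c :: real
    and \<alpha> :: "nat \<Rightarrow> real"
    and K :: mat_kind
    and M :: "nat \<Rightarrow> 'w measure"
    and A :: "nat \<Rightarrow> 'w \<Rightarrow> int mat"
    and G :: "('g, 'm) monoid_scheme"
  assumes "c > 1"
    and "\<And>n. n \<ge> 1 \<Longrightarrow> \<alpha> n = c * ln (real n) / real n"
    and "\<And>n. n \<ge> 1 \<Longrightarrow> prob_space (M n)"
    and "\<And>n. n \<ge> 1 \<Longrightarrow> random_matrix (M n) K int_ring n (A n)"
    and "\<And>n. n \<ge> 1 \<Longrightarrow> \<alpha> n \<in> {0<..1/2} \<Longrightarrow> balanced_mat (M n) (\<alpha> n) K n (A n)"
    and "comm_group G"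
    and "finite (carrier G)"
  shows "(\<lambda>n. \<integral>\<omega>. real (card (Sur (cok n (A n \<omega>)) G)) \<partial>(M n)) \<longlonglongrightarrow>
           (case K of
              General \<Rightarrow> 1
            | Symmetric \<Rightarrow> real (order (wedge_square G))
            | Alternating \<Rightarrow> real (order (sym_square G)))"
proof -
  interpret finite_abelian G
    using assms(6,7) by (simp add: finite_abelian_def finite_abelian_axioms_def)
  let ?N = "order G"
  let ?S = "case K of General \<Rightarrow> 1 | Symmetric \<Rightarrow> order (wedge_square G) | Alternating \<Rightarrow> order (sym_square G)"
  let ?E = "\<lambda>n. \<integral>\<omega>. real (card (Sur (cok n (A n \<omega>)) G)) \<partial>(M n)"
  let ?p = "\<lambda>n. entry_law (M n) (A n)"
  let ?\<theta> = "\<lambda>n. off_diag_weight K n ?N (?p n)" and ?\<delta> = "\<lambda>n. diag_weight K n ?N (?p n)"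
  let ?bad = "\<lambda>n. (\<Sum>u | u \<in> {..<n} \<rightarrow>\<^sub>E carrier VV \<and> \<not> special K n u. pair_weights.weight n (?\<theta> n) (?\<delta> n) u)"
  have N0: "real ?N > 0" using order_pos by simp
  \<comment> \<open>Balance is assumed only for \<alpha> n in (0, 1/2], which holds for all large n;
    at n = 1 it fails because ln 1 = 0.\<close>
  have ev: "eventually (\<lambda>n. n \<ge> 1 \<and> 0 < \<alpha> n \<and> \<alpha> n \<le> 1/2) sequentially"
  proof -
    have "(\<lambda>n. c * ln (real n) / real n) \<longlonglongrightarrow> 0" by real_asymp
    then have "eventually (\<lambda>n. c * ln (real n) / real n < 1/2) sequentially"
      by (rule order_tendstoD) simp
    then show ?thesis
      using eventually_ge_at_top[of 2]
    proof eventually_elim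
      case (elim n)
      then show ?case using assms(1) assms(2)[of n] by auto
    qed
  qed
  have bad: "(\<lambda>n. ?bad n / real ?N ^ n) \<longlonglongrightarrow> 0"
  proof (rule sum_bad_tendsto_0[OF assms(1) _ order_pos assms(2)])
    show "0 < root_gap ?N / 2" using root_gap(1)[OF order_pos] by simp
    show "eventually (\<lambda>n. pair_weights (carrier VV) ?N (form_orth K) (isotropic K) n (?\<theta> n) (?\<delta> n) (special K n) (\<alpha> n) (root_gap ?N / 2)) sequentially"
      using ev
    proof eventually_elim
      case (elim n)
      then show ?case using assms(3-5)[of n] by (intro pair_weights_entry_law) auto
    qed
  qed
  \<comment> \<open>The comparison is with the limit times the proportion of generating tuples,
    which itself tends to 1.\<close>
  have err: "(\<lambda>n. ?E n - real (card (generating G n)) / real ?N ^ n * real ?S) \<longlonglongrightarrow> 0"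
  proof (rule Lim_null_comparison[OF _ bad])
    show "eventually (\<lambda>n. norm (?E n - real (card (generating G n)) / real ?N ^ n * real ?S) \<le> ?bad n / real ?N ^ n) sequentially"
      using ev
    proof eventually_elim
      case (elim n)
      have "cmod (of_nat ?N ^ n * complex_of_real (?E n) - of_nat (card (generating G n) * ?S)) \<le> ?bad n"
        using elim assms(3-5)[of n] by (intro expected_surjections_error) auto
      also have "of_nat ?N ^ n * complex_of_real (?E n) - of_nat (card (generating G n) * ?S)
         = complex_of_real (real ?N ^ n * (?E n - real (card (generating G n)) / real ?N ^ n * real ?S))"
        using N0 by (simp add: algebra_simps)
      finally have "real ?N ^ n * \<bar>?E n - real (card (generating G n)) / real ?N ^ n * real ?S\<bar> \<le> ?bad n"
        unfolding norm_of_real by (simp add: abs_mult)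
      then show ?case using N0 by (simp add: le_divide_eq mult.commute)
    qed
  qed
  have "(\<lambda>n. (?E n - real (card (generating G n)) / real ?N ^ n * real ?S) + real (card (generating G n)) / real ?N ^ n * real ?S) \<longlonglongrightarrow> 0 + 1 * real ?S"
    by (intro tendsto_add err tendsto_mult card_generating_asymp tendsto_const)
  then have "?E \<longlonglongrightarrow> real ?S" by simp
  also have "real ?S = (case K of General \<Rightarrow> 1 | Symmetric \<Rightarrow> real (order (wedge_square G)) | Alternating \<Rightarrow> real (order (sym_square G)))"
    by (cases K) auto
  finally show ?thesis .
qed

end
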